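(* Let $p$ be a prime. For any positive integer $n$ we have $$\dim_{\mathbb{F}_p}\big(HH^1(\mathbb{F}_p\mathfrak{S}_n)\big)=\begin{cases}2F_2(n) & \text{if } p=2,\\ F_p(n) & \text{if } p\ge 3.\end{cases}$$
   Context: $\mathfrak{S}_n$ is the symmetric group on $n$ letters, $\mathbb{F}_p\mathfrak{S}_n$ its group algebra over the field with $p$ elements, and $HH^r(A)=\mathrm{Ext}^r_{A\otimes A^{\mathrm{op}}}(A,A)$ denotes degree $r$ Hochschild cohomology of an algebra $A$ over the base field (here $\mathbb{F}_p$). For a partition $\lambda$ of $n$ (written $\lambda\vdash n$), $\lambda_k$ denotes the number of parts of $\lambda$ of length (size) exactly $k$. For integers $n\ge 0$, $k\ge 1$, $F_k(n)=\sum_{\lambda\vdash n}\lambda_k$ is the total number of parts of length $k$ in all partitions of $n$. *)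

theory Defs
  imports
    "HOL-Algebra.Sym_Groups"
    "HOL-Algebra.QuotRing"
    "HOL-Number_Theory.Residues"
    "HOL-Library.FSet"
    "HOL-Library.Multiset"
    "Jordan_Normal_Form.Missing_VectorSpace"
begin

text \<open>
  Algebras over a base ring, and left modules over a possibly noncommutative ring, are carried by
  the record \<open>('r, 'm) module\<close> of HOL-Algebra. The fields \<open>mult\<close> and \<open>one\<close> of a record that only
  serves as a module are irrelevant.
\<close>

section \<open>Free modules and quotients\<close>

definition free_module :: "('r, 'e) ring_scheme \<Rightarrow> 'x set \<Rightarrow> ('r, 'x \<Rightarrow> 'r) module" where
  "free_module R X =
     \<lparr>carrier = {u. (\<forall>x\<in>X. u x \<in> carrier R) \<and> (\<forall>x. x \<notin> X \<longrightarrow> u x = \<zero>\<^bsub>R\<^esub>) \<and> finite {x. u x \<noteq> \<zero>\<^bsub>R\<^esub>}},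
      mult = undefined, one = undefined,
      zero = (\<lambda>x. \<zero>\<^bsub>R\<^esub>), add = (\<lambda>u v x. u x \<oplus>\<^bsub>R\<^esub> v x),
      smult = (\<lambda>r u x. r \<otimes>\<^bsub>R\<^esub> u x)\<rparr>"

definition basis_vec :: "('r, 'e) ring_scheme \<Rightarrow> 'x \<Rightarrow> 'x \<Rightarrow> 'r" where
  "basis_vec R x = (\<lambda>y. if y = x then \<one>\<^bsub>R\<^esub> else \<zero>\<^bsub>R\<^esub>)"

text \<open>The linear map \<open>free_module R X \<rightarrow> M\<close> that sends the basis vector at \<open>x\<close> to \<open>\<phi> x\<close>.\<close>

definition lin_ext ::
  "('r, 'e) ring_scheme \<Rightarrow> 'x set \<Rightarrow> ('r, 'm, 'f) module_scheme \<Rightarrow> ('x \<Rightarrow> 'm) \<Rightarrow> ('x \<Rightarrow> 'r) \<Rightarrow> 'm" where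
  "lin_ext R X M \<phi> u = (\<Oplus>\<^bsub>M\<^esub>x\<in>{x \<in> X. u x \<noteq> \<zero>\<^bsub>R\<^esub>}. u x \<odot>\<^bsub>M\<^esub> \<phi> x)"

definition coset_smult :: "('r, 'm, 'f) module_scheme \<Rightarrow> 'm set \<Rightarrow> 'r \<Rightarrow> 'm set \<Rightarrow> 'm set" where
  "coset_smult M H c X = (\<Union>x\<in>X. H +>\<^bsub>M\<^esub> (c \<odot>\<^bsub>M\<^esub> x))"

definition quotient_module :: "('r, 'm, 'f) module_scheme \<Rightarrow> 'm set \<Rightarrow> ('r, 'm set) module" where
  "quotient_module M H =
     \<lparr>carrier = a_rcosets\<^bsub>M\<^esub> H, mult = undefined, one = undefined,
      zero = H, add = set_add M, smult = coset_smult M H\<rparr>"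

section \<open>Group algebras and enveloping algebras\<close>

text \<open>The monoid algebra \<open>k[G]\<close> with the convolution product; for a group \<open>G\<close> this is the
  group algebra.\<close>

definition monoid_algebra :: "('k, 'e) ring_scheme \<Rightarrow> ('g, 'f) monoid_scheme \<Rightarrow> ('k, 'g \<Rightarrow> 'k) module" where
  "monoid_algebra k G = (free_module k (carrier G))
     \<lparr>mult := (\<lambda>u v z. \<Oplus>\<^bsub>k\<^esub>x\<in>{x \<in> carrier G. u x \<noteq> \<zero>\<^bsub>k\<^esub>}. \<Oplus>\<^bsub>k\<^esub>y\<in>{y \<in> carrier G. v y \<noteq> \<zero>\<^bsub>k\<^esub>}.
                 if x \<otimes>\<^bsub>G\<^esub> y = z then u x \<otimes>\<^bsub>k\<^esub> v y else \<zero>\<^bsub>k\<^esub>),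
      one := basis_vec k \<one>\<^bsub>G\<^esub>\<rparr>"

definition opposite :: "('k, 'a) module \<Rightarrow> ('k, 'a) module" where
  "opposite A = A\<lparr>mult := (\<lambda>a b. b \<otimes>\<^bsub>A\<^esub> a)\<rparr>"

text \<open>
  The tensor product of two \<open>k\<close>-algebras: the free \<open>k\<close>-module on \<open>A \<times> B\<close>, with the product
  \<open>(a, b) (a', b') = (a a', b b')\<close> on its basis, modulo the bilinearity relations. These relations
  span an ideal, so the ideal they generate is the submodule they generate.
\<close>

definition bilinear_relations :: "('k, 'e) ring_scheme \<Rightarrow> ('k, 'a) module \<Rightarrow> ('k, 'b) module \<Rightarrow>
    ('a \<times> 'b \<Rightarrow> 'k) set" where
  "bilinear_relations k A B =
     (let S = monoid_algebra k (A \<times>\<times> B); e = (\<lambda>a b. basis_vec k (a, b)) in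
        {e (a \<oplus>\<^bsub>A\<^esub> a') b \<ominus>\<^bsub>S\<^esub> (e a b \<oplus>\<^bsub>S\<^esub> e a' b) | a a' b.
           a \<in> carrier A \<and> a' \<in> carrier A \<and> b \<in> carrier B}
      \<union> {e a (b \<oplus>\<^bsub>B\<^esub> b') \<ominus>\<^bsub>S\<^esub> (e a b \<oplus>\<^bsub>S\<^esub> e a b') | a b b'.
           a \<in> carrier A \<and> b \<in> carrier B \<and> b' \<in> carrier B}
      \<union> {e (c \<odot>\<^bsub>A\<^esub> a) b \<ominus>\<^bsub>S\<^esub> c \<odot>\<^bsub>S\<^esub> e a b | c a b.
           c \<in> carrier k \<and> a \<in> carrier A \<and> b \<in> carrier B}
      \<union> {e a (c \<odot>\<^bsub>B\<^esub> b) \<ominus>\<^bsub>S\<^esub> c \<odot>\<^bsub>S\<^esub> e a b | c a b.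
           c \<in> carrier k \<and> a \<in> carrier A \<and> b \<in> carrier B})"

definition tensor_algebra :: "('k, 'e) ring_scheme \<Rightarrow> ('k, 'a) module \<Rightarrow> ('k, 'b) module \<Rightarrow>
    ('k, ('a \<times> 'b \<Rightarrow> 'k) set) module" where
  "tensor_algebra k A B =
     (let S = monoid_algebra k (A \<times>\<times> B); I = Idl\<^bsub>S\<^esub> (bilinear_relations k A B) in
        ring.extend (S Quot I) (module.fields (coset_smult S I)))"

definition enveloping_algebra :: "('k, 'e) ring_scheme \<Rightarrow> ('k, 'a) module \<Rightarrow>
    ('k, ('a \<times> 'a \<Rightarrow> 'k) set) module" where
  "enveloping_algebra k A = tensor_algebra k A (opposite A)"

text \<open>
  \<open>A\<close> as a left module over its enveloping algebra, \<open>(b \<otimes> c) \<cdot> a = b a c\<close>. An element of the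
  enveloping algebra is a coset \<open>X\<close> of formal combinations of pairs; all members of \<open>X\<close> act alike.
\<close>

definition regular_bimodule :: "('k, 'e) ring_scheme \<Rightarrow> ('k, 'a) module \<Rightarrow>
    (('a \<times> 'a \<Rightarrow> 'k) set, 'a) module" where
  "regular_bimodule k A =
     ring.extend (ring.truncate A) (module.fields
       (\<lambda>X a. the_elem
          ((\<lambda>u. lin_ext k (carrier A \<times> carrier A) A (\<lambda>(b, c). b \<otimes>\<^bsub>A\<^esub> a \<otimes>\<^bsub>A\<^esub> c) u) ` X)))"

section \<open>Ext\<close>

text \<open>
  The module of \<open>R\<close>-linear maps. For a \<open>k\<close>-algebra \<open>R\<close> a scalar \<open>c\<close> of \<open>k\<close> acts on it through the
  element \<open>c \<cdot> 1\<close> of \<open>R\<close>, which is central.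
\<close>

definition hom_module :: "('k, 'r) module \<Rightarrow> ('r, 'm) module \<Rightarrow> ('r, 'n) module \<Rightarrow>
    ('k, 'm \<Rightarrow> 'n) module" where
  "hom_module R M N =
     \<lparr>carrier = {\<phi> \<in> carrier M \<rightarrow>\<^sub>E carrier N.
        (\<forall>x\<in>carrier M. \<forall>y\<in>carrier M. \<phi> (x \<oplus>\<^bsub>M\<^esub> y) = \<phi> x \<oplus>\<^bsub>N\<^esub> \<phi> y) \<and>
        (\<forall>r\<in>carrier R. \<forall>x\<in>carrier M. \<phi> (r \<odot>\<^bsub>M\<^esub> x) = r \<odot>\<^bsub>N\<^esub> \<phi> x)},
      mult = undefined, one = undefined,
      zero = (\<lambda>x\<in>carrier M. \<zero>\<^bsub>N\<^esub>),
      add = (\<lambda>\<phi> \<psi>. \<lambda>x\<in>carrier M. \<phi> x \<oplus>\<^bsub>N\<^esub> \<psi> x),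
      smult = (\<lambda>c \<phi>. \<lambda>x\<in>carrier M. (c \<odot>\<^bsub>R\<^esub> \<one>\<^bsub>R\<^esub>) \<odot>\<^bsub>N\<^esub> \<phi> x)\<rparr>"

text \<open>
  Ext is computed from the standard free resolution
  \<open>\<dots> \<rightarrow> P\<^sub>2 \<rightarrow> P\<^sub>1 \<rightarrow> P\<^sub>0 \<rightarrow> M \<rightarrow> 0\<close>, in which \<open>P\<^sub>0\<close> is free on the underlying set of \<open>M\<close> and
  \<open>P\<^sub>i\<^sub>+\<^sub>1\<close> is free on the underlying set of the kernel of the map out of \<open>P\<^sub>i\<close>. The type of basis
  elements below is closed under forming finitely supported \<open>'r\<close>-valued functions (encoded by their
  finite graphs), so that all the \<open>P\<^sub>i\<close> have the same type.
\<close>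

datatype ('m, 'r) gen = Gen (gen_elem: 'm) | Syz "(('m, 'r) gen \<times> 'r) fset"

definition syz_gen :: "('r, 'e) ring_scheme \<Rightarrow> (('m, 'r) gen \<Rightarrow> 'r) \<Rightarrow> ('m, 'r) gen" where
  "syz_gen R u = Syz (Abs_fset {(x, u x) | x. u x \<noteq> \<zero>\<^bsub>R\<^esub>})"

text \<open>\<open>syz_gen R\<close> is injective on finitely supported functions, and \<open>syz_map R K\<close> is the linear map
  from the free module on (the codes of) the elements of \<open>K\<close> that sends each basis vector to the
  element of \<open>K\<close> it stands for.\<close>

definition syz_map :: "('r, 'e) ring_scheme \<Rightarrow> (('m, 'r) gen \<Rightarrow> 'r) set \<Rightarrow>
    (('m, 'r) gen \<Rightarrow> 'r) \<Rightarrow> ('m, 'r) gen \<Rightarrow> 'r" where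
  "syz_map R K = lin_ext R (syz_gen R ` K) (free_module R UNIV) (the_inv_into K (syz_gen R))"

definition augmentation :: "('r, 'e) ring_scheme \<Rightarrow> ('r, 'm) module \<Rightarrow> (('m, 'r) gen \<Rightarrow> 'r) \<Rightarrow> 'm" where
  "augmentation R M = lin_ext R (Gen ` carrier M) M gen_elem"

text \<open>\<open>syzygies R M i\<close> is the kernel of the map out of \<open>P\<^sub>i\<close>.\<close>

primrec syzygies :: "('r, 'e) ring_scheme \<Rightarrow> ('r, 'm) module \<Rightarrow> nat \<Rightarrow> (('m, 'r) gen \<Rightarrow> 'r) set" where
  "syzygies R M 0 =
     {u \<in> carrier (free_module R (Gen ` carrier M)). augmentation R M u = \<zero>\<^bsub>M\<^esub>}"
| "syzygies R M (Suc i) =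
     {u \<in> carrier (free_module R (syz_gen R ` syzygies R M i)).
        syz_map R (syzygies R M i) u = (\<lambda>x. \<zero>\<^bsub>R\<^esub>)}"

definition std_resolution :: "('r, 'e) ring_scheme \<Rightarrow> ('r, 'm) module \<Rightarrow> nat \<Rightarrow>
    ('r, ('m, 'r) gen \<Rightarrow> 'r) module" where
  "std_resolution R M i = free_module R
     (case i of 0 \<Rightarrow> Gen ` carrier M | Suc j \<Rightarrow> syz_gen R ` syzygies R M j)"

text \<open>\<open>std_diff R M i\<close> is the map \<open>P\<^sub>i\<^sub>+\<^sub>1 \<rightarrow> P\<^sub>i\<close>.\<close>

definition std_diff :: "('r, 'e) ring_scheme \<Rightarrow> ('r, 'm) module \<Rightarrow> nat \<Rightarrow>
    (('m, 'r) gen \<Rightarrow> 'r) \<Rightarrow> ('m, 'r) gen \<Rightarrow> 'r" where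
  "std_diff R M i = syz_map R (syzygies R M i)"

definition cochains :: "('k, 'r) module \<Rightarrow> ('r, 'm) module \<Rightarrow> ('r, 'n) module \<Rightarrow> nat \<Rightarrow>
    ('k, (('m, 'r) gen \<Rightarrow> 'r) \<Rightarrow> 'n) module" where
  "cochains R M N i = hom_module R (std_resolution R M i) N"

definition codiff :: "('k, 'r) module \<Rightarrow> ('r, 'm) module \<Rightarrow> nat \<Rightarrow>
    ((('m, 'r) gen \<Rightarrow> 'r) \<Rightarrow> 'n) \<Rightarrow> (('m, 'r) gen \<Rightarrow> 'r) \<Rightarrow> 'n" where
  "codiff R M i \<phi> = compose (carrier (std_resolution R M (Suc i))) \<phi> (std_diff R M i)"

definition cocycles :: "('k, 'r) module \<Rightarrow> ('r, 'm) module \<Rightarrow> ('r, 'n) module \<Rightarrow> nat \<Rightarrow>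
    ((('m, 'r) gen \<Rightarrow> 'r) \<Rightarrow> 'n) set" where
  "cocycles R M N i =
     {\<phi> \<in> carrier (cochains R M N i). codiff R M i \<phi> = \<zero>\<^bsub>cochains R M N (Suc i)\<^esub>}"

definition coboundaries :: "('k, 'r) module \<Rightarrow> ('r, 'm) module \<Rightarrow> ('r, 'n) module \<Rightarrow> nat \<Rightarrow>
    ((('m, 'r) gen \<Rightarrow> 'r) \<Rightarrow> 'n) set" where
  "coboundaries R M N i =
     (case i of 0 \<Rightarrow> {\<zero>\<^bsub>cochains R M N 0\<^esub>}
      | Suc j \<Rightarrow> codiff R M j ` carrier (cochains R M N j))"

definition Ext :: "('k, 'r) module \<Rightarrow> nat \<Rightarrow> ('r, 'm) module \<Rightarrow> ('r, 'n) module \<Rightarrow>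
    ('k, ((('m, 'r) gen \<Rightarrow> 'r) \<Rightarrow> 'n) set) module" where
  "Ext R i M N =
     quotient_module ((cochains R M N i)\<lparr>carrier := cocycles R M N i\<rparr>) (coboundaries R M N i)"

definition HH :: "('k, 'e) ring_scheme \<Rightarrow> nat \<Rightarrow> ('k, 'a) module \<Rightarrow>
    ('k, ((('a, ('a \<times> 'a \<Rightarrow> 'k) set) gen \<Rightarrow> ('a \<times> 'a \<Rightarrow> 'k) set) \<Rightarrow> 'a) set) module" where
  "HH k i A = Ext (enveloping_algebra k A) i (regular_bimodule k A) (regular_bimodule k A)"

section \<open>Symmetric groups and partitions\<close>

abbreviation prime_field :: "nat \<Rightarrow> int ring" where
  "prime_field p \<equiv> residue_ring (int p)"

abbreviation sym_group_algebra :: "nat \<Rightarrow> nat \<Rightarrow> (int, (nat \<Rightarrow> nat) \<Rightarrow> int) module" where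
  "sym_group_algebra p n \<equiv> monoid_algebra (prime_field p) (sym_group n)"

definition partitions :: "nat \<Rightarrow> nat multiset set" where
  "partitions n = {l. (\<forall>i \<in># l. 1 \<le> i) \<and> sum_mset l = n}"

definition num_parts :: "nat \<Rightarrow> nat \<Rightarrow> nat" where
  "num_parts k n = (\<Sum>l\<in>partitions n. count l k)"

end

theory Submission
  imports Defs
begin

text \<open>
  \<open>Ext\<^sup>1\<close> of the bimodule \<open>A\<close>, computed from the standard resolution, consists of the linear maps on the first
  syzygies modulo those that extend to \<open>P\<^sub>0\<close>. Evaluating such a map on the syzygies
  \<open>(a \<otimes> 1 - 1 \<otimes> a) e\<^sub>1\<close> identifies it with the derivations of \<open>A\<close> modulo the inner ones. For a group algebra
  a derivation is a \<open>1\<close>-cocycle of \<open>G\<close> with values in \<open>k\<^sup>G\<close> (conjugation action), so that \<open>HH\<^sup>1\<close> is the direct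
  sum of the groups \<open>Hom (C x, k)\<close> over representatives \<open>x\<close> of the conjugacy classes. For a permutation \<open>x\<close> with
  \<open>m\<^sub>k\<close> cycles of length \<open>k\<close>, the centralizer \<open>C x\<close> is generated by the cycles of \<open>x\<close> and by the permutations
  swapping two of them; \<open>Hom (C x, F\<^sub>p)\<close> has dimension the number of \<open>k\<close> with \<open>p dvd k\<close> and \<open>m\<^sub>k \<ge> 1\<close>, plus, for
  \<open>p = 2\<close>, the number of \<open>k\<close> with \<open>m\<^sub>k \<ge> 2\<close>. Summed over all partitions, either number is \<open>F\<^sub>p(n)\<close>.
\<close>

section \<open>Left modules over a noncommutative ring\<close>

text \<open>The standard resolution is free on whole underlying sets, and the quotient defining Ext
  is only a record of cosets; neither lends itself to counting dimensions. The dimension is read off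
  from coordinates instead: a linear map from the cocycles onto the functions on a finite set X,
  with the coboundaries as its kernel. What must be shown about X changes form on the way down:
  functionals on derivations that vanish together exactly on the inner ones and take all values
  become elements of centralizers at which the characters are determined and can be prescribed.

  For x with m cycles of length k, the corresponding factor of the centralizer is the wreath product
  of Z/k by the symmetric group on m letters. Its homomorphisms to the prime field come from the
  total rotation in Z/k and from the sign of the permutation of the cycles. Hence X consists of
  pairs of a partition and a part size. F_p(n) counts pairs of a partition and a number j between 1
  and the number of parts p; these j parts can be regrouped as one part p j or, for p = 2, as two
  parts j.\<close>

locale left_module = R?: ring R + M?: abelian_group M
  for R :: "('r, 'e) ring_scheme" (structure) and M :: "('r, 'm, 'f) module_scheme" (structure) +
  assumes lsmult_closed [simp, intro]:
      "\<lbrakk>a \<in> carrier R; x \<in> carrier M\<rbrakk> \<Longrightarrow> a \<odot>\<^bsub>M\<^esub> x \<in> carrier M"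
    and lsmult_l_distr:
      "\<lbrakk>a \<in> carrier R; b \<in> carrier R; x \<in> carrier M\<rbrakk> \<Longrightarrow>
      (a \<oplus> b) \<odot>\<^bsub>M\<^esub> x = a \<odot>\<^bsub>M\<^esub> x \<oplus>\<^bsub>M\<^esub> b \<odot>\<^bsub>M\<^esub> x"
    and lsmult_r_distr:
      "\<lbrakk>a \<in> carrier R; x \<in> carrier M; y \<in> carrier M\<rbrakk> \<Longrightarrow>
      a \<odot>\<^bsub>M\<^esub> (x \<oplus>\<^bsub>M\<^esub> y) = a \<odot>\<^bsub>M\<^esub> x \<oplus>\<^bsub>M\<^esub> a \<odot>\<^bsub>M\<^esub> y"
    and lsmult_assoc:
      "\<lbrakk>a \<in> carrier R; b \<in> carrier R; x \<in> carrier M\<rbrakk> \<Longrightarrow>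
      (a \<otimes> b) \<odot>\<^bsub>M\<^esub> x = a \<odot>\<^bsub>M\<^esub> (b \<odot>\<^bsub>M\<^esub> x)"
    and lsmult_one [simp]: "x \<in> carrier M \<Longrightarrow> \<one> \<odot>\<^bsub>M\<^esub> x = x"
begin

lemma lsmult_l_null [simp]: "x \<in> carrier M \<Longrightarrow> \<zero> \<odot>\<^bsub>M\<^esub> x = \<zero>\<^bsub>M\<^esub>"
  by (metis R.add.r_cancel_one' R.r_zero R.zero_closed lsmult_closed lsmult_l_distr M.add.r_cancel_one')

lemma lsmult_r_null [simp]: "a \<in> carrier R \<Longrightarrow> a \<odot>\<^bsub>M\<^esub> \<zero>\<^bsub>M\<^esub> = \<zero>\<^bsub>M\<^esub>"
  by (metis M.add.r_cancel_one' M.r_zero M.zero_closed lsmult_closed lsmult_r_distr)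

lemma lsmult_r_minus:
  "\<lbrakk>a \<in> carrier R; x \<in> carrier M\<rbrakk> \<Longrightarrow> a \<odot>\<^bsub>M\<^esub> (\<ominus>\<^bsub>M\<^esub> x) = \<ominus>\<^bsub>M\<^esub> (a \<odot>\<^bsub>M\<^esub> x)"
  by (metis M.add.inv_closed M.minus_equality M.l_neg lsmult_closed lsmult_r_distr lsmult_r_null)

lemma lsmult_l_minus:
  "\<lbrakk>a \<in> carrier R; x \<in> carrier M\<rbrakk> \<Longrightarrow> (\<ominus> a) \<odot>\<^bsub>M\<^esub> x = \<ominus>\<^bsub>M\<^esub> (a \<odot>\<^bsub>M\<^esub> x)"
  by (metis R.add.inv_closed M.minus_equality R.l_neg lsmult_closed lsmult_l_distr lsmult_l_null)

lemma finsum_lsmult: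
  assumes "finite A" "a \<in> carrier R" "f \<in> A \<rightarrow> carrier M"
  shows "(\<Oplus>\<^bsub>M\<^esub>i\<in>A. a \<odot>\<^bsub>M\<^esub> f i) = a \<odot>\<^bsub>M\<^esub> (\<Oplus>\<^bsub>M\<^esub>i\<in>A. f i)"
  using assms(1,3)
proof (induction A)
  case (insert x F)
  then have "(\<lambda>i. a \<odot>\<^bsub>M\<^esub> f i) \<in> F \<rightarrow> carrier M" "f \<in> F \<rightarrow> carrier M" "f x \<in> carrier M"
    using assms(2) by auto
  with insert assms(2) show ?case by (simp add: lsmult_r_distr)
qed (use assms(2) in simp)

end

lemma left_moduleI:
  fixes R :: "('r, 'e) ring_scheme" (structure) and M :: "('r, 'm, 'f) module_scheme" (structure)
  assumes "ring R" and "abelian_group M"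
    and "\<And>a x. \<lbrakk>a \<in> carrier R; x \<in> carrier M\<rbrakk> \<Longrightarrow> a \<odot>\<^bsub>M\<^esub> x \<in> carrier M"
    and "\<And>a b x. \<lbrakk>a \<in> carrier R; b \<in> carrier R; x \<in> carrier M\<rbrakk> \<Longrightarrow>
      (a \<oplus> b) \<odot>\<^bsub>M\<^esub> x = (a \<odot>\<^bsub>M\<^esub> x) \<oplus>\<^bsub>M\<^esub> (b \<odot>\<^bsub>M\<^esub> x)"
    and "\<And>a x y. \<lbrakk>a \<in> carrier R; x \<in> carrier M; y \<in> carrier M\<rbrakk> \<Longrightarrow>
      a \<odot>\<^bsub>M\<^esub> (x \<oplus>\<^bsub>M\<^esub> y) = (a \<odot>\<^bsub>M\<^esub> x) \<oplus>\<^bsub>M\<^esub> (a \<odot>\<^bsub>M\<^esub> y)"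
    and "\<And>a b x. \<lbrakk>a \<in> carrier R; b \<in> carrier R; x \<in> carrier M\<rbrakk> \<Longrightarrow>
      (a \<otimes> b) \<odot>\<^bsub>M\<^esub> x = a \<odot>\<^bsub>M\<^esub> (b \<odot>\<^bsub>M\<^esub> x)"
    and "\<And>x. x \<in> carrier M \<Longrightarrow> \<one> \<odot>\<^bsub>M\<^esub> x = x"
  shows "left_module R M"
  using assms by (intro left_module.intro left_module_axioms.intro) auto

lemma (in module) left_module: "left_module R M"
  by (intro left_moduleI R.ring_axioms M.abelian_group_axioms)
    (auto simp: smult_l_distr smult_r_distr smult_assoc1)

lemma (in left_module) module:
  assumes "cring R" shows "module R M"
  using assms by (intro moduleI M.abelian_group_axioms)
    (auto simp: lsmult_l_distr lsmult_r_distr lsmult_assoc)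

subsection \<open>Linear maps\<close>

definition additive_maps :: "('a, 'e) ring_scheme \<Rightarrow> ('b, 'f) ring_scheme \<Rightarrow> ('a \<Rightarrow> 'b) set" where
  "additive_maps M N = {f \<in> carrier M \<rightarrow> carrier N.
     \<forall>x\<in>carrier M. \<forall>y\<in>carrier M. f (x \<oplus>\<^bsub>M\<^esub> y) = f x \<oplus>\<^bsub>N\<^esub> f y}"

text \<open>Extensionality is not demanded, unlike in the carrier of \<open>hom_module\<close>, so
  that composites and plain lambda terms qualify; \<open>hom_module_carrier\<close> puts it
  back.\<close>

definition left_hom :: "('r, 'e) ring_scheme \<Rightarrow> ('r, 'a, 'f) module_scheme \<Rightarrow> ('r, 'b, 'g) module_scheme \<Rightarrow>
    ('a \<Rightarrow> 'b) set" where
  "left_hom R M N = {f \<in> additive_maps M N.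
     \<forall>r\<in>carrier R. \<forall>x\<in>carrier M. f (r \<odot>\<^bsub>M\<^esub> x) = r \<odot>\<^bsub>N\<^esub> f x}"

lemma additive_mapsI:
  assumes "\<And>x. x \<in> carrier M \<Longrightarrow> f x \<in> carrier N"
    and "\<And>x y. \<lbrakk>x \<in> carrier M; y \<in> carrier M\<rbrakk> \<Longrightarrow> f (x \<oplus>\<^bsub>M\<^esub> y) = f x \<oplus>\<^bsub>N\<^esub> f y"
  shows "f \<in> additive_maps M N"
  using assms by (auto simp: additive_maps_def)

lemma
  assumes "f \<in> additive_maps M N"
  shows additive_closed: "x \<in> carrier M \<Longrightarrow> f x \<in> carrier N"
    and additive_add: "\<lbrakk>x \<in> carrier M; y \<in> carrier M\<rbrakk> \<Longrightarrow> f (x \<oplus>\<^bsub>M\<^esub> y) = f x \<oplus>\<^bsub>N\<^esub> f y"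
  using assms by (auto simp: additive_maps_def)

lemma
  assumes f: "f \<in> additive_maps M N" and "abelian_group M" "abelian_group N"
  shows additive_zero: "f \<zero>\<^bsub>M\<^esub> = \<zero>\<^bsub>N\<^esub>"
    and additive_neg: "x \<in> carrier M \<Longrightarrow> f (\<ominus>\<^bsub>M\<^esub> x) = \<ominus>\<^bsub>N\<^esub> f x"
    and additive_minus: "\<lbrakk>x \<in> carrier M; y \<in> carrier M\<rbrakk> \<Longrightarrow> f (x \<ominus>\<^bsub>M\<^esub> y) = f x \<ominus>\<^bsub>N\<^esub> f y"
proof -
  interpret M: abelian_group M by fact
  interpret N: abelian_group N by fact
  note [simp] = additive_closed[OF f] additive_add[OF f]
  have "f \<zero>\<^bsub>M\<^esub> \<oplus>\<^bsub>N\<^esub> f \<zero>\<^bsub>M\<^esub> = f \<zero>\<^bsub>M\<^esub>"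
    using additive_add[OF f, of "\<zero>\<^bsub>M\<^esub>" "\<zero>\<^bsub>M\<^esub>"] by simp
  then show z: "f \<zero>\<^bsub>M\<^esub> = \<zero>\<^bsub>N\<^esub>" by (simp add: N.add.r_cancel_one)
  have neg: "f (\<ominus>\<^bsub>M\<^esub> x) = \<ominus>\<^bsub>N\<^esub> f x" if "x \<in> carrier M" for x
  proof -
    have "f (\<ominus>\<^bsub>M\<^esub> x) \<oplus>\<^bsub>N\<^esub> f x = \<zero>\<^bsub>N\<^esub>"
      using additive_add[OF f, of "\<ominus>\<^bsub>M\<^esub> x" x] that z by (simp add: M.l_neg)
    then show ?thesis using that by (metis M.a_inv_closed N.minus_equality additive_closed[OF f])
  qed
  then show "x \<in> carrier M \<Longrightarrow> f (\<ominus>\<^bsub>M\<^esub> x) = \<ominus>\<^bsub>N\<^esub> f x" .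
  show "\<lbrakk>x \<in> carrier M; y \<in> carrier M\<rbrakk> \<Longrightarrow> f (x \<ominus>\<^bsub>M\<^esub> y) = f x \<ominus>\<^bsub>N\<^esub> f y"
    by (simp add: a_minus_def neg)
qed

lemma left_homI:
  assumes "\<And>x. x \<in> carrier M \<Longrightarrow> f x \<in> carrier N"
    and "\<And>x y. \<lbrakk>x \<in> carrier M; y \<in> carrier M\<rbrakk> \<Longrightarrow> f (x \<oplus>\<^bsub>M\<^esub> y) = f x \<oplus>\<^bsub>N\<^esub> f y"
    and "\<And>r x. \<lbrakk>r \<in> carrier R; x \<in> carrier M\<rbrakk> \<Longrightarrow> f (r \<odot>\<^bsub>M\<^esub> x) = r \<odot>\<^bsub>N\<^esub> f x"
  shows "f \<in> left_hom R M N"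
  using assms by (auto simp: left_hom_def additive_maps_def)

lemma
  assumes "f \<in> left_hom R M N"
  shows left_hom_additive: "f \<in> additive_maps M N"
    and left_hom_smult: "\<lbrakk>r \<in> carrier R; x \<in> carrier M\<rbrakk> \<Longrightarrow> f (r \<odot>\<^bsub>M\<^esub> x) = r \<odot>\<^bsub>N\<^esub> f x"
  using assms by (auto simp: left_hom_def)

lemmas left_hom_closed = additive_closed[OF left_hom_additive]
  and left_hom_add = additive_add[OF left_hom_additive]

lemma left_hom_compose:
  assumes f: "f \<in> left_hom R L M" and g: "g \<in> left_hom R M N"
  shows "(\<lambda>x. g (f x)) \<in> left_hom R L N"
  by (rule left_homI) (simp_all add: left_hom_closed[OF f] left_hom_closed[OF g] left_hom_add[OF f]
      left_hom_add[OF g] left_hom_smult[OF f] left_hom_smult[OF g])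

lemma hom_module_carrier:
  "carrier (hom_module R M N) = left_hom R M N \<inter> extensional (carrier M)"
  by (auto simp: hom_module_def left_hom_def additive_maps_def PiE_def)

text \<open>Closure of \<open>M\<close> under its operations keeps sums and multiples inside the set
  on which the restriction changes nothing.\<close>

lemma restrict_left_hom:
  assumes "abelian_group M" "\<And>r x. \<lbrakk>r \<in> carrier R; x \<in> carrier M\<rbrakk> \<Longrightarrow> r \<odot>\<^bsub>M\<^esub> x \<in> carrier M"
    and "f \<in> left_hom R M N"
  shows "restrict f (carrier M) \<in> left_hom R M N"
proof -
  interpret abelian_group M by fact
  show ?thesis using assms(2,3) by (auto simp: left_hom_def additive_maps_def)
qed

subsection \<open>Free modules\<close>

lemma free_module_simps [simp]:
  "zero (free_module R X) = (\<lambda>x. \<zero>\<^bsub>R\<^esub>)"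
  "add (free_module R X) = (\<lambda>u v x. u x \<oplus>\<^bsub>R\<^esub> v x)"
  "smult (free_module R X) = (\<lambda>r u x. r \<otimes>\<^bsub>R\<^esub> u x)"
  by (simp_all add: free_module_def)

lemma free_module_carrier:
  "u \<in> carrier (free_module R X) \<longleftrightarrow>
    (\<forall>x\<in>X. u x \<in> carrier R) \<and> (\<forall>x. x \<notin> X \<longrightarrow> u x = \<zero>\<^bsub>R\<^esub>) \<and> finite {x. u x \<noteq> \<zero>\<^bsub>R\<^esub>}"
  by (simp add: free_module_def)

context ring
begin

lemma free_module_apply_closed [simp]: "u \<in> carrier (free_module R X) \<Longrightarrow> u x \<in> carrier R"
  by (cases "x \<in> X") (auto simp: free_module_carrier)

lemma free_module_add_closed:
  assumes "u \<in> carrier (free_module R X)" "v \<in> carrier (free_module R X)"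
  shows "(\<lambda>x. u x \<oplus> v x) \<in> carrier (free_module R X)"
proof -
  have "{x. u x \<oplus> v x \<noteq> \<zero>} \<subseteq> {x. u x \<noteq> \<zero>} \<union> {x. v x \<noteq> \<zero>}" by auto
  then show ?thesis
    using assms by (auto simp: free_module_carrier intro: finite_subset)
qed

lemma free_module_smult_closed:
  assumes "r \<in> carrier R" "u \<in> carrier (free_module R X)"
  shows "(\<lambda>x. r \<otimes> u x) \<in> carrier (free_module R X)"
proof -
  have "{x. r \<otimes> u x \<noteq> \<zero>} \<subseteq> {x. u x \<noteq> \<zero>}" using assms by auto
  then show ?thesis
    using assms by (auto simp: free_module_carrier intro: finite_subset)
qed

lemma free_module_neg_closed:
  assumes "u \<in> carrier (free_module R X)"
  shows "(\<lambda>x. \<ominus> u x) \<in> carrier (free_module R X)"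
proof -
  have "{x. \<ominus> u x \<noteq> \<zero>} \<subseteq> {x. u x \<noteq> \<zero>}" using assms by auto
  then show ?thesis
    using assms by (auto simp: free_module_carrier intro: finite_subset)
qed

lemma free_module_abelian_group: "abelian_group (free_module R X)"
proof (rule abelian_groupI)
  fix u assume "u \<in> carrier (free_module R X)"
  then show "\<exists>v\<in>carrier (free_module R X). v \<oplus>\<^bsub>free_module R X\<^esub> u = \<zero>\<^bsub>free_module R X\<^esub>"
    by (intro bexI[of _ "\<lambda>x. \<ominus> u x"]) (auto simp: free_module_neg_closed l_neg)
qed (auto simp: free_module_add_closed a_ac, auto simp: free_module_carrier)

lemma free_left_module: "left_module R (free_module R X)"
  by (rule left_moduleI[OF ring_axioms free_module_abelian_group])
    (auto simp: free_module_smult_closed l_distr r_distr m_assoc)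

lemma free_module_minus:
  assumes "u \<in> carrier (free_module R X)"
  shows "\<ominus>\<^bsub>free_module R X\<^esub> u = (\<lambda>x. \<ominus> u x)"
proof -
  interpret F: abelian_group "free_module R X" by (rule free_module_abelian_group)
  show ?thesis
    using assms by (intro F.minus_equality) (auto simp: free_module_neg_closed l_neg fun_eq_iff)
qed

lemma free_module_diff:
  assumes "u \<in> carrier (free_module R X)" "v \<in> carrier (free_module R X)"
  shows "u \<ominus>\<^bsub>free_module R X\<^esub> v = (\<lambda>x. u x \<ominus> v x)"
  using assms by (simp add: a_minus_def free_module_minus)

lemma basis_vec_closed [simp]: "x \<in> X \<Longrightarrow> basis_vec R x \<in> carrier (free_module R X)"
  by (auto simp: free_module_carrier basis_vec_def)

lemma free_module_induct [consumes 1, case_names zero add]: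
  assumes u: "u \<in> carrier (free_module R X)"
    and zero: "P (\<lambda>x. \<zero>)"
    and add: "\<And>r x u. \<lbrakk>r \<in> carrier R; x \<in> X; u \<in> carrier (free_module R X); P u\<rbrakk> \<Longrightarrow>
      P ((r \<odot>\<^bsub>free_module R X\<^esub> basis_vec R x) \<oplus>\<^bsub>free_module R X\<^esub> u)"
  shows "P u"
proof -
  have "finite {x. u x \<noteq> \<zero>}" using u by (simp add: free_module_carrier)
  \<comment> \<open>The outer \<open>u\<close> only supplies a finite set. The claim for all vectors
    supported in that set lets the induction remove one point of the support at a time.\<close>
  then have "\<forall>u\<in>carrier (free_module R X). {x. u x \<noteq> \<zero>} \<subseteq> Y \<longrightarrow> P u" if "Y = {x. u x \<noteq> \<zero>}" for Y
    unfolding that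
  proof (induction rule: finite_induct)
    case empty
    have "u = (\<lambda>x. \<zero>)" if "{x. u x \<noteq> \<zero>} \<subseteq> {}" for u :: "'c \<Rightarrow> 'a" using that by auto
    with zero show ?case by metis
  next
    case (insert y Y)
    show ?case
    proof (intro ballI impI)
      fix u assume u: "u \<in> carrier (free_module R X)" and sub: "{x. u x \<noteq> \<zero>} \<subseteq> insert y Y"
      show "P u"
      proof (cases "u y = \<zero>")
        case True
        then show ?thesis using insert.IH u sub by blast
      next
        case False
        then have y: "y \<in> X" using u by (auto simp: free_module_carrier)
        let ?v = "u(y := \<zero>)"
        have "{x. ?v x \<noteq> \<zero>} \<subseteq> {x. u x \<noteq> \<zero>}" by auto
        then have v: "?v \<in> carrier (free_module R X)"
          using u by (auto simp: free_module_carrier intro: finite_subset)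
        have "{x. ?v x \<noteq> \<zero>} \<subseteq> Y" using sub by auto
        with insert.IH v have "P ?v" by blast
        moreover have "u = (u y \<odot>\<^bsub>free_module R X\<^esub> basis_vec R y) \<oplus>\<^bsub>free_module R X\<^esub> ?v"
          using u by (auto simp: basis_vec_def fun_eq_iff)
        ultimately show ?thesis using add[of "u y" y ?v] u v y by simp
      qed
    qed
  qed
  with u show ?thesis by blast
qed

text \<open>Applied to one argument at a time, this reduces multilinear identities, such as
  associativity of a convolution product, to basis vectors and avoids nested sums.\<close>

lemma free_module_hom_eqI:
  assumes u: "u \<in> carrier (free_module R X)" and N: "left_module R N"
    and f: "f \<in> left_hom R (free_module R X) N" and g: "g \<in> left_hom R (free_module R X) N"
    and eq: "\<And>x. x \<in> X \<Longrightarrow> f (basis_vec R x) = g (basis_vec R x)"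
  shows "f u = g u"
  using u
proof (induction rule: free_module_induct)
  interpret N: left_module R N by (rule N)
  case zero
  then show ?case
    using additive_zero[OF left_hom_additive[OF f] free_module_abelian_group N.M.abelian_group_axioms]
      additive_zero[OF left_hom_additive[OF g] free_module_abelian_group N.M.abelian_group_axioms] by simp
next
  interpret F: left_module R "free_module R X" by (rule free_left_module)
  case (add r x u)
  have [simp]: "r \<odot>\<^bsub>free_module R X\<^esub> basis_vec R x \<in> carrier (free_module R X)"
    using add(1,2) by (intro F.lsmult_closed) auto
  show ?case
    unfolding left_hom_add[OF f \<open>r \<odot>\<^bsub>free_module R X\<^esub> basis_vec R x \<in> _\<close> add(3)]
      left_hom_add[OF g \<open>r \<odot>\<^bsub>free_module R X\<^esub> basis_vec R x \<in> _\<close> add(3)]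
      left_hom_smult[OF f add(1) basis_vec_closed[OF add(2)]]
      left_hom_smult[OF g add(1) basis_vec_closed[OF add(2)]]
    using add(2,4) eq by simp
qed

end

context left_module
begin

text \<open>The index set of \<open>lin_ext\<close> is the support and so varies with
  \<open>u\<close>. Extra points contribute zero, and a common finite index set makes additivity a
  termwise matter.\<close>

lemma lin_ext_superset:
  assumes u: "u \<in> carrier (free_module R X)" and \<phi>: "\<phi> \<in> X \<rightarrow> carrier M"
    and Y: "finite Y" "Y \<subseteq> X" "{x. u x \<noteq> \<zero>} \<subseteq> Y"
  shows "lin_ext R X M \<phi> u = (\<Oplus>\<^bsub>M\<^esub>x\<in>Y. u x \<odot>\<^bsub>M\<^esub> \<phi> x)"
  unfolding lin_ext_def
  by (rule M.add.finprod_mono_neutral_cong_left) (use assms in \<open>auto simp: Pi_def\<close>)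

lemma lin_ext_closed [simp]:
  assumes "u \<in> carrier (free_module R X)" "\<phi> \<in> X \<rightarrow> carrier M"
  shows "lin_ext R X M \<phi> u \<in> carrier M"
  unfolding lin_ext_def using assms by (intro M.finsum_closed) auto

lemma lin_ext_add:
  assumes u: "u \<in> carrier (free_module R X)" and v: "v \<in> carrier (free_module R X)"
    and \<phi>: "\<phi> \<in> X \<rightarrow> carrier M"
  shows "lin_ext R X M \<phi> (\<lambda>x. u x \<oplus> v x) = lin_ext R X M \<phi> u \<oplus>\<^bsub>M\<^esub> lin_ext R X M \<phi> v"
proof -
  let ?Y = "{x. u x \<noteq> \<zero>} \<union> {x. v x \<noteq> \<zero>}"
  have Y: "finite ?Y" "?Y \<subseteq> X" using u v by (auto simp: free_module_carrier)
  have "{x. u x \<oplus> v x \<noteq> \<zero>} \<subseteq> ?Y" by auto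
  then have "lin_ext R X M \<phi> (\<lambda>x. u x \<oplus> v x) = (\<Oplus>\<^bsub>M\<^esub>x\<in>?Y. (u x \<oplus> v x) \<odot>\<^bsub>M\<^esub> \<phi> x)"
    using Y R.free_module_add_closed[OF u v] \<phi> by (intro lin_ext_superset)
  also have "\<dots> = (\<Oplus>\<^bsub>M\<^esub>x\<in>?Y. u x \<odot>\<^bsub>M\<^esub> \<phi> x \<oplus>\<^bsub>M\<^esub> v x \<odot>\<^bsub>M\<^esub> \<phi> x)"
    using Y u v \<phi> by (intro M.finsum_cong') (auto simp: lsmult_l_distr Pi_def subset_iff)
  also have "\<dots> = (\<Oplus>\<^bsub>M\<^esub>x\<in>?Y. u x \<odot>\<^bsub>M\<^esub> \<phi> x) \<oplus>\<^bsub>M\<^esub> (\<Oplus>\<^bsub>M\<^esub>x\<in>?Y. v x \<odot>\<^bsub>M\<^esub> \<phi> x)"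
    using Y u v \<phi> by (intro M.finsum_addf) (auto simp: Pi_def subset_iff)
  finally show ?thesis
    using Y u v \<phi> by (simp add: lin_ext_superset[where Y = ?Y])
qed

lemma lin_ext_smult:
  assumes u: "u \<in> carrier (free_module R X)" and r: "r \<in> carrier R" and \<phi>: "\<phi> \<in> X \<rightarrow> carrier M"
  shows "lin_ext R X M \<phi> (\<lambda>x. r \<otimes> u x) = r \<odot>\<^bsub>M\<^esub> lin_ext R X M \<phi> u"
proof -
  let ?Y = "{x. u x \<noteq> \<zero>}"
  have Y: "finite ?Y" "?Y \<subseteq> X" using u by (auto simp: free_module_carrier)
  have "{x. r \<otimes> u x \<noteq> \<zero>} \<subseteq> ?Y" using r by auto
  then have "lin_ext R X M \<phi> (\<lambda>x. r \<otimes> u x) = (\<Oplus>\<^bsub>M\<^esub>x\<in>?Y. (r \<otimes> u x) \<odot>\<^bsub>M\<^esub> \<phi> x)"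
    using Y R.free_module_smult_closed[OF r u] \<phi> by (intro lin_ext_superset)
  also have "\<dots> = (\<Oplus>\<^bsub>M\<^esub>x\<in>?Y. r \<odot>\<^bsub>M\<^esub> (u x \<odot>\<^bsub>M\<^esub> \<phi> x))"
    using Y u \<phi> r by (intro M.finsum_cong') (auto simp: lsmult_assoc Pi_def subset_iff)
  also have "\<dots> = r \<odot>\<^bsub>M\<^esub> (\<Oplus>\<^bsub>M\<^esub>x\<in>?Y. u x \<odot>\<^bsub>M\<^esub> \<phi> x)"
    using Y u \<phi> r by (intro finsum_lsmult) (auto simp: Pi_def subset_iff)
  finally show ?thesis
    using Y u \<phi> by (simp add: lin_ext_superset[where Y = ?Y])
qed

lemma lin_ext_left_hom:
  assumes "\<phi> \<in> X \<rightarrow> carrier M"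
  shows "lin_ext R X M \<phi> \<in> left_hom R (free_module R X) M"
  using assms by (intro left_homI) (auto simp: lin_ext_add lin_ext_smult)

lemma lin_ext_basis_vec [simp]:
  assumes "x \<in> X" "\<phi> \<in> X \<rightarrow> carrier M"
  shows "lin_ext R X M \<phi> (basis_vec R x) = \<phi> x"
proof -
  have [simp]: "\<phi> x \<in> carrier M" using assms by auto
  have "lin_ext R X M \<phi> (basis_vec R x) = (\<Oplus>\<^bsub>M\<^esub>y\<in>{x}. basis_vec R x y \<odot>\<^bsub>M\<^esub> \<phi> y)"
    using assms basis_vec_closed[OF assms(1)]
    by (intro lin_ext_superset) (auto simp: basis_vec_def[of R x])
  then show ?thesis by (simp add: basis_vec_def)
qed

end

subsection \<open>Quotients of vector spaces\<close>

lemma (in ring) finsum_free_module_apply: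
  assumes "finite A" "f \<in> A \<rightarrow> carrier (free_module R X)"
  shows "(\<Oplus>\<^bsub>free_module R X\<^esub>i\<in>A. f i) x = (\<Oplus>i\<in>A. f i x)"
  using assms
proof (induction A)
  interpret F: abelian_group "free_module R X" by (rule free_module_abelian_group)
  case empty
  show ?case by (simp add: F.finsum_empty)
next
  interpret F: abelian_group "free_module R X" by (rule free_module_abelian_group)
  case (insert a A)
  then have "f \<in> A \<rightarrow> carrier (free_module R X)" "f a \<in> carrier (free_module R X)"
    "(\<lambda>i. f i x) \<in> A \<rightarrow> carrier R" "f a x \<in> carrier R" by (auto simp: Pi_iff)
  with insert show ?case by (simp add: F.finsum_insert)
qed

lemma (in field) free_vectorspace: "vectorspace R (free_module R X)"
proof -
  interpret left_module R "free_module R X" by (rule free_left_module)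
  show ?thesis using module[OF cring_axioms] field_axioms by (simp add: vectorspace_def)
qed

lemma (in field) free_module_dim:
  assumes X: "finite X"
  shows "vectorspace.fin_dim R (free_module R X)" "vectorspace.dim R (free_module R X) = card X"
proof -
  interpret V: vectorspace R "free_module R X" by (rule free_vectorspace)
  let ?e = "basis_vec R :: 'c \<Rightarrow> 'c \<Rightarrow> 'a"
  have inj: "inj_on ?e Y" for Y
    by (intro inj_onI) (auto simp: basis_vec_def fun_eq_iff split: if_splits)
  have sub: "?e ` X \<subseteq> carrier (free_module R X)" by auto
  \<comment> \<open>Evaluating a combination at \<open>x\<close> returns the coefficient of the
    basis vector at \<open>x\<close>; existence and uniqueness of coordinates both follow from
    this.\<close>
  have lc: "V.lincomb a (?e ` X) x = (if x \<in> X then a (?e x) else \<zero>)"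
    if a: "a \<in> ?e ` X \<rightarrow> carrier R" for a x
  proof -
    have "V.lincomb a (?e ` X) x =
        (\<Oplus>v\<in>?e ` X. (a v \<odot>\<^bsub>free_module R X\<^esub> v) x)"
      unfolding V.lincomb_def using a X
      by (intro finsum_free_module_apply)
        (auto simp: Pi_iff intro!: free_module_smult_closed simp del: free_module_apply_closed)
    also have "\<dots> = (\<Oplus>y\<in>X. (a (?e y) \<odot>\<^bsub>free_module R X\<^esub> ?e y) x)"
      using a inj by (intro finsum_reindex) (auto simp: Pi_iff basis_vec_def)
    also have "\<dots> = (\<Oplus>y\<in>X. if x = y then a (?e y) else \<zero>)"
      using a by (intro finsum_cong') (auto simp: basis_vec_def Pi_iff)
    also have "\<dots> = (if x \<in> X then a (?e x) else \<zero>)"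
    proof (cases "x \<in> X")
      case True
      then show ?thesis using finsum_singleton[of x X "\<lambda>y. a (?e y)"] X a by (auto simp: Pi_iff)
    next
      case False
      then have "(\<Oplus>y\<in>X. if x = y then a (?e y) else \<zero>) = (\<Oplus>y\<in>X. \<zero>)"
        by (intro finsum_cong') auto
      with False show ?thesis by simp
    qed
    finally show ?thesis .
  qed
  have basis: "V.basis (?e ` X)"
  proof (subst V.basis_criterion)
    show "\<forall>v. v \<in> carrier (free_module R X) \<longrightarrow>
      (\<exists>!a. a \<in> ?e ` X \<rightarrow>\<^sub>E carrier R \<and> V.lincomb a (?e ` X) = v)"
    proof (intro allI impI)
      fix v assume v: "v \<in> carrier (free_module R X)"
      show "\<exists>!a. a \<in> ?e ` X \<rightarrow>\<^sub>E carrier R \<and> V.lincomb a (?e ` X) = v"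
      proof (rule ex1I)
        \<comment> \<open>Coefficients are indexed by vectors, so \<open>v\<close> is read at the
          point to which the basis vector belongs.\<close>
        let ?a = "restrict (\<lambda>b. v (the_inv_into X ?e b)) (?e ` X)"
        have a: "?a \<in> ?e ` X \<rightarrow>\<^sub>E carrier R" using v by auto
        have "V.lincomb ?a (?e ` X) x = v x" for x
        proof -
          have "?a \<in> ?e ` X \<rightarrow> carrier R" using a by auto
          from lc[OF this, of x] show ?thesis
            using v by (auto simp: the_inv_into_f_f[OF inj] free_module_carrier)
        qed
        with a show "?a \<in> ?e ` X \<rightarrow>\<^sub>E carrier R \<and> V.lincomb ?a (?e ` X) = v" by blast
        fix a assume a': "a \<in> ?e ` X \<rightarrow>\<^sub>E carrier R \<and> V.lincomb a (?e ` X) = v"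
        then have a1: "a \<in> ?e ` X \<rightarrow>\<^sub>E carrier R" and a2: "a \<in> ?e ` X \<rightarrow> carrier R" by auto
        show "a = ?a"
        proof (rule PiE_ext[OF a1 a])
          fix b assume "b \<in> ?e ` X"
          then obtain x where "x \<in> X" "b = ?e x" by blast
          then show "a b = ?a b" using lc[OF a2, of x] a' by (auto simp: the_inv_into_f_f[OF inj])
        qed
      qed
    qed
  qed (use X sub in auto)
  show "V.fin_dim" unfolding V.fin_dim_def
    using basis X sub unfolding V.basis_def by (intro exI[of _ "?e ` X"]) auto
  have "V.dim = card (?e ` X)" using basis X by (intro V.dim_basis) auto
  then show "V.dim = card X" using inj card_image by metis
qed

text \<open>As a rewrite rule this has a variable head and would match every membership goal.\<close>

declare (in ring) free_module_apply_closed [simp del]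

text \<open>First isomorphism theorem, for the coset space of a record that is not assumed to be a module.\<close>

lemma quotient_module_dim:
  assumes k: "field k" and V: "abelian_group V" and X: "finite X"
    and smult: "\<And>c v. \<lbrakk>c \<in> carrier k; v \<in> carrier V\<rbrakk> \<Longrightarrow> c \<odot>\<^bsub>V\<^esub> v \<in> carrier V"
    and T: "T \<in> left_hom k V (free_module k X)"
    and surj: "T ` carrier V = carrier (free_module k X)"
    and H: "H = {v \<in> carrier V. T v = \<zero>\<^bsub>free_module k X\<^esub>}"
  shows "vectorspace k (quotient_module V H) \<and> vectorspace.fin_dim k (quotient_module V H) \<and>
    vectorspace.dim k (quotient_module V H) = card X"
proof -
  interpret k: field k by (rule k)
  interpret V: abelian_group V by (rule V)
  let ?W = "free_module k X"
  interpret W: vectorspace k ?W by (rule k.free_vectorspace)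
  note Tc = left_hom_closed[OF T] and Ta = left_hom_add[OF T] and Ts = left_hom_smult[OF T]
  note Tm = additive_minus[OF left_hom_additive[OF T] V W.abelian_group_axioms]
  \<comment> \<open>Cosets of the kernel are the fibres of \<open>T\<close>. Naming a coset by its
    common value \<open>w\<close> transports the structure of the free module to the coset space,
    which thereby inherits the vector space laws.\<close>
  define J where "J w = {v \<in> carrier V. T v = w}" for w
  let ?Q = "quotient_module V H"
  have coset: "H +>\<^bsub>V\<^esub> v = J (T v)" if v: "v \<in> carrier V" for v
  proof (intro equalityI subsetI)
    fix x assume "x \<in> H +>\<^bsub>V\<^esub> v"
    then obtain h where h: "h \<in> H" "x = h \<oplus>\<^bsub>V\<^esub> v" by (auto simp: a_r_coset_def r_coset_def)
    then have "T x = \<zero>\<^bsub>?W\<^esub> \<oplus>\<^bsub>?W\<^esub> T v" using Ta[of h v] v by (simp add: H)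
    also have "\<dots> = T v" using Tc[OF v] by (rule W.l_zero)
    finally show "x \<in> J (T v)" using h v by (auto simp: J_def H)
  next
    fix x assume "x \<in> J (T v)"
    then have x: "x \<in> carrier V" "T x = T v" by (auto simp: J_def)
    then have "T (x \<ominus>\<^bsub>V\<^esub> v) = \<zero>\<^bsub>?W\<^esub>" using Tm[of x v] v Tc[OF v] W.r_neg by (simp add: a_minus_def)
    moreover have "x = (x \<ominus>\<^bsub>V\<^esub> v) \<oplus>\<^bsub>V\<^esub> v" using x v by (simp add: a_minus_def V.a_assoc V.l_neg)
    ultimately show "x \<in> H +>\<^bsub>V\<^esub> v" using x v by (auto simp: a_r_coset_def r_coset_def H)
  qed
  have carrier: "carrier ?Q = J ` carrier ?W"
    unfolding surj[symmetric]
    by (auto simp: quotient_module_def A_RCOSETS_def RCOSETS_def a_r_coset_def[symmetric] coset)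
  have zero: "zero ?Q = J (zero ?W)" by (simp add: quotient_module_def J_def H)
  have nonempty: "\<exists>v\<in>carrier V. T v = w" if "w \<in> carrier ?W" for w
    using that unfolding surj[symmetric] by auto
  have add: "J a \<oplus>\<^bsub>?Q\<^esub> J b = J (a \<oplus>\<^bsub>?W\<^esub> b)" if a: "a \<in> carrier ?W" and b: "b \<in> carrier ?W" for a b
  proof -
    have "J a \<oplus>\<^bsub>?Q\<^esub> J b = {x \<oplus>\<^bsub>V\<^esub> y | x y. x \<in> J a \<and> y \<in> J b}"
      by (auto simp: quotient_module_def set_add_def set_mult_def)
    also have "\<dots> = J (a \<oplus>\<^bsub>?W\<^esub> b)"
    proof (intro equalityI subsetI)
      fix z assume z: "z \<in> J (a \<oplus>\<^bsub>?W\<^esub> b)"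
      obtain x where x: "x \<in> carrier V" "T x = a" using nonempty[OF a] by blast
      have zc: "z \<in> carrier V" and Tz: "T z = a \<oplus>\<^bsub>?W\<^esub> b" using z by (auto simp: J_def)
      have "T (z \<ominus>\<^bsub>V\<^esub> x) = (a \<oplus>\<^bsub>?W\<^esub> b) \<ominus>\<^bsub>?W\<^esub> a" using Tm[OF zc x(1)] Tz x by simp
      also have "\<dots> = b" unfolding a_minus_def using a b
        by (metis W.a_assoc W.a_comm W.add.inv_closed W.l_zero W.r_neg)
      finally have "z \<ominus>\<^bsub>V\<^esub> x \<in> J b" using zc x by (simp add: J_def)
      moreover have "z = x \<oplus>\<^bsub>V\<^esub> (z \<ominus>\<^bsub>V\<^esub> x)"
        using x zc by (metis V.a_comm V.a_inv_closed V.a_lcomm V.r_neg V.r_zero a_minus_def)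
      ultimately show "z \<in> {x \<oplus>\<^bsub>V\<^esub> y | x y. x \<in> J a \<and> y \<in> J b}"
        using x unfolding J_def by blast
    qed (use Ta in \<open>auto simp: J_def simp del: free_module_simps\<close>)
    finally show ?thesis .
  qed
  have smul: "c \<odot>\<^bsub>?Q\<^esub> J a = J (c \<odot>\<^bsub>?W\<^esub> a)" if c: "c \<in> carrier k" and a: "a \<in> carrier ?W" for c a
  proof -
    have "c \<odot>\<^bsub>?Q\<^esub> J a = (\<Union>x\<in>J a. H +>\<^bsub>V\<^esub> (c \<odot>\<^bsub>V\<^esub> x))"
      by (simp add: quotient_module_def coset_smult_def)
    also have "\<dots> = (\<Union>x\<in>J a. J (c \<odot>\<^bsub>?W\<^esub> a))"
      using c by (intro SUP_cong) (auto simp: J_def coset smult Ts simp del: free_module_simps)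
    also have "\<dots> = J (c \<odot>\<^bsub>?W\<^esub> a)" using nonempty[OF a] by (auto simp: J_def)
    finally show ?thesis .
  qed
  have inj: "inj_on J (carrier ?W)"
  proof (rule inj_onI)
    fix a b assume "a \<in> carrier ?W" "b \<in> carrier ?W" "J a = J b"
    then show "a = b" using nonempty[of a] unfolding J_def by blast
  qed
  interpret Wm: left_module k ?W by (rule k.free_left_module)
  note [simp del] = free_module_simps
  have Q: "vectorspace k ?Q"
  proof (rule vs_criteria)
    show "\<forall>v\<in>carrier ?Q. \<exists>neg_v\<in>carrier ?Q. v \<oplus>\<^bsub>?Q\<^esub> neg_v = \<zero>\<^bsub>?Q\<^esub>"
    proof
      fix v assume "v \<in> carrier ?Q"
      then obtain a where a: "a \<in> carrier ?W" "v = J a" by (auto simp: carrier)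
      then have "v \<oplus>\<^bsub>?Q\<^esub> J (\<ominus>\<^bsub>?W\<^esub> a) = \<zero>\<^bsub>?Q\<^esub>" by (simp add: add zero W.r_neg)
      with a show "\<exists>w\<in>carrier ?Q. v \<oplus>\<^bsub>?Q\<^esub> w = \<zero>\<^bsub>?Q\<^esub>" by (auto simp: carrier)
    qed
    show "\<forall>v w. v \<in> carrier ?Q \<and> w \<in> carrier ?Q \<longrightarrow> v \<oplus>\<^bsub>?Q\<^esub> w = w \<oplus>\<^bsub>?Q\<^esub> v"
      by (auto simp: carrier add W.a_comm intro: arg_cong[of _ _ J])
  qed (auto simp: carrier zero add smul k W.a_assoc Wm.lsmult_l_distr Wm.lsmult_r_distr
      Wm.lsmult_assoc)
  interpret Q: vectorspace k ?Q by (rule Q)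
  interpret J: linear_map k ?W ?Q J
    by unfold_locales (auto simp: module_hom_def carrier add smul)
  have fd: "W.fin_dim" and dim: "W.dim = card X" using k.free_module_dim[OF X] by auto
  have "Q.fin_dim" using J.surj_fin_dim[OF fd] carrier by simp
  moreover have "Q.dim = card X" using J.dim_eq[OF fd inj] carrier dim by simp
  ultimately show ?thesis using Q by blast
qed

section \<open>Ext in degree one\<close>

lemma (in ring) free_module_mono:
  "X \<subseteq> Y \<Longrightarrow> u \<in> carrier (free_module R X) \<Longrightarrow> u \<in> carrier (free_module R Y)"
  by (auto simp: free_module_carrier)

text \<open>Finite support makes the graph over the support a finite set, and on finite sets
  \<open>Abs_fset\<close> is injective.\<close>

lemma inj_on_syz_gen:
  assumes "\<And>u. u \<in> K \<Longrightarrow> finite {x. u x \<noteq> \<zero>\<^bsub>R\<^esub>}"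
  shows "inj_on (syz_gen R) K"
proof (rule inj_onI)
  fix u v assume u: "u \<in> K" and v: "v \<in> K" and eq: "syz_gen R u = syz_gen R v"
  have fin: "finite {(x, w x) |x. w x \<noteq> \<zero>\<^bsub>R\<^esub>}" if "w \<in> K" for w
    using finite_imageI[OF assms[OF that], of "\<lambda>x. (x, w x)"] by (simp add: setcompr_eq_image)
  have "{(x, u x) |x. u x \<noteq> \<zero>\<^bsub>R\<^esub>} = {(x, v x) |x. v x \<noteq> \<zero>\<^bsub>R\<^esub>}"
    using eq fin[OF u] fin[OF v] unfolding syz_gen_def by (auto simp: Abs_fset_inject)
  then have *: "(x, y) \<in> {(x, u x) |x. u x \<noteq> \<zero>\<^bsub>R\<^esub>} \<longleftrightarrow> (x, y) \<in> {(x, v x) |x. v x \<noteq> \<zero>\<^bsub>R\<^esub>}" for x y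
    by simp
  show "u = v"
  proof
    \<comment> \<open>If one of the two values is nonzero, its pair lies in the common graph;
      otherwise both are zero.\<close>
    fix x show "u x = v x" using *[of x "u x"] *[of x "v x"] by auto
  qed
qed

section \<open>Kernels inside free modules and the free modules that cover them\<close>

locale submodule_of_free = ring R for R :: "('r, 'e) ring_scheme" (structure) +
  fixes K :: "(('m, 'r) gen \<Rightarrow> 'r) set"
  assumes sub: "K \<subseteq> carrier (free_module R UNIV)"
    and zero_mem: "(\<lambda>x. \<zero>) \<in> K"
    and add_mem: "\<lbrakk>u \<in> K; v \<in> K\<rbrakk> \<Longrightarrow> (\<lambda>x. u x \<oplus> v x) \<in> K"
    and smult_mem: "\<lbrakk>r \<in> carrier R; u \<in> K\<rbrakk> \<Longrightarrow> (\<lambda>x. r \<otimes> u x) \<in> K"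
begin

abbreviation "F \<equiv> free_module R (syz_gen R ` K)"
abbreviation "KM \<equiv> (free_module R UNIV)\<lparr>carrier := K\<rparr>"
abbreviation "gen_vec \<kappa> \<equiv> basis_vec R (syz_gen R \<kappa>)"

lemma inj_syz_gen: "inj_on (syz_gen R) K"
  using sub by (intro inj_on_syz_gen) (auto simp: free_module_carrier)

lemma mem_apply_closed: "u \<in> K \<Longrightarrow> u x \<in> carrier R"
  by (rule free_module_apply_closed[OF subsetD[OF sub]])

lemma neg_mem:
  assumes u: "u \<in> K"
  shows "(\<lambda>x. \<ominus> u x) \<in> K"
proof -
  have "(\<lambda>x. \<ominus> u x) = (\<lambda>x. (\<ominus> \<one>) \<otimes> u x)"
    using mem_apply_closed[OF u] by (simp add: l_minus)
  with u show ?thesis using smult_mem[of "\<ominus> \<one>" u] by simp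
qed

lemma KM_left_module: "left_module R KM"
proof -
  interpret L: left_module R "free_module R UNIV :: ('r, ('m, 'r) gen \<Rightarrow> 'r) module"
    by (rule free_left_module)
  have L: "u \<in> carrier KM \<Longrightarrow> u \<in> carrier (free_module R UNIV)" for u
    using subsetD[OF sub] by simp
  note [simp del] = free_module_simps
  show ?thesis
  proof (rule left_moduleI[OF ring_axioms])
    show "abelian_group KM"
    proof (rule abelian_groupI)
      fix u assume u: "u \<in> carrier KM"
      show "\<exists>v\<in>carrier KM. v \<oplus>\<^bsub>KM\<^esub> u = \<zero>\<^bsub>KM\<^esub>"
        using neg_mem[of u] L.M.l_neg[OF L[OF u]] free_module_minus[OF L[OF u]] u
        by (intro bexI[of _ "\<lambda>x. \<ominus> u x"]) auto
    next
      fix u v assume "u \<in> carrier KM" "v \<in> carrier KM"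
      then show "u \<oplus>\<^bsub>KM\<^esub> v \<in> carrier KM" "u \<oplus>\<^bsub>KM\<^esub> v = v \<oplus>\<^bsub>KM\<^esub> u"
        using L.M.a_comm[of u v] add_mem[of u v] L by (simp_all add: free_module_simps(2))
    next
      fix u v w assume "u \<in> carrier KM" "v \<in> carrier KM" "w \<in> carrier KM"
      then show "u \<oplus>\<^bsub>KM\<^esub> v \<oplus>\<^bsub>KM\<^esub> w = u \<oplus>\<^bsub>KM\<^esub> (v \<oplus>\<^bsub>KM\<^esub> w)"
        using L.M.a_assoc[of u v w] L by simp
    next
      fix u assume "u \<in> carrier KM"
      then show "\<zero>\<^bsub>KM\<^esub> \<oplus>\<^bsub>KM\<^esub> u = u" using L.M.l_zero[of u] L by simp
    qed (simp add: zero_mem free_module_simps(1))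
  next
    fix a x assume "a \<in> carrier R" "x \<in> carrier KM"
    then show "a \<odot>\<^bsub>KM\<^esub> x \<in> carrier KM" by (simp add: smult_mem free_module_simps(3))
  next
    fix a b x assume "a \<in> carrier R" "b \<in> carrier R" "x \<in> carrier KM"
    then show "(a \<oplus> b) \<odot>\<^bsub>KM\<^esub> x = a \<odot>\<^bsub>KM\<^esub> x \<oplus>\<^bsub>KM\<^esub> b \<odot>\<^bsub>KM\<^esub> x"
      "a \<otimes> b \<odot>\<^bsub>KM\<^esub> x = a \<odot>\<^bsub>KM\<^esub> (b \<odot>\<^bsub>KM\<^esub> x)"
      using L.lsmult_l_distr[of a b x] L.lsmult_assoc[of a b x] L by simp_all
  next
    fix a x y assume "a \<in> carrier R" "x \<in> carrier KM" "y \<in> carrier KM"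
    then show "a \<odot>\<^bsub>KM\<^esub> (x \<oplus>\<^bsub>KM\<^esub> y) = a \<odot>\<^bsub>KM\<^esub> x \<oplus>\<^bsub>KM\<^esub> a \<odot>\<^bsub>KM\<^esub> y"
      using L.lsmult_r_distr[of a x y] L by simp
  next
    fix x assume "x \<in> carrier KM"
    then show "\<one> \<odot>\<^bsub>KM\<^esub> x = x" using L.lsmult_one[of x] L by simp
  qed
qed

lemma inv_syz_gen_closed: "the_inv_into K (syz_gen R) \<in> syz_gen R ` K \<rightarrow> carrier (free_module R UNIV)"
proof
  fix x assume "x \<in> syz_gen R ` K"
  then obtain u where "u \<in> K" "x = syz_gen R u" by blast
  then show "the_inv_into K (syz_gen R) x \<in> carrier (free_module R UNIV)"
    using the_inv_into_f_f[OF inj_syz_gen, of u] subsetD[OF sub, of u] by simp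
qed

lemma syz_map_left_hom: "syz_map R K \<in> left_hom R F (free_module R UNIV)"
proof -
  interpret FU: left_module R "free_module R UNIV :: ('r, ('m, 'r) gen \<Rightarrow> 'r) module"
    by (rule free_left_module)
  show ?thesis unfolding syz_map_def by (rule FU.lin_ext_left_hom[OF inv_syz_gen_closed])
qed

lemma syz_map_gen_vec [simp]: "\<kappa> \<in> K \<Longrightarrow> syz_map R K (gen_vec \<kappa>) = \<kappa>"
proof -
  interpret FU: left_module R "free_module R UNIV :: ('r, ('m, 'r) gen \<Rightarrow> 'r) module"
    by (rule free_left_module)
  assume "\<kappa> \<in> K"
  then show ?thesis
    unfolding syz_map_def using FU.lin_ext_basis_vec[OF _ inv_syz_gen_closed, of "syz_gen R \<kappa>"]
    by (simp add: the_inv_into_f_f[OF inj_syz_gen])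
qed

lemma syz_map_mem: "u \<in> carrier F \<Longrightarrow> syz_map R K u \<in> K"
proof (induction rule: free_module_induct)
  case zero
  then show ?case
    using additive_zero[OF left_hom_additive[OF syz_map_left_hom] free_module_abelian_group
        free_module_abelian_group] zero_mem by simp
next
  case (add r x u)
  interpret F: left_module R F by (rule free_left_module)
  from add obtain \<kappa> where \<kappa>: "\<kappa> \<in> K" "x = syz_gen R \<kappa>" by blast
  have c: "basis_vec R x \<in> carrier F" using add(2) by simp
  have "syz_map R K (r \<odot>\<^bsub>F\<^esub> basis_vec R x \<oplus>\<^bsub>F\<^esub> u) = (\<lambda>y. r \<otimes> \<kappa> y \<oplus> syz_map R K u y)"
    unfolding left_hom_add[OF syz_map_left_hom F.lsmult_closed[OF add(1) c] add(3)]
      left_hom_smult[OF syz_map_left_hom add(1) c] using \<kappa> by simp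
  with add \<kappa> show ?case by (simp add: add_mem smult_mem)
qed

lemma syz_map_left_hom_KM: "syz_map R K \<in> left_hom R F KM"
  using syz_map_left_hom syz_map_mem by (auto simp: left_hom_def additive_maps_def)

text \<open>The passage from one syzygy module to the next: the kernel is again an instance of the
  locale.\<close>

lemma kernel_submodule_of_free: "submodule_of_free R {u \<in> carrier F. syz_map R K u = (\<lambda>x. \<zero>)}"
proof
  show "{u \<in> carrier F. syz_map R K u = (\<lambda>x. \<zero>)} \<subseteq> carrier (free_module R UNIV)"
    using free_module_mono[OF subset_UNIV, of _ "syz_gen R ` K"] by (simp add: subset_iff)
next
  show "(\<lambda>x. \<zero>) \<in> {u \<in> carrier F. syz_map R K u = (\<lambda>x. \<zero>)}"
    using additive_zero[OF left_hom_additive[OF syz_map_left_hom] free_module_abelian_group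
        free_module_abelian_group] by (simp add: free_module_carrier)
next
  fix u v assume "u \<in> {u \<in> carrier F. syz_map R K u = (\<lambda>x. \<zero>)}" "v \<in> {u \<in> carrier F. syz_map R K u = (\<lambda>x. \<zero>)}"
  then show "(\<lambda>x. u x \<oplus> v x) \<in> {u \<in> carrier F. syz_map R K u = (\<lambda>x. \<zero>)}"
    using left_hom_add[OF syz_map_left_hom, of u v] free_module_add_closed[of u _ v] by simp
next
  fix r u assume "r \<in> carrier R" "u \<in> {u \<in> carrier F. syz_map R K u = (\<lambda>x. \<zero>)}"
  then show "(\<lambda>x. r \<otimes> u x) \<in> {u \<in> carrier F. syz_map R K u = (\<lambda>x. \<zero>)}"
    using left_hom_smult[OF syz_map_left_hom, of r u] free_module_smult_closed[of r u] by simp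
qed

end

section \<open>Cocycles and coboundaries in degree one\<close>

locale two_modules = M: left_module R M + N: left_module R N
  for R :: "('k, 'r) module" (structure) and M :: "('r, 'm) module" and N :: "('r, 'n) module"
begin

abbreviation "P0 \<equiv> free_module R (Gen ` carrier M) :: ('r, ('m, 'r) gen \<Rightarrow> 'r) module"
abbreviation "K0 \<equiv> syzygies R M 0"

lemma gen_elem_closed: "gen_elem \<in> Gen ` carrier M \<rightarrow> carrier M"
  by auto

lemma augmentation_left_hom: "augmentation R M \<in> left_hom R P0 M"
  unfolding augmentation_def by (rule M.lin_ext_left_hom[OF gen_elem_closed])

lemma augmentation_basis [simp]:
  "a \<in> carrier M \<Longrightarrow> augmentation R M (basis_vec R (Gen a)) = a"
  unfolding augmentation_def using M.lin_ext_basis_vec[OF _ gen_elem_closed, of "Gen a"] by simp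

lemma K0_mem: "u \<in> K0 \<longleftrightarrow> u \<in> carrier P0 \<and> augmentation R M u = \<zero>\<^bsub>M\<^esub>"
  by simp

lemmas [simp del] = syzygies.simps

sublocale K0: submodule_of_free R K0
proof
  show "K0 \<subseteq> carrier (free_module R UNIV)"
  proof
    fix u assume "u \<in> K0"
    then have "u \<in> carrier P0" by (simp add: K0_mem)
    then show "u \<in> carrier (free_module R UNIV)" by (rule M.R.free_module_mono[OF subset_UNIV])
  qed
  show "(\<lambda>x. \<zero>) \<in> K0"
    using additive_zero[OF left_hom_additive[OF augmentation_left_hom] M.R.free_module_abelian_group
        M.M.abelian_group_axioms] unfolding K0_mem by (simp add: free_module_carrier)
next
  fix u v assume "u \<in> K0" "v \<in> K0"
  then show "(\<lambda>x. u x \<oplus> v x) \<in> K0"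
    using left_hom_add[OF augmentation_left_hom, of u v] M.R.free_module_add_closed[of u _ v]
    unfolding K0_mem by simp
next
  fix r u assume "r \<in> carrier R" "u \<in> K0"
  then show "(\<lambda>x. r \<otimes> u x) \<in> K0"
    using left_hom_smult[OF augmentation_left_hom, of r u] M.R.free_module_smult_closed[of r u]
    unfolding K0_mem by simp
qed

abbreviation "P1 \<equiv> K0.F"
abbreviation "K1 \<equiv> syzygies R M (Suc 0)"

sublocale K1: submodule_of_free R K1
  unfolding syzygies.simps(2) by (rule K0.kernel_submodule_of_free)

lemma K1_mem: "u \<in> K1 \<longleftrightarrow> u \<in> carrier P1 \<and> syz_map R K0 u = (\<lambda>x. \<zero>)"
  by (simp add: syzygies.simps(2))

text \<open>Every element of \<open>K1\<close> is the image of its own basis vector, so that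
  composing with the differential into \<open>P1\<close> tests exactly the vanishing on
  \<open>K1\<close>.\<close>

lemma cocycle_iff:
  "\<phi> \<in> cocycles R M N (Suc 0) \<longleftrightarrow>
     \<phi> \<in> left_hom R P1 N \<and> \<phi> \<in> extensional (carrier P1) \<and> (\<forall>z\<in>K1. \<phi> z = \<zero>\<^bsub>N\<^esub>)"
  (is "_ \<longleftrightarrow> ?H \<and> ?E \<and> ?Z")
proof -
  have "(\<forall>w\<in>carrier K1.F. \<phi> (syz_map R K1 w) = \<zero>\<^bsub>N\<^esub>) \<longleftrightarrow> ?Z"
  proof
    assume l: "\<forall>w\<in>carrier K1.F. \<phi> (syz_map R K1 w) = \<zero>\<^bsub>N\<^esub>"
    show ?Z
    proof
      fix z assume z: "z \<in> K1"
      then have "K1.gen_vec z \<in> carrier K1.F" by simp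
      with l z show "\<phi> z = \<zero>\<^bsub>N\<^esub>" by (metis K1.syz_map_gen_vec)
    qed
  qed (use K1.syz_map_mem in blast)
  moreover have "compose (carrier K1.F) \<phi> (syz_map R K1) = (\<lambda>x\<in>carrier K1.F. \<zero>\<^bsub>N\<^esub>) \<longleftrightarrow>
      (\<forall>w\<in>carrier K1.F. \<phi> (syz_map R K1 w) = \<zero>\<^bsub>N\<^esub>)"
    by (auto simp: compose_def fun_eq_iff restrict_def)
  ultimately show ?thesis
    by (auto simp: cocycles_def cochains_def std_resolution_def hom_module_carrier codiff_def
        std_diff_def hom_module_def[of _ K1.F])
qed

text \<open>A cocycle kills the kernel \<open>K1\<close> of the map from \<open>P1\<close> onto
  \<open>K0\<close>, hence factors through \<open>K0\<close>. The choice of preimages by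
  \<open>K0.gen_vec\<close> is not linear, but the value of the cocycle does not depend on the
  preimage.\<close>

lemma cocycle_left_hom:
  assumes "\<phi> \<in> cocycles R M N (Suc 0)"
  shows "(\<lambda>\<kappa>. \<phi> (K0.gen_vec \<kappa>)) \<in> left_hom R K0.KM N"
    and "u \<in> carrier P1 \<Longrightarrow> \<phi> (K0.gen_vec (syz_map R K0 u)) = \<phi> u"
proof -
  interpret F: left_module R P1 by (rule M.R.free_left_module)
  have \<phi>: "\<phi> \<in> left_hom R P1 N" and Z: "\<And>z. z \<in> K1 \<Longrightarrow> \<phi> z = \<zero>\<^bsub>N\<^esub>"
    using assms by (auto simp: cocycle_iff)
  have [simp]: "\<kappa> \<in> K0 \<Longrightarrow> K0.gen_vec \<kappa> \<in> carrier P1" for \<kappa> by simp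
  have diff: "\<phi> u = \<phi> v" if u: "u \<in> carrier P1" and v: "v \<in> carrier P1"
    and eq: "syz_map R K0 u = syz_map R K0 v" for u v
  proof -
    interpret KM: left_module R K0.KM by (rule K0.KM_left_module)
    have "syz_map R K0 (u \<ominus>\<^bsub>P1\<^esub> v) = syz_map R K0 v \<ominus>\<^bsub>K0.KM\<^esub> syz_map R K0 v"
      using additive_minus[OF left_hom_additive[OF K0.syz_map_left_hom_KM]
          F.M.abelian_group_axioms KM.M.abelian_group_axioms u v] eq by simp
    also have "\<dots> = \<zero>\<^bsub>K0.KM\<^esub>"
      unfolding a_minus_def using K0.syz_map_mem[OF v] by (intro KM.M.r_neg) simp
    finally have "u \<ominus>\<^bsub>P1\<^esub> v \<in> K1"
      using F.M.minus_closed[OF u v] by (simp add: K1_mem)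
    then have "\<phi> u \<ominus>\<^bsub>N\<^esub> \<phi> v = \<zero>\<^bsub>N\<^esub>"
      using Z additive_minus[OF left_hom_additive[OF \<phi>] F.M.abelian_group_axioms
          N.M.abelian_group_axioms u v] by simp
    then show ?thesis using left_hom_closed[OF \<phi>] u v by simp
  qed
  show *: "\<phi> (K0.gen_vec (syz_map R K0 u)) = \<phi> u" if "u \<in> carrier P1" for u
    using that K0.syz_map_mem by (intro diff) auto
  show "(\<lambda>\<kappa>. \<phi> (K0.gen_vec \<kappa>)) \<in> left_hom R K0.KM N"
  proof (rule left_homI)
    fix \<kappa> \<mu> assume "\<kappa> \<in> carrier K0.KM" "\<mu> \<in> carrier K0.KM"
    then have k: "\<kappa> \<in> K0" "\<mu> \<in> K0" by auto
    have "\<phi> (K0.gen_vec (\<kappa> \<oplus>\<^bsub>K0.KM\<^esub> \<mu>)) = \<phi> (K0.gen_vec \<kappa> \<oplus>\<^bsub>P1\<^esub> K0.gen_vec \<mu>)"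
    proof (rule diff)
      show "syz_map R K0 (K0.gen_vec (\<kappa> \<oplus>\<^bsub>K0.KM\<^esub> \<mu>)) = syz_map R K0 (K0.gen_vec \<kappa> \<oplus>\<^bsub>P1\<^esub> K0.gen_vec \<mu>)"
        using k by (subst left_hom_add[OF K0.syz_map_left_hom]) (auto simp: K0.add_mem)
    qed (use k in \<open>auto simp: K0.add_mem intro!: M.R.free_module_add_closed\<close>)
    then show "\<phi> (K0.gen_vec (\<kappa> \<oplus>\<^bsub>K0.KM\<^esub> \<mu>)) = \<phi> (K0.gen_vec \<kappa>) \<oplus>\<^bsub>N\<^esub> \<phi> (K0.gen_vec \<mu>)"
      using k by (subst (asm) left_hom_add[OF \<phi>]) auto
  next
    fix r \<kappa> assume r: "r \<in> carrier R" and "\<kappa> \<in> carrier K0.KM"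
    then have k: "\<kappa> \<in> K0" by auto
    have "\<phi> (K0.gen_vec (r \<odot>\<^bsub>K0.KM\<^esub> \<kappa>)) = \<phi> (r \<odot>\<^bsub>P1\<^esub> K0.gen_vec \<kappa>)"
    proof (rule diff)
      show "syz_map R K0 (K0.gen_vec (r \<odot>\<^bsub>K0.KM\<^esub> \<kappa>)) = syz_map R K0 (r \<odot>\<^bsub>P1\<^esub> K0.gen_vec \<kappa>)"
        using k r by (subst left_hom_smult[OF K0.syz_map_left_hom]) (auto simp: K0.smult_mem)
    qed (use k r in \<open>auto simp: K0.smult_mem intro!: M.R.free_module_smult_closed\<close>)
    then show "\<phi> (K0.gen_vec (r \<odot>\<^bsub>K0.KM\<^esub> \<kappa>)) = r \<odot>\<^bsub>N\<^esub> \<phi> (K0.gen_vec \<kappa>)"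
      using k r by (subst (asm) left_hom_smult[OF \<phi>]) auto
  qed (auto simp: left_hom_closed[OF \<phi>])
qed

text \<open>The converse of the factorization through \<open>K0\<close>: a map pulled back along
  \<open>P1\<close> to \<open>K0\<close> kills the kernel \<open>K1\<close>.\<close>

lemma cocycleI:
  assumes \<psi>: "\<psi> \<in> left_hom R K0.KM N"
  shows "restrict (\<lambda>u. \<psi> (syz_map R K0 u)) (carrier P1) \<in> cocycles R M N (Suc 0)"
proof -
  interpret F: left_module R P1 by (rule M.R.free_left_module)
  interpret KM: left_module R K0.KM by (rule K0.KM_left_module)
  have "\<psi> (\<lambda>x. \<zero>) = \<zero>\<^bsub>N\<^esub>"
    using additive_zero[OF left_hom_additive[OF \<psi>] KM.M.abelian_group_axioms N.M.abelian_group_axioms]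
    by simp
  then show ?thesis
    unfolding cocycle_iff using restrict_left_hom[OF F.M.abelian_group_axioms F.lsmult_closed
        left_hom_compose[OF K0.syz_map_left_hom_KM \<psi>]]
    by (auto simp: K1_mem)
qed

text \<open>The differential takes \<open>P1\<close> into the carrier of \<open>P0\<close>, so
  restricting \<open>\<chi>\<close> to that carrier, which makes it a cochain, does not alter the
  composite.\<close>

lemma coboundary_iff:
  "\<phi> \<in> coboundaries R M N (Suc 0) \<longleftrightarrow>
    (\<exists>\<chi>\<in>left_hom R P0 N. \<phi> = restrict (\<lambda>u. \<chi> (syz_map R K0 u)) (carrier P1))"
proof -
  interpret F: left_module R P0 by (rule M.R.free_left_module)
  have "\<phi> \<in> coboundaries R M N (Suc 0) \<longleftrightarrow>
    (\<exists>\<chi>\<in>left_hom R P0 N \<inter> extensional (carrier P0).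
      \<phi> = restrict (\<lambda>u. \<chi> (syz_map R K0 u)) (carrier P1))"
    by (auto simp: coboundaries_def cochains_def std_resolution_def hom_module_carrier codiff_def
        std_diff_def compose_def)
  also have "\<dots> \<longleftrightarrow> (\<exists>\<chi>\<in>left_hom R P0 N. \<phi> = restrict (\<lambda>u. \<chi> (syz_map R K0 u)) (carrier P1))"
  proof
    assume "\<exists>\<chi>\<in>left_hom R P0 N. \<phi> = restrict (\<lambda>u. \<chi> (syz_map R K0 u)) (carrier P1)"
    then obtain \<chi> where \<chi>: "\<chi> \<in> left_hom R P0 N"
      "\<phi> = restrict (\<lambda>u. \<chi> (syz_map R K0 u)) (carrier P1)" by blast
    have "syz_map R K0 u \<in> carrier P0" if "u \<in> carrier P1" for u
      using K0.syz_map_mem[OF that] by (simp add: K0_mem)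
    then have "\<phi> = restrict (\<lambda>u. restrict \<chi> (carrier P0) (syz_map R K0 u)) (carrier P1)"
      unfolding \<chi>(2) by (intro restrict_ext) simp
    then show "\<exists>\<chi>\<in>left_hom R P0 N \<inter> extensional (carrier P0).
        \<phi> = restrict (\<lambda>u. \<chi> (syz_map R K0 u)) (carrier P1)"
      using restrict_left_hom[OF F.M.abelian_group_axioms F.lsmult_closed \<chi>(1)] by blast
  qed blast
  finally show ?thesis .
qed

end

section \<open>Cocycles and derivations\<close>

declare free_module_simps [simp del]

locale k_algebra = A: module k A + A: ring A
  for k :: "('k, 'e) ring_scheme" and A :: "('k, 'a, 'f) module_scheme" (structure) +
  assumes smult_mult_l:
      "\<lbrakk>c \<in> carrier k; x \<in> carrier A; y \<in> carrier A\<rbrakk> \<Longrightarrow> (c \<odot> x) \<otimes> y = c \<odot> (x \<otimes> y)"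
    and smult_mult_r:
      "\<lbrakk>c \<in> carrier k; x \<in> carrier A; y \<in> carrier A\<rbrakk> \<Longrightarrow> x \<otimes> (c \<odot> y) = c \<odot> (x \<otimes> y)"

definition bilinear_maps :: "('k, 'e) ring_scheme \<Rightarrow> ('k, 'a, 'f) module_scheme \<Rightarrow> ('k, 'b, 'g) module_scheme \<Rightarrow>
    ('k, 'c, 'h) module_scheme \<Rightarrow> ('a \<Rightarrow> 'b \<Rightarrow> 'c) set" where
  "bilinear_maps k A B C = {f.
     (\<forall>a\<in>carrier A. f a \<in> left_hom k B C) \<and> (\<forall>b\<in>carrier B. (\<lambda>a. f a b) \<in> left_hom k A C)}"

definition derivations :: "('k, 'e) ring_scheme \<Rightarrow> ('k, 'a, 'f) module_scheme \<Rightarrow> ('a \<Rightarrow> 'a) set" where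
  "derivations k A = {D \<in> left_hom k A A. \<forall>x\<in>carrier A. \<forall>y\<in>carrier A.
     D (x \<otimes>\<^bsub>A\<^esub> y) = D x \<otimes>\<^bsub>A\<^esub> y \<oplus>\<^bsub>A\<^esub> x \<otimes>\<^bsub>A\<^esub> D y}"

lemma
  assumes "D \<in> derivations k A"
  shows derivation_left_hom: "D \<in> left_hom k A A"
    and derivation_mult: "\<lbrakk>x \<in> carrier A; y \<in> carrier A\<rbrakk> \<Longrightarrow>
      D (x \<otimes>\<^bsub>A\<^esub> y) = D x \<otimes>\<^bsub>A\<^esub> y \<oplus>\<^bsub>A\<^esub> x \<otimes>\<^bsub>A\<^esub> D y"
  using assms by (auto simp: derivations_def)

lemmas derivation_closed = left_hom_closed[OF derivation_left_hom]
  and derivation_add = left_hom_add[OF derivation_left_hom]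
  and derivation_smult = left_hom_smult[OF derivation_left_hom]

text \<open>
  The properties of \<open>A \<otimes> A\<^sup>o\<^sup>p\<close> and of its module \<open>A\<close> that enter the computation; \<open>t b c\<close> stands for
  \<open>b \<otimes> c\<close>.
\<close>

locale bimodule_env = A: k_algebra k A + two_modules R N N
  for k :: "('k, 'e) ring_scheme" and A :: "('k, 'a) module" (structure)
    and R :: "('k, 'r) module" and N :: "('r, 'a) module" +
  fixes t :: "'a \<Rightarrow> 'a \<Rightarrow> 'r"
  assumes carrier_N: "carrier N = carrier A"
    and add_N [simp]: "add N = add A"
    and zero_N [simp]: "zero N = zero A"
    and t_closed [simp]: "\<lbrakk>b \<in> carrier A; c \<in> carrier A\<rbrakk> \<Longrightarrow> t b c \<in> carrier R"
    and t_add_l: "\<lbrakk>b \<in> carrier A; b' \<in> carrier A; c \<in> carrier A\<rbrakk> \<Longrightarrow> t (b \<oplus> b') c = t b c \<oplus>\<^bsub>R\<^esub> t b' c"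
    and t_add_r: "\<lbrakk>b \<in> carrier A; c \<in> carrier A; c' \<in> carrier A\<rbrakk> \<Longrightarrow> t b (c \<oplus> c') = t b c \<oplus>\<^bsub>R\<^esub> t b c'"
    and t_scalar: "\<lbrakk>z \<in> carrier k; b \<in> carrier A; c \<in> carrier A\<rbrakk> \<Longrightarrow> t (z \<odot> b) c = t b (z \<odot> c)"
    and t_mult: "\<lbrakk>b \<in> carrier A; b' \<in> carrier A; c \<in> carrier A; c' \<in> carrier A\<rbrakk> \<Longrightarrow>
      t b c \<otimes>\<^bsub>R\<^esub> t b' c' = t (b \<otimes> b') (c' \<otimes> c)"
    and t_one: "t \<one> \<one> = \<one>\<^bsub>R\<^esub>"
    and t_act: "\<lbrakk>b \<in> carrier A; c \<in> carrier A; x \<in> carrier A\<rbrakk> \<Longrightarrow> t b c \<odot>\<^bsub>N\<^esub> x = b \<otimes> x \<otimes> c"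
    and smult_one_R: "z \<in> carrier k \<Longrightarrow> z \<odot>\<^bsub>R\<^esub> \<one>\<^bsub>R\<^esub> = t (z \<odot> \<one>) \<one>"
    and t_generate: "\<lbrakk>r \<in> carrier R; P \<zero>\<^bsub>R\<^esub>;
      \<And>b c r. \<lbrakk>b \<in> carrier A; c \<in> carrier A; r \<in> carrier R; P r\<rbrakk> \<Longrightarrow> P (t b c \<oplus>\<^bsub>R\<^esub> r)\<rbrakk> \<Longrightarrow> P r"
    and t_descend: "f \<in> bilinear_maps k A A A \<Longrightarrow>
      \<exists>L\<in>additive_maps R A. \<forall>b\<in>carrier A. \<forall>c\<in>carrier A. L (t b c) = f b c"
begin

text \<open>Rewriting with \<open>carrier_N\<close> itself would destroy the form of \<open>P0\<close>.\<close>

lemma mem_N [simp]: "x \<in> carrier N \<longleftrightarrow> x \<in> carrier A"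
  by (simp add: carrier_N)

lemma a_inv_N [simp]: "a_inv N = a_inv A"
  by (simp add: a_inv_def m_inv_def carrier_N fun_eq_iff)

lemma a_minus_N [simp]: "x \<ominus>\<^bsub>N\<^esub> y = x \<ominus> y"
  by (simp add: a_minus_def)

abbreviation "e1 \<equiv> basis_vec R (Gen \<one> :: ('a, 'r) gen)"

text \<open>The universal derivation of \<open>A\<close> into the kernel of the multiplication map;
  \<open>d_mult\<close> is its Leibniz rule.\<close>

definition d :: "'a \<Rightarrow> 'r" where "d a = t a \<one> \<ominus>\<^bsub>R\<^esub> t \<one> a"

sublocale P0: left_module R P0 by (rule M.R.free_left_module)
sublocale KM: left_module R K0.KM by (rule K0.KM_left_module)

lemma e1_closed [simp]: "e1 \<in> carrier P0" by simp

lemma KM_ops [simp]: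
  "add K0.KM = add P0" "zero K0.KM = zero P0" "smult K0.KM = smult P0"
  by (simp_all add: free_module_simps)

lemma KM_minus: "\<lbrakk>u \<in> K0; v \<in> K0\<rbrakk> \<Longrightarrow> u \<ominus>\<^bsub>K0.KM\<^esub> v = u \<ominus>\<^bsub>P0\<^esub> v"
proof -
  assume u: "u \<in> K0" and v: "v \<in> K0"
  have neg: "\<ominus>\<^bsub>K0.KM\<^esub> v = \<ominus>\<^bsub>P0\<^esub> v"
  proof (rule P0.M.minus_equality[symmetric])
    show "\<ominus>\<^bsub>K0.KM\<^esub> v \<oplus>\<^bsub>P0\<^esub> v = \<zero>\<^bsub>P0\<^esub>" using KM.M.l_neg[of v] v by simp
    show "\<ominus>\<^bsub>K0.KM\<^esub> v \<in> carrier P0" using KM.M.a_inv_closed[of v] v by (simp add: K0_mem)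
  qed (use v in \<open>simp add: K0_mem\<close>)
  then show ?thesis by (simp add: a_minus_def)
qed

lemma d_closed [simp]: "a \<in> carrier A \<Longrightarrow> d a \<in> carrier R"
  by (simp add: d_def)

lemma augmentation_e1: "augmentation R N (r \<odot>\<^bsub>P0\<^esub> e1) = r \<odot>\<^bsub>N\<^esub> \<one>" if "r \<in> carrier R"
  using left_hom_smult[OF augmentation_left_hom that e1_closed] by simp

lemma smult_e1_mem: "\<lbrakk>r \<in> carrier R; r \<odot>\<^bsub>N\<^esub> \<one> = \<zero>\<rbrakk> \<Longrightarrow> r \<odot>\<^bsub>P0\<^esub> e1 \<in> K0"
  using augmentation_e1[of r] P0.lsmult_closed[of r e1] by (simp add: K0_mem)

lemma minus_act: "\<lbrakk>r \<in> carrier R; s \<in> carrier R; x \<in> carrier A\<rbrakk> \<Longrightarrow>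
    (r \<ominus>\<^bsub>R\<^esub> s) \<odot>\<^bsub>N\<^esub> x = r \<odot>\<^bsub>N\<^esub> x \<ominus> s \<odot>\<^bsub>N\<^esub> x"
  using M.lsmult_l_distr[of r "\<ominus>\<^bsub>R\<^esub> s" x] M.lsmult_l_minus[of s x] by (simp add: a_minus_def)

lemma act_closed [simp]: "\<lbrakk>r \<in> carrier R; x \<in> carrier A\<rbrakk> \<Longrightarrow> r \<odot>\<^bsub>N\<^esub> x \<in> carrier A"
  using M.lsmult_closed by simp

lemma d_act_one: "a \<in> carrier A \<Longrightarrow> d a \<odot>\<^bsub>N\<^esub> \<one> = \<zero>"
  by (simp add: d_def minus_act t_act)

lemma d_act: "\<lbrakk>a \<in> carrier A; x \<in> carrier A\<rbrakk> \<Longrightarrow> d a \<odot>\<^bsub>N\<^esub> x = a \<otimes> x \<ominus> x \<otimes> a"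
  by (simp add: d_def minus_act t_act)

abbreviation "dvec a \<equiv> d a \<odot>\<^bsub>P0\<^esub> e1"

lemma dvec_mem [simp]: "a \<in> carrier A \<Longrightarrow> dvec a \<in> K0"
  by (simp add: smult_e1_mem d_act_one)

lemma d_add: "\<lbrakk>a \<in> carrier A; b \<in> carrier A\<rbrakk> \<Longrightarrow> d (a \<oplus> b) = d a \<oplus>\<^bsub>R\<^esub> d b"
  by (simp add: d_def t_add_l t_add_r a_minus_def M.R.minus_add M.R.a_ac)

lemma d_scalar: "\<lbrakk>x \<in> carrier k; a \<in> carrier A\<rbrakk> \<Longrightarrow> d (x \<odot> a) = t (x \<odot> \<one>) \<one> \<otimes>\<^bsub>R\<^esub> d a"
  by (simp add: d_def a_minus_def M.R.r_distr M.R.r_minus t_mult t_scalar[symmetric] A.smult_mult_l)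

text \<open>The difference between \<open>t (a \<otimes> b) \<one>\<close> and
  \<open>t \<one> (a \<otimes> b)\<close> telescopes through \<open>t a b\<close>.\<close>

lemma d_mult:
  assumes "a \<in> carrier A" "b \<in> carrier A"
  shows "d (a \<otimes> b) = t \<one> b \<otimes>\<^bsub>R\<^esub> d a \<oplus>\<^bsub>R\<^esub> t a \<one> \<otimes>\<^bsub>R\<^esub> d b"
proof -
  have "t \<one> b \<otimes>\<^bsub>R\<^esub> d a = t a b \<ominus>\<^bsub>R\<^esub> t \<one> (a \<otimes> b)"
    "t a \<one> \<otimes>\<^bsub>R\<^esub> d b = t (a \<otimes> b) \<one> \<ominus>\<^bsub>R\<^esub> t a b"
    using assms by (simp_all add: d_def a_minus_def M.R.r_distr M.R.r_minus t_mult)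
  then show ?thesis
    using assms by (simp add: d_def a_minus_def M.R.a_ac M.R.r_neg1 M.R.r_neg2 M.R.r_neg)
qed

section \<open>Homomorphisms on the first syzygies and derivations\<close>

context
  fixes \<psi>
  assumes \<psi>: "\<psi> \<in> left_hom R K0.KM N"
begin

lemma \<psi>_closed [simp]: "\<kappa> \<in> K0 \<Longrightarrow> \<psi> \<kappa> \<in> carrier A"
  using left_hom_closed[OF \<psi>] by simp

lemma \<psi>_add: "\<lbrakk>u \<in> K0; v \<in> K0\<rbrakk> \<Longrightarrow> \<psi> (u \<oplus>\<^bsub>P0\<^esub> v) = \<psi> u \<oplus> \<psi> v"
  using left_hom_add[OF \<psi>] by simp

lemma \<psi>_smult: "\<lbrakk>r \<in> carrier R; v \<in> K0\<rbrakk> \<Longrightarrow> \<psi> (r \<odot>\<^bsub>P0\<^esub> v) = r \<odot>\<^bsub>N\<^esub> \<psi> v"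
  using left_hom_smult[OF \<psi>] by simp

lemma \<psi>_minus: "\<lbrakk>u \<in> K0; v \<in> K0\<rbrakk> \<Longrightarrow> \<psi> (u \<ominus>\<^bsub>P0\<^esub> v) = \<psi> u \<ominus> \<psi> v"
  using additive_minus[OF left_hom_additive[OF \<psi>] KM.M.abelian_group_axioms M.M.abelian_group_axioms]
  by (simp add: KM_minus)

lemma K0_smult: "\<lbrakk>r \<in> carrier R; v \<in> K0\<rbrakk> \<Longrightarrow> r \<odot>\<^bsub>P0\<^esub> v \<in> K0"
  using KM.lsmult_closed by simp

lemma derivation_of_hom: "(\<lambda>a. \<psi> (dvec a)) \<in> derivations k A"
proof -
  have "\<psi> (dvec (a \<oplus> b)) = \<psi> (dvec a) \<oplus> \<psi> (dvec b)" if "a \<in> carrier A" "b \<in> carrier A" for a b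
    using that by (simp add: d_add P0.lsmult_l_distr \<psi>_add)
  moreover have "\<psi> (dvec (x \<odot> a)) = x \<odot> \<psi> (dvec a)" if "x \<in> carrier k" "a \<in> carrier A" for x a
    using that by (simp add: d_scalar P0.lsmult_assoc \<psi>_smult t_act A.smult_mult_l)
  moreover have "\<psi> (dvec (a \<otimes> b)) = \<psi> (dvec a) \<otimes> b \<oplus> a \<otimes> \<psi> (dvec b)"
    if "a \<in> carrier A" "b \<in> carrier A" for a b
    using that by (simp add: d_mult P0.lsmult_l_distr P0.lsmult_assoc \<psi>_add \<psi>_smult K0_smult t_act)
  ultimately show ?thesis by (auto simp: derivations_def intro!: left_homI)
qed

text \<open>Writing \<open>u = (u - (aug u) e\<^sub>1) + (aug u) e\<^sub>1\<close> extends \<open>\<psi>\<close> to \<open>P\<^sub>0\<close> with \<open>m\<close> as the value at \<open>e\<^sub>1\<close>.\<close>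

lemma extend_inner:
  assumes m: "m \<in> carrier A" and inner: "\<And>a. a \<in> carrier A \<Longrightarrow> \<psi> (dvec a) = a \<otimes> m \<ominus> m \<otimes> a"
  shows "\<exists>\<chi>\<in>left_hom R P0 N. \<forall>\<kappa>\<in>K0. \<chi> \<kappa> = \<psi> \<kappa>"
proof -
  let ?aug = "augmentation R N"
  \<comment> \<open>The component of \<open>u\<close> in \<open>K0\<close>: the augmentation of
    \<open>u\<close> is lifted back to \<open>P0\<close> along \<open>e1\<close> and
    subtracted.\<close>
  define \<beta> where "\<beta> u = u \<ominus>\<^bsub>P0\<^esub> t (?aug u) \<one> \<odot>\<^bsub>P0\<^esub> e1" for u
  define \<chi> where "\<chi> u = \<psi> (\<beta> u) \<oplus> ?aug u \<otimes> m" for u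
  have aug_c [simp]: "?aug u \<in> carrier A" if "u \<in> carrier P0" for u
    using left_hom_closed[OF augmentation_left_hom that] by simp
  note aug_add = left_hom_add[OF augmentation_left_hom, simplified]
  note aug_smult = left_hom_smult[OF augmentation_left_hom, simplified]
  have te [simp]: "t a b \<odot>\<^bsub>P0\<^esub> e1 \<in> carrier P0" if "a \<in> carrier A" "b \<in> carrier A" for a b
    using that by (intro P0.lsmult_closed) auto
  have \<beta>_mem [simp]: "\<beta> u \<in> K0" if u: "u \<in> carrier P0" for u
  proof -
    have "?aug (\<beta> u) = ?aug u \<ominus> ?aug u"
      unfolding \<beta>_def using u
        additive_minus[OF left_hom_additive[OF augmentation_left_hom] P0.M.abelian_group_axioms
          M.M.abelian_group_axioms, of u "t (?aug u) \<one> \<odot>\<^bsub>P0\<^esub> e1"]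
      by (simp add: augmentation_e1 t_act)
    then show ?thesis using u
      by (simp add: K0_mem \<beta>_def a_minus_def A.A.r_neg)
  qed
  have \<beta>_add: "\<beta> (u \<oplus>\<^bsub>P0\<^esub> v) = \<beta> u \<oplus>\<^bsub>P0\<^esub> \<beta> v" if "u \<in> carrier P0" "v \<in> carrier P0" for u v
    using that by (simp add: \<beta>_def aug_add t_add_l P0.lsmult_l_distr a_minus_def P0.M.minus_add P0.M.a_ac)
  have \<chi>_closed: "\<chi> u \<in> carrier A" if "u \<in> carrier P0" for u
    using that m by (simp add: \<chi>_def)
  have \<chi>_add: "\<chi> (u \<oplus>\<^bsub>P0\<^esub> v) = \<chi> u \<oplus> \<chi> v" if "u \<in> carrier P0" "v \<in> carrier P0" for u v
    using that m by (simp add: \<chi>_def \<beta>_add aug_add \<psi>_add A.A.l_distr A.A.a_ac)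
  \<comment> \<open>The map \<open>\<beta>\<close> respects multiplication from the left factor but
    not from the right one. Its defect at \<open>t b c\<close> is
    \<open>t (b \<otimes> a) \<one>\<close> applied to \<open>dvec c\<close>, with \<open>a\<close>
    the augmentation of \<open>u\<close>; the inner form of \<open>\<psi>\<close> at
    \<open>dvec c\<close> cancels this against the change in the term
    \<open>?aug u \<otimes> m\<close>.\<close>
  have \<chi>_t: "\<chi> (t b c \<odot>\<^bsub>P0\<^esub> u) = t b c \<odot>\<^bsub>N\<^esub> \<chi> u"
    if u: "u \<in> carrier P0" and b: "b \<in> carrier A" and c: "c \<in> carrier A" for b c u
  proof -
    define a where "a = ?aug u"
    have a [simp]: "a \<in> carrier A" using u by (simp add: a_def)
    note [simp] = b c u m
    define w where "w = t b c \<odot>\<^bsub>P0\<^esub> u"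
    define x where "x = t (b \<otimes> a) c \<odot>\<^bsub>P0\<^esub> e1"
    define y where "y = t (b \<otimes> a \<otimes> c) \<one> \<odot>\<^bsub>P0\<^esub> e1"
    have wxy [simp]: "w \<in> carrier P0" "x \<in> carrier P0" "y \<in> carrier P0"
      by (simp_all add: w_def x_def y_def)
    have 1: "\<beta> (t b c \<odot>\<^bsub>P0\<^esub> u) = w \<ominus>\<^bsub>P0\<^esub> y"
      by (simp add: \<beta>_def aug_smult t_act w_def y_def a_def)
    have 2: "t b c \<odot>\<^bsub>P0\<^esub> \<beta> u = w \<ominus>\<^bsub>P0\<^esub> x"
      by (simp add: \<beta>_def a_minus_def P0.lsmult_r_distr P0.lsmult_r_minus w_def x_def a_def
          P0.lsmult_assoc[symmetric] t_mult)
    have 3: "t (b \<otimes> a) \<one> \<odot>\<^bsub>P0\<^esub> dvec c = y \<ominus>\<^bsub>P0\<^esub> x"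
    proof -
      have "t (b \<otimes> a) \<one> \<otimes>\<^bsub>R\<^esub> d c = t (b \<otimes> a \<otimes> c) \<one> \<oplus>\<^bsub>R\<^esub> \<ominus>\<^bsub>R\<^esub> t (b \<otimes> a) c"
        by (simp add: d_def a_minus_def M.R.r_distr M.R.r_minus t_mult)
      then show ?thesis
        using P0.lsmult_assoc[of "t (b \<otimes> a) \<one>" "d c" e1]
        by (simp add: P0.lsmult_l_distr P0.lsmult_l_minus x_def y_def a_minus_def)
    qed
    have "w \<ominus>\<^bsub>P0\<^esub> y = (w \<ominus>\<^bsub>P0\<^esub> x) \<ominus>\<^bsub>P0\<^esub> (y \<ominus>\<^bsub>P0\<^esub> x)"
      by (simp add: a_minus_def P0.M.minus_add P0.M.a_ac P0.M.r_neg2)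
    then have "\<beta> (t b c \<odot>\<^bsub>P0\<^esub> u) = t b c \<odot>\<^bsub>P0\<^esub> \<beta> u \<ominus>\<^bsub>P0\<^esub> t (b \<otimes> a) \<one> \<odot>\<^bsub>P0\<^esub> dvec c"
      by (simp only: 1 2 3)
    then have "\<psi> (\<beta> (t b c \<odot>\<^bsub>P0\<^esub> u)) = b \<otimes> \<psi> (\<beta> u) \<otimes> c \<ominus> b \<otimes> a \<otimes> (c \<otimes> m \<ominus> m \<otimes> c)"
      by (simp add: \<psi>_minus K0_smult \<psi>_smult t_act inner)
    then have "\<chi> (t b c \<odot>\<^bsub>P0\<^esub> u) =
        b \<otimes> \<psi> (\<beta> u) \<otimes> c \<ominus> b \<otimes> a \<otimes> (c \<otimes> m \<ominus> m \<otimes> c) \<oplus> b \<otimes> a \<otimes> c \<otimes> m"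
      by (simp add: \<chi>_def aug_smult t_act a_def)
    also have "\<dots> = b \<otimes> (\<psi> (\<beta> u) \<oplus> a \<otimes> m) \<otimes> c"
    proof -
      define X Y Z where "X = b \<otimes> \<psi> (\<beta> u) \<otimes> c" and "Y = b \<otimes> a \<otimes> c \<otimes> m" and "Z = b \<otimes> a \<otimes> m \<otimes> c"
      have XYZ: "X \<in> carrier A" "Y \<in> carrier A" "Z \<in> carrier A" by (simp_all add: X_def Y_def Z_def)
      have "b \<otimes> a \<otimes> (c \<otimes> m \<ominus> m \<otimes> c) = Y \<ominus> Z"
        by (simp add: Y_def Z_def a_minus_def A.A.r_distr A.A.r_minus A.A.m_assoc)
      moreover have "b \<otimes> (\<psi> (\<beta> u) \<oplus> a \<otimes> m) \<otimes> c = X \<oplus> Z"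
        by (simp add: X_def Z_def A.A.r_distr A.A.l_distr A.A.m_assoc)
      moreover have "X \<ominus> (Y \<ominus> Z) \<oplus> Y = X \<oplus> Z"
        using XYZ by (simp add: a_minus_def A.A.minus_add A.A.a_assoc A.A.a_comm[of Z Y] A.A.r_neg1)
      ultimately show ?thesis by (simp only: X_def Y_def)
    qed
    finally show ?thesis by (simp add: \<chi>_def t_act a_def)
  qed
  have \<chi>_smult: "\<chi> (r \<odot>\<^bsub>P0\<^esub> u) = r \<odot>\<^bsub>N\<^esub> \<chi> u" if u: "u \<in> carrier P0" and r: "r \<in> carrier R" for r u
    using r
  proof (rule t_generate)
    have "\<chi> \<zero>\<^bsub>P0\<^esub> \<oplus> \<chi> \<zero>\<^bsub>P0\<^esub> = \<chi> \<zero>\<^bsub>P0\<^esub>" using \<chi>_add[of "\<zero>\<^bsub>P0\<^esub>" "\<zero>\<^bsub>P0\<^esub>"] by simp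
    then have "\<chi> \<zero>\<^bsub>P0\<^esub> = \<zero>" using \<chi>_closed[of "\<zero>\<^bsub>P0\<^esub>"] by (simp add: A.A.add.r_cancel_one)
    then show "\<chi> (\<zero>\<^bsub>R\<^esub> \<odot>\<^bsub>P0\<^esub> u) = \<zero>\<^bsub>R\<^esub> \<odot>\<^bsub>N\<^esub> \<chi> u"
      using u \<chi>_closed[OF u] by simp
  qed (use u \<chi>_closed[OF u] in \<open>simp add: P0.lsmult_l_distr M.lsmult_l_distr \<chi>_add \<chi>_t\<close>)
  have "\<chi> \<in> left_hom R P0 N"
    by (rule left_homI) (simp_all add: \<chi>_closed \<chi>_add \<chi>_smult)
  moreover have "\<chi> \<kappa> = \<psi> \<kappa>" if \<kappa>: "\<kappa> \<in> K0" for \<kappa>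
  proof -
    \<comment> \<open>On \<open>K0\<close> the augmentation vanishes, so \<open>\<beta>\<close> is
      the identity there once \<open>t \<zero> \<one>\<close> is known to be zero.\<close>
    have "t \<zero> \<one> = t \<zero> \<one> \<oplus>\<^bsub>R\<^esub> t \<zero> \<one>" using t_add_l[of \<zero> \<zero> \<one>] by simp
    then have t0: "t \<zero> \<one> = \<zero>\<^bsub>R\<^esub>" using M.R.add.r_cancel_one[of "t \<zero> \<one>" "t \<zero> \<one>"] by simp
    have \<kappa>': "\<kappa> \<in> carrier P0" "augmentation R N \<kappa> = \<zero>" using \<kappa> by (simp_all add: K0_mem)
    have "\<beta> \<kappa> = \<kappa> \<oplus>\<^bsub>P0\<^esub> \<ominus>\<^bsub>P0\<^esub> (\<zero>\<^bsub>R\<^esub> \<odot>\<^bsub>P0\<^esub> e1)"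
      unfolding \<beta>_def \<kappa>'(2) t0 a_minus_def ..
    also have "\<ominus>\<^bsub>P0\<^esub> (\<zero>\<^bsub>R\<^esub> \<odot>\<^bsub>P0\<^esub> e1) = \<zero>\<^bsub>P0\<^esub>"
      by (rule P0.M.minus_equality) simp_all
    also have "\<kappa> \<oplus>\<^bsub>P0\<^esub> \<zero>\<^bsub>P0\<^esub> = \<kappa>" using \<kappa>'(1) by (rule P0.M.r_zero)
    finally show ?thesis using m \<psi>_closed[OF \<kappa>] \<kappa>'(2) by (simp add: \<chi>_def)
  qed
  ultimately show ?thesis by (intro bexI[of _ \<chi>]) simp_all
qed

end

lemma inner_of_extension:
  assumes "\<chi> \<in> left_hom R P0 N" "a \<in> carrier A"
  shows "\<chi> (dvec a) = a \<otimes> \<chi> e1 \<ominus> \<chi> e1 \<otimes> a"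
  using left_hom_smult[OF assms(1), of "d a" e1] left_hom_closed[OF assms(1) e1_closed] assms(2)
  by (simp add: d_act)

text \<open>The homomorphism is the composite of \<open>\<pi>\<close> and \<open>L\<close>. The
  linear map \<open>\<pi>\<close> from \<open>P0\<close> to R lifts the augmentation along the
  action on \<open>\<one>\<close>, so it carries \<open>K0\<close> into the elements that annihilate
  \<open>\<one>\<close>; on those the additive map \<open>L\<close> determined by \<open>D\<close>
  is R-linear.\<close>

lemma hom_of_derivation:
  assumes D: "D \<in> derivations k A"
  shows "\<exists>\<psi>\<in>left_hom R K0.KM N. \<forall>a\<in>carrier A. \<psi> (dvec a) = D a"
proof -
  note [simp] = derivation_closed[OF D]
  have "D \<one> = D \<one> \<oplus> D \<one>" using derivation_mult[OF D, of \<one> \<one>] by simp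
  then have D1: "D \<one> = \<zero>" using A.A.add.r_cancel_one[of "D \<one>" "D \<one>"] by simp
  \<comment> \<open>The sign makes \<open>L (d a) = D a\<close>: since \<open>D \<one>\<close> is
    zero, only the term \<open>t \<one> a\<close> contributes, and it enters \<open>d a\<close>
    negatively.\<close>
  have "(\<lambda>b c. \<ominus> (b \<otimes> D c)) \<in> bilinear_maps k A A A"
    unfolding bilinear_maps_def
    by (auto intro!: left_homI simp: derivation_add[OF D] derivation_smult[OF D] A.A.r_distr A.A.l_distr
        A.A.minus_add A.smult_mult_l A.smult_mult_r A.A.smult_r_minus)
  then obtain L where L: "L \<in> additive_maps R A"
    and Lt: "\<And>b c. \<lbrakk>b \<in> carrier A; c \<in> carrier A\<rbrakk> \<Longrightarrow> L (t b c) = \<ominus> (b \<otimes> D c)"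
    using t_descend by blast
  have Lc [simp]: "L r \<in> carrier A" if "r \<in> carrier R" for r using additive_closed[OF L that] .
  note L_add = additive_add[OF L]
  have L0: "L \<zero>\<^bsub>R\<^esub> = \<zero>"
    using additive_zero[OF L M.R.abelian_group_axioms A.A.abelian_group_axioms] .
  \<comment> \<open>The Leibniz rule leaves a defect of linearity that is a multiple of the action
    of \<open>s\<close> on \<open>\<one>\<close>; it disappears for the \<open>s\<close> considered
    in \<open>L_mult\<close>.\<close>
  have Ltm: "L (t b c \<otimes>\<^bsub>R\<^esub> s) = t b c \<odot>\<^bsub>N\<^esub> L s \<ominus> b \<otimes> (s \<odot>\<^bsub>N\<^esub> \<one>) \<otimes> D c"
    if s: "s \<in> carrier R" and b: "b \<in> carrier A" and c: "c \<in> carrier A" for b c s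
    using s
  proof (rule t_generate)
    show "L (t b c \<otimes>\<^bsub>R\<^esub> \<zero>\<^bsub>R\<^esub>) = t b c \<odot>\<^bsub>N\<^esub> L \<zero>\<^bsub>R\<^esub> \<ominus> b \<otimes> (\<zero>\<^bsub>R\<^esub> \<odot>\<^bsub>N\<^esub> \<one>) \<otimes> D c"
      using b c by (simp add: L0 a_minus_def t_act)
    fix b' c' s assume b': "b' \<in> carrier A" "c' \<in> carrier A" and s: "s \<in> carrier R"
      and IH: "L (t b c \<otimes>\<^bsub>R\<^esub> s) = t b c \<odot>\<^bsub>N\<^esub> L s \<ominus> b \<otimes> (s \<odot>\<^bsub>N\<^esub> \<one>) \<otimes> D c"
    define y where "y = s \<odot>\<^bsub>N\<^esub> \<one>"
    have y: "y \<in> carrier A" using s by (simp add: y_def)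
    have "L (t b c \<otimes>\<^bsub>R\<^esub> (t b' c' \<oplus>\<^bsub>R\<^esub> s)) =
        \<ominus> (b \<otimes> b' \<otimes> (D c' \<otimes> c \<oplus> c' \<otimes> D c)) \<oplus> (b \<otimes> L s \<otimes> c \<ominus> b \<otimes> y \<otimes> D c)"
      using b c b' s IH by (simp add: M.R.r_distr L_add t_mult Lt derivation_mult[OF D] t_act y_def)
    also have "\<dots> = b \<otimes> (\<ominus> (b' \<otimes> D c') \<oplus> L s) \<otimes> c \<ominus> b \<otimes> (b' \<otimes> c' \<oplus> y) \<otimes> D c"
      using b c b' s y by (simp add: A.A.ring_simprules a_minus_def)
    also have "\<dots> = t b c \<odot>\<^bsub>N\<^esub> L (t b' c' \<oplus>\<^bsub>R\<^esub> s) \<ominus> b \<otimes> ((t b' c' \<oplus>\<^bsub>R\<^esub> s) \<odot>\<^bsub>N\<^esub> \<one>) \<otimes> D c"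
      using b c b' s by (simp add: L_add Lt t_act M.lsmult_l_distr y_def)
    finally show "L (t b c \<otimes>\<^bsub>R\<^esub> (t b' c' \<oplus>\<^bsub>R\<^esub> s)) =
        t b c \<odot>\<^bsub>N\<^esub> L (t b' c' \<oplus>\<^bsub>R\<^esub> s) \<ominus> b \<otimes> ((t b' c' \<oplus>\<^bsub>R\<^esub> s) \<odot>\<^bsub>N\<^esub> \<one>) \<otimes> D c" .
  qed
  have L_mult: "L (r \<otimes>\<^bsub>R\<^esub> s) = r \<odot>\<^bsub>N\<^esub> L s"
    if r: "r \<in> carrier R" and s: "s \<in> carrier R" "s \<odot>\<^bsub>N\<^esub> \<one> = \<zero>" for r s
    using r
  proof (rule t_generate)
    show "L (\<zero>\<^bsub>R\<^esub> \<otimes>\<^bsub>R\<^esub> s) = \<zero>\<^bsub>R\<^esub> \<odot>\<^bsub>N\<^esub> L s" using s by (simp add: L0)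
  qed (use s in \<open>simp add: M.R.l_distr L_add Ltm M.lsmult_l_distr a_minus_def\<close>)
  \<comment> \<open>R as a left module over itself, the target of \<open>\<pi>\<close>, under which
    the generator at an element \<open>x\<close> of \<open>A\<close> goes to
    \<open>t x \<one>\<close>.\<close>
  define Rl where "Rl = \<lparr>carrier = carrier R, mult = mult R, one = one R, zero = zero R, add = add R,
    smult = mult R\<rparr>"
  have Rl [simp]: "carrier Rl = carrier R" "zero Rl = zero R" "add Rl = add R" "smult Rl = mult R"
    by (simp_all add: Rl_def)
  have "abelian_group Rl"
    by (rule abelian_groupI) (auto simp: M.R.a_ac intro: M.R.l_neg)
  interpret Rl: left_module R Rl
    by (rule left_moduleI[OF M.R.ring_axioms \<open>abelian_group Rl\<close>]) (simp_all add: M.R.ring_simprules)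
  define p where "p x = t (gen_elem x) \<one>" for x :: "('a, 'r) gen"
  have p: "p \<in> Gen ` carrier N \<rightarrow> carrier Rl" by (auto simp: p_def)
  define \<pi> where "\<pi> = lin_ext R (Gen ` carrier N) Rl p"
  have \<pi>: "\<pi> \<in> left_hom R P0 Rl" unfolding \<pi>_def by (rule Rl.lin_ext_left_hom[OF p])
  have \<pi>_act: "\<pi> u \<odot>\<^bsub>N\<^esub> \<one> = augmentation R N u" if u: "u \<in> carrier P0" for u
  proof (rule M.R.free_module_hom_eqI[OF u M.left_module_axioms _ augmentation_left_hom])
    show "(\<lambda>u. \<pi> u \<odot>\<^bsub>N\<^esub> \<one>) \<in> left_hom R P0 N"
      using left_hom_closed[OF \<pi>] left_hom_add[OF \<pi>] left_hom_smult[OF \<pi>]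
      by (intro left_homI) (simp_all add: M.lsmult_l_distr M.lsmult_assoc)
    fix x :: "('a, 'r) gen" assume "x \<in> Gen ` carrier N"
    then obtain a where a: "a \<in> carrier A" "x = Gen a" by auto
    then show "\<pi> (basis_vec R x) \<odot>\<^bsub>N\<^esub> \<one> = augmentation R N (basis_vec R x)"
      using Rl.lin_ext_basis_vec[OF _ p, of x] by (simp add: \<pi>_def p_def t_act)
  qed
  have "(\<lambda>u. L (\<pi> u)) \<in> left_hom R K0.KM N"
    using left_hom_closed[OF \<pi>] left_hom_add[OF \<pi>] left_hom_smult[OF \<pi>] \<pi>_act
    by (intro left_homI) (simp_all add: K0_mem L_add L_mult)
  moreover have "L (\<pi> (dvec a)) = D a" if a: "a \<in> carrier A" for a
  proof -
    have "\<pi> e1 = \<one>\<^bsub>R\<^esub>"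
      using Rl.lin_ext_basis_vec[OF _ p, of "Gen \<one>"] by (simp add: \<pi>_def p_def t_one)
    then have "\<pi> (dvec a) = d a"
      using left_hom_smult[OF \<pi>, of "d a" e1] a by simp
    then have "L (\<pi> (dvec a)) = L (t a \<one>) \<ominus> L (t \<one> a)"
      using additive_minus[OF L M.R.abelian_group_axioms A.A.abelian_group_axioms] a by (simp add: d_def)
    then show ?thesis using a by (simp add: Lt D1 a_minus_def)
  qed
  ultimately show ?thesis by (intro bexI[of _ "\<lambda>u. L (\<pi> u)"]) simp_all
qed

definition cocycle_derivation :: "((('a, 'r) gen \<Rightarrow> 'r) \<Rightarrow> 'a) \<Rightarrow> 'a \<Rightarrow> 'a" where
  "cocycle_derivation \<phi> a = \<phi> (K0.gen_vec (dvec a))"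

lemma cocycle_derivation:
  assumes "\<phi> \<in> cocycles R N N (Suc 0)"
  shows "cocycle_derivation \<phi> \<in> derivations k A"
  using derivation_of_hom[OF cocycle_left_hom(1)[OF assms]] by (simp add: cocycle_derivation_def[abs_def])

text \<open>The element \<open>m\<close> is the value at \<open>e1\<close> of an extension to
  \<open>P0\<close>: any extension yields one by \<open>inner_of_extension\<close>, and
  \<open>extend_inner\<close> rebuilds an extension from it.\<close>

lemma coboundary_iff_inner:
  assumes \<phi>: "\<phi> \<in> cocycles R N N (Suc 0)"
  shows "\<phi> \<in> coboundaries R N N (Suc 0) \<longleftrightarrow>
    (\<exists>m\<in>carrier A. \<forall>a\<in>carrier A. cocycle_derivation \<phi> a = a \<otimes> m \<ominus> m \<otimes> a)" (is "?l \<longleftrightarrow> ?r")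
proof
  assume ?l
  then obtain \<chi> where \<chi>: "\<chi> \<in> left_hom R P0 N" "\<phi> = restrict (\<lambda>u. \<chi> (syz_map R K0 u)) (carrier P1)"
    by (auto simp: coboundary_iff)
  have "cocycle_derivation \<phi> a = \<chi> (dvec a)" if "a \<in> carrier A" for a
    using that by (simp add: cocycle_derivation_def \<chi>(2))
  then show ?r using inner_of_extension[OF \<chi>(1)] left_hom_closed[OF \<chi>(1) e1_closed] by auto
next
  assume ?r
  then obtain m where m: "m \<in> carrier A"
    "\<And>a. a \<in> carrier A \<Longrightarrow> cocycle_derivation \<phi> a = a \<otimes> m \<ominus> m \<otimes> a" by blast
  obtain \<chi> where \<chi>: "\<chi> \<in> left_hom R P0 N" "\<And>\<kappa>. \<kappa> \<in> K0 \<Longrightarrow> \<chi> \<kappa> = \<phi> (K0.gen_vec \<kappa>)"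
    using extend_inner[OF cocycle_left_hom(1)[OF \<phi>] m(1)] m(2) by (auto simp: cocycle_derivation_def)
  have "\<phi> = restrict (\<lambda>u. \<chi> (syz_map R K0 u)) (carrier P1)"
  proof (rule extensionalityI[where A = "carrier P1"])
    show "\<phi> \<in> extensional (carrier P1)" using \<phi> by (simp add: cocycle_iff)
    show "\<phi> u = restrict (\<lambda>u. \<chi> (syz_map R K0 u)) (carrier P1) u" if "u \<in> carrier P1" for u
      using that \<chi>(2)[OF K0.syz_map_mem[OF that]] cocycle_left_hom(2)[OF \<phi> that] by simp
  qed simp
  with \<chi>(1) show ?l by (auto simp: coboundary_iff)
qed

lemma cocycle_of_derivation:
  assumes "D \<in> derivations k A"
  shows "\<exists>\<phi>\<in>cocycles R N N (Suc 0). \<forall>a\<in>carrier A. cocycle_derivation \<phi> a = D a"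
proof -
  obtain \<psi> where \<psi>: "\<psi> \<in> left_hom R K0.KM N" "\<forall>a\<in>carrier A. \<psi> (dvec a) = D a"
    using hom_of_derivation[OF assms] by blast
  show ?thesis
    using cocycleI[OF \<psi>(1)] \<psi>(2) by (intro bexI[OF _ cocycleI[OF \<psi>(1)]]) (simp add: cocycle_derivation_def)
qed

end

section \<open>Monoid algebras and tensor products\<close>

lemma abelian_group_cong:
  assumes "abelian_group M" "carrier M' = carrier M" "zero M' = zero M" "add M' = add M"
  shows "abelian_group M'"
proof -
  interpret M: abelian_group M by fact
  show ?thesis
  proof (rule abelian_groupI)
    fix x assume "x \<in> carrier M'"
    then show "\<exists>y\<in>carrier M'. y \<oplus>\<^bsub>M'\<^esub> x = \<zero>\<^bsub>M'\<^esub>"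
      using M.l_neg[of x] M.a_inv_closed[of x] by (auto simp: assms(2-))
  next
    fix x y assume "x \<in> carrier M'" "y \<in> carrier M'"
    then show "x \<oplus>\<^bsub>M'\<^esub> y = y \<oplus>\<^bsub>M'\<^esub> x" by (simp add: assms(2-) M.a_comm)
  qed (simp_all add: assms(2-) M.a_assoc)
qed

lemma ring_cong:
  assumes "ring R" "carrier R' = carrier R" "mult R' = mult R" "one R' = one R"
    "zero R' = zero R" "add R' = add R"
  shows "ring R'"
proof -
  interpret R: ring R by fact
  show ?thesis
  proof (rule ringI)
    show "abelian_group R'" using abelian_group_cong[OF R.abelian_group_axioms] assms(2-) by blast
    show "Group.monoid R'" by (rule monoidI) (simp_all add: assms(2-) R.m_assoc)
  qed (simp_all add: assms(2-) R.l_distr R.r_distr)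
qed

lemma left_module_cong:
  assumes "left_module R M" "carrier M' = carrier M" "zero M' = zero M" "add M' = add M"
    "smult M' = smult M"
  shows "left_module R M'"
proof -
  interpret M: left_module R M by fact
  show ?thesis
    using abelian_group_cong[OF M.M.abelian_group_axioms assms(2-4)]
    by (intro left_moduleI M.R.ring_axioms) (simp_all add: assms(2-) M.lsmult_l_distr M.lsmult_r_distr M.lsmult_assoc)
qed

lemma left_hom_cong:
  assumes "carrier M' = carrier M" "add M' = add M" "smult M' = smult M"
    "carrier N' = carrier N" "add N' = add N" "smult N' = smult N"
  shows "left_hom R M' N' = left_hom R M N"
  by (simp add: left_hom_def additive_maps_def assms)

lemma monoid_algebra_fields [simp]:
  "carrier (monoid_algebra k G) = carrier (free_module k (carrier G))"
  "zero (monoid_algebra k G) = zero (free_module k (carrier G))"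
  "add (monoid_algebra k G) = add (free_module k (carrier G))"
  "smult (monoid_algebra k G) = smult (free_module k (carrier G))"
  "one (monoid_algebra k G) = basis_vec k \<one>\<^bsub>G\<^esub>"
  by (simp_all add: monoid_algebra_def)

lemma (in ring) lin_ext_free_apply:
  assumes u: "u \<in> carrier (free_module R X)" and \<phi>: "\<phi> \<in> X \<rightarrow> carrier (free_module R Y)"
  shows "lin_ext R X (free_module R Y) \<phi> u z = (\<Oplus>x\<in>{x \<in> X. u x \<noteq> \<zero>}. u x \<otimes> \<phi> x z)"
proof -
  have "finite {x \<in> X. u x \<noteq> \<zero>}" using u by (simp add: free_module_carrier)
  moreover have "(\<lambda>x. u x \<odot>\<^bsub>free_module R Y\<^esub> \<phi> x) \<in> {x \<in> X. u x \<noteq> \<zero>} \<rightarrow> carrier (free_module R Y)"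
    using free_module_apply_closed[OF u] \<phi> free_module_smult_closed[of _ _ Y]
    by (intro funcsetI) (simp add: free_module_simps Pi_iff)
  ultimately show ?thesis
    unfolding lin_ext_def by (subst finsum_free_module_apply) (simp_all add: free_module_simps)
qed

section \<open>The convolution algebra of a monoid\<close>

locale cring_monoid = k: cring k + G: Group.monoid G
  for k :: "('k, 'e) ring_scheme" and G :: "('g, 'f) monoid_scheme" (structure)
begin

abbreviation "F \<equiv> free_module k (carrier G)"
abbreviation "S \<equiv> monoid_algebra k G"
abbreviation "e \<equiv> basis_vec k"

sublocale F: left_module k F by (rule k.free_left_module)

sublocale S: left_module k S by (rule left_module_cong[OF F.left_module_axioms]) simp_all

lemma translate_closed: "x \<in> carrier G \<Longrightarrow> (\<lambda>y. e (x \<otimes> y)) \<in> carrier G \<rightarrow> carrier F"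
  by auto

lemma convolution_closed:
  assumes "v \<in> carrier F"
  shows "(\<lambda>x. lin_ext k (carrier G) F (\<lambda>y. e (x \<otimes> y)) v) \<in> carrier G \<rightarrow> carrier F"
  by (intro funcsetI F.lin_ext_closed[OF assms] translate_closed)

text \<open>Reading the double sum as an iterated linear extension makes linearity in the left
  argument automatic and opens the way to checking the ring axioms on basis vectors.\<close>

lemma mult_eq_lin_ext:
  assumes u: "u \<in> carrier F" and v: "v \<in> carrier F"
  shows "u \<otimes>\<^bsub>S\<^esub> v = lin_ext k (carrier G) F (\<lambda>x. lin_ext k (carrier G) F (\<lambda>y. e (x \<otimes> y)) v) u"
proof
  fix z
  let ?U = "{x \<in> carrier G. u x \<noteq> \<zero>\<^bsub>k\<^esub>}" and ?V = "{y \<in> carrier G. v y \<noteq> \<zero>\<^bsub>k\<^esub>}"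
  note uc [simp] = k.free_module_apply_closed[OF u] and vc [simp] = k.free_module_apply_closed[OF v]
  have fin: "finite ?V" using v by (simp add: free_module_carrier)
  have inner: "u x \<otimes>\<^bsub>k\<^esub> lin_ext k (carrier G) F (\<lambda>y. e (x \<otimes> y)) v z =
      (\<Oplus>\<^bsub>k\<^esub>y\<in>?V. if x \<otimes> y = z then u x \<otimes>\<^bsub>k\<^esub> v y else \<zero>\<^bsub>k\<^esub>)" if x: "x \<in> carrier G" for x
  proof -
    have "u x \<otimes>\<^bsub>k\<^esub> (\<Oplus>\<^bsub>k\<^esub>y\<in>?V. v y \<otimes>\<^bsub>k\<^esub> e (x \<otimes> y) z) =
        (\<Oplus>\<^bsub>k\<^esub>y\<in>?V. u x \<otimes>\<^bsub>k\<^esub> (v y \<otimes>\<^bsub>k\<^esub> e (x \<otimes> y) z))"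
      by (intro k.finsum_rdistr fin) (auto simp: basis_vec_def)
    also have "\<dots> = (\<Oplus>\<^bsub>k\<^esub>y\<in>?V. if x \<otimes> y = z then u x \<otimes>\<^bsub>k\<^esub> v y else \<zero>\<^bsub>k\<^esub>)"
      by (intro k.finsum_cong') (auto simp: basis_vec_def)
    finally show ?thesis by (simp add: k.lin_ext_free_apply[OF v translate_closed[OF x]])
  qed
  show "(u \<otimes>\<^bsub>S\<^esub> v) z =
      lin_ext k (carrier G) F (\<lambda>x. lin_ext k (carrier G) F (\<lambda>y. e (x \<otimes> y)) v) u z"
    unfolding k.lin_ext_free_apply[OF u convolution_closed[OF v]] monoid_algebra_def
    by (simp, intro k.finsum_cong') (auto simp: inner intro!: k.finsum_closed)
qed

lemma mult_left_hom_l: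
  assumes v: "v \<in> carrier F" shows "(\<lambda>u. u \<otimes>\<^bsub>S\<^esub> v) \<in> left_hom k F F"
proof -
  note h = F.lin_ext_left_hom[OF convolution_closed[OF v]]
  show ?thesis
    using left_hom_closed[OF h] left_hom_add[OF h] left_hom_smult[OF h] v
    by (intro left_homI) (simp_all add: mult_eq_lin_ext)
qed

lemma mult_closed [simp]: "\<lbrakk>u \<in> carrier F; v \<in> carrier F\<rbrakk> \<Longrightarrow> u \<otimes>\<^bsub>S\<^esub> v \<in> carrier F"
  using left_hom_closed[OF mult_left_hom_l] by blast

lemma mult_basis_l:
  assumes "x \<in> carrier G" "v \<in> carrier F"
  shows "e x \<otimes>\<^bsub>S\<^esub> v = lin_ext k (carrier G) F (\<lambda>y. e (x \<otimes> y)) v"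
  using assms F.lin_ext_basis_vec[OF assms(1) convolution_closed[OF assms(2)]]
  by (simp add: mult_eq_lin_ext)

lemma mult_basis [simp]:
  assumes "x \<in> carrier G" "y \<in> carrier G" shows "e x \<otimes>\<^bsub>S\<^esub> e y = e (x \<otimes> y)"
  using assms F.lin_ext_basis_vec[OF assms(2) translate_closed[OF assms(1)]]
  by (simp add: mult_basis_l)

text \<open>Here the argument sits inside the inner extension, so linearity is proved by induction
  over \<open>u\<close>. Commutativity of k enters where a scalar passes the coefficient
  \<open>r\<close>.\<close>

lemma mult_left_hom_r:
  assumes u: "u \<in> carrier F" shows "(\<lambda>v. u \<otimes>\<^bsub>S\<^esub> v) \<in> left_hom k F F"
  using u
proof (induction rule: k.free_module_induct)
  case zero
  have "(\<lambda>x. \<zero>\<^bsub>k\<^esub>) \<otimes>\<^bsub>S\<^esub> v = \<zero>\<^bsub>F\<^esub>" if "v \<in> carrier F" for v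
    using additive_zero[OF left_hom_additive[OF mult_left_hom_l[OF that]] F.M.abelian_group_axioms
        F.M.abelian_group_axioms] by (simp add: free_module_simps)
  then show ?case by (intro left_homI) simp_all
next
  case (add r x u)
  have ex: "r \<odot>\<^bsub>F\<^esub> e x \<in> carrier F" using add by (intro F.lsmult_closed) auto
  have "(r \<odot>\<^bsub>F\<^esub> e x \<oplus>\<^bsub>F\<^esub> u) \<otimes>\<^bsub>S\<^esub> v =
      r \<odot>\<^bsub>F\<^esub> lin_ext k (carrier G) F (\<lambda>y. e (x \<otimes> y)) v \<oplus>\<^bsub>F\<^esub> u \<otimes>\<^bsub>S\<^esub> v" if v: "v \<in> carrier F" for v
    using left_hom_add[OF mult_left_hom_l[OF v] ex add(3)]
      left_hom_smult[OF mult_left_hom_l[OF v] add(1), of "e x"] add(2) v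
    by (simp add: mult_basis_l)
  moreover note h = F.lin_ext_left_hom[OF translate_closed[OF add(2)]]
  ultimately show ?case
    using left_hom_closed[OF h] left_hom_add[OF h] left_hom_smult[OF h]
      left_hom_closed[OF add(4)] left_hom_add[OF add(4)] left_hom_smult[OF add(4)] add(1)
    by (intro left_homI) (simp_all add: F.lsmult_r_distr F.M.a_ac F.lsmult_assoc[symmetric] k.m_comm[of r])
qed

lemma mult_add_l: "\<lbrakk>u \<in> carrier F; v \<in> carrier F; w \<in> carrier F\<rbrakk> \<Longrightarrow>
    (u \<oplus>\<^bsub>F\<^esub> v) \<otimes>\<^bsub>S\<^esub> w = u \<otimes>\<^bsub>S\<^esub> w \<oplus>\<^bsub>F\<^esub> v \<otimes>\<^bsub>S\<^esub> w"
  using left_hom_add[OF mult_left_hom_l] by blast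

lemma mult_add_r: "\<lbrakk>u \<in> carrier F; v \<in> carrier F; w \<in> carrier F\<rbrakk> \<Longrightarrow>
    w \<otimes>\<^bsub>S\<^esub> (u \<oplus>\<^bsub>F\<^esub> v) = w \<otimes>\<^bsub>S\<^esub> u \<oplus>\<^bsub>F\<^esub> w \<otimes>\<^bsub>S\<^esub> v"
  using left_hom_add[OF mult_left_hom_r] by blast

lemma mult_smult_l: "\<lbrakk>r \<in> carrier k; u \<in> carrier F; w \<in> carrier F\<rbrakk> \<Longrightarrow>
    (r \<odot>\<^bsub>F\<^esub> u) \<otimes>\<^bsub>S\<^esub> w = r \<odot>\<^bsub>F\<^esub> (u \<otimes>\<^bsub>S\<^esub> w)"
  using left_hom_smult[OF mult_left_hom_l] by blast

lemma mult_smult_r: "\<lbrakk>r \<in> carrier k; u \<in> carrier F; w \<in> carrier F\<rbrakk> \<Longrightarrow>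
    w \<otimes>\<^bsub>S\<^esub> (r \<odot>\<^bsub>F\<^esub> u) = r \<odot>\<^bsub>F\<^esub> (w \<otimes>\<^bsub>S\<^esub> u)"
  using left_hom_smult[OF mult_left_hom_r] by blast

lemma mult_assoc:
  assumes u: "u \<in> carrier F" and v: "v \<in> carrier F" and w: "w \<in> carrier F"
  shows "(u \<otimes>\<^bsub>S\<^esub> v) \<otimes>\<^bsub>S\<^esub> w = u \<otimes>\<^bsub>S\<^esub> (v \<otimes>\<^bsub>S\<^esub> w)"
proof (rule k.free_module_hom_eqI[OF u F.left_module_axioms])
  show "(\<lambda>u. (u \<otimes>\<^bsub>S\<^esub> v) \<otimes>\<^bsub>S\<^esub> w) \<in> left_hom k F F"
    by (rule left_hom_compose[OF mult_left_hom_l[OF v] mult_left_hom_l[OF w]])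
  show "(\<lambda>u. u \<otimes>\<^bsub>S\<^esub> (v \<otimes>\<^bsub>S\<^esub> w)) \<in> left_hom k F F"
    using v w by (intro mult_left_hom_l) simp
  fix x assume x: "x \<in> carrier G"
  show "(e x \<otimes>\<^bsub>S\<^esub> v) \<otimes>\<^bsub>S\<^esub> w = e x \<otimes>\<^bsub>S\<^esub> (v \<otimes>\<^bsub>S\<^esub> w)"
  proof (rule k.free_module_hom_eqI[OF v F.left_module_axioms])
    show "(\<lambda>v. (e x \<otimes>\<^bsub>S\<^esub> v) \<otimes>\<^bsub>S\<^esub> w) \<in> left_hom k F F"
      using x by (intro left_hom_compose[OF mult_left_hom_r mult_left_hom_l] w) simp
    show "(\<lambda>v. e x \<otimes>\<^bsub>S\<^esub> (v \<otimes>\<^bsub>S\<^esub> w)) \<in> left_hom k F F"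
      using x by (intro left_hom_compose[OF mult_left_hom_l mult_left_hom_r] w) simp
    fix y assume y: "y \<in> carrier G"
    show "(e x \<otimes>\<^bsub>S\<^esub> e y) \<otimes>\<^bsub>S\<^esub> w = e x \<otimes>\<^bsub>S\<^esub> (e y \<otimes>\<^bsub>S\<^esub> w)"
    proof (rule k.free_module_hom_eqI[OF w F.left_module_axioms])
      show "(\<lambda>w. (e x \<otimes>\<^bsub>S\<^esub> e y) \<otimes>\<^bsub>S\<^esub> w) \<in> left_hom k F F"
        using x y by (intro mult_left_hom_r) simp
      show "(\<lambda>w. e x \<otimes>\<^bsub>S\<^esub> (e y \<otimes>\<^bsub>S\<^esub> w)) \<in> left_hom k F F"
        using x y by (intro left_hom_compose[OF mult_left_hom_r mult_left_hom_r]) simp_all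
    qed (use x y in \<open>simp add: G.m_assoc\<close>)
  qed
qed

lemma id_left_hom: "(\<lambda>u. u) \<in> left_hom k F F"
  by (intro left_homI) simp_all

lemma mult_one:
  assumes u: "u \<in> carrier F"
  shows "e \<one> \<otimes>\<^bsub>S\<^esub> u = u" "u \<otimes>\<^bsub>S\<^esub> e \<one> = u"
proof -
  show "e \<one> \<otimes>\<^bsub>S\<^esub> u = u"
    by (rule k.free_module_hom_eqI[OF u F.left_module_axioms mult_left_hom_r id_left_hom]) simp_all
  show "u \<otimes>\<^bsub>S\<^esub> e \<one> = u"
    by (rule k.free_module_hom_eqI[OF u F.left_module_axioms mult_left_hom_l id_left_hom]) simp_all
qed

lemma S_ring: "ring S"
proof (rule ringI[OF S.M.abelian_group_axioms])
  show "Group.monoid S" by (rule monoidI) (simp_all add: mult_assoc mult_one)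
qed (simp_all add: mult_add_l mult_add_r)

sublocale S: k_algebra k S
  by (intro k_algebra.intro S_ring S.module k.cring_axioms k_algebra_axioms.intro)
    (simp_all add: mult_smult_l mult_smult_r)

end

section \<open>Opposite algebras\<close>

lemma opposite_fields [simp]:
  "carrier (opposite A) = carrier A" "zero (opposite A) = zero A" "add (opposite A) = add A"
  "smult (opposite A) = smult A" "one (opposite A) = one A" "mult (opposite A) = (\<lambda>a b. b \<otimes>\<^bsub>A\<^esub> a)"
  by (simp_all add: opposite_def)

lemma (in k_algebra) left_module: "left_module k A"
  by (rule A.left_module)

lemma opposite_k_algebra:
  assumes "k_algebra k A" shows "k_algebra k (opposite A)"
proof -
  interpret A: k_algebra k A by fact
  interpret Om: left_module k "opposite A"
    by (rule left_module_cong[OF A.left_module]) simp_all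
  have "ring (opposite A)"
  proof (rule ringI[OF Om.M.abelian_group_axioms])
    show "Group.monoid (opposite A)" by (rule monoidI) (simp_all add: A.A.m_assoc)
  qed (simp_all add: A.A.l_distr A.A.r_distr)
  then show ?thesis
    by (intro k_algebra.intro Om.module A.A.R.cring_axioms k_algebra_axioms.intro)
      (simp_all add: A.smult_mult_l A.smult_mult_r)
qed

section \<open>The tensor product of two algebras\<close>

locale tensor_product = A: k_algebra k A + B: k_algebra k B
  for k :: "('k, 'e) ring_scheme" and A :: "('k, 'a) module" and B :: "('k, 'b) module"
begin

sublocale cring_monoid k "A \<times>\<times> B"
  by (intro cring_monoid.intro A.A.R.cring_axioms DirProd_monoid A.A.monoid_axioms B.A.monoid_axioms)

declare carrier_DirProd [simp del]

lemma mem_DirProd [simp]: "(b, c) \<in> carrier (A \<times>\<times> B) \<longleftrightarrow> b \<in> carrier A \<and> c \<in> carrier B"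
  by (simp add: carrier_DirProd)

definition "I = Idl\<^bsub>S\<^esub> (bilinear_relations k A B)"
abbreviation "T \<equiv> tensor_algebra k A B"
definition "proj u = I +>\<^bsub>S\<^esub> u"
definition "t b c = proj (e (b, c))"

lemma e_closed [simp]: "\<lbrakk>b \<in> carrier A; c \<in> carrier B\<rbrakk> \<Longrightarrow> e (b, c) \<in> carrier F"
  by simp

lemma S_minus: "u \<ominus>\<^bsub>S\<^esub> v = u \<ominus>\<^bsub>F\<^esub> v"
  by (simp add: a_minus_def a_inv_def m_inv_def)

lemma F_diff: "\<lbrakk>u \<in> carrier F; v \<in> carrier F\<rbrakk> \<Longrightarrow> u \<ominus>\<^bsub>F\<^esub> v \<in> carrier F"
  by (rule F.M.minus_closed)

lemma relations_closed: "bilinear_relations k A B \<subseteq> carrier S"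
  by (auto simp: bilinear_relations_def Let_def S_minus intro!: F_diff F.M.a_closed F.lsmult_closed)

sublocale I: ideal I S
  unfolding I_def by (rule S.A.genideal_ideal[OF relations_closed])

lemma relations_mem: "u \<in> bilinear_relations k A B \<Longrightarrow> u \<in> I"
  unfolding I_def using S.A.genideal_self[OF relations_closed] by blast

lemma tensor_fields:
  "carrier T = carrier (S Quot I)" "mult T = mult (S Quot I)" "one T = one (S Quot I)"
  "zero T = zero (S Quot I)" "add T = add (S Quot I)" "smult T = coset_smult S I"
  by (simp_all add: tensor_algebra_def Let_def I_def ring.defs module.defs)

sublocale T: ring T
  by (rule ring_cong[OF I.quotient_is_ring]) (simp_all add: tensor_fields)

lemma carrier_T: "carrier T = proj ` carrier F"
  by (auto simp: tensor_fields FactRing_def A_RCOSETS_def RCOSETS_def proj_def a_r_coset_def)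

lemma proj_closed [simp]: "u \<in> carrier F \<Longrightarrow> proj u \<in> carrier T"
  by (simp add: carrier_T)

lemma proj_add: "\<lbrakk>u \<in> carrier F; v \<in> carrier F\<rbrakk> \<Longrightarrow> proj (u \<oplus>\<^bsub>F\<^esub> v) = proj u \<oplus>\<^bsub>T\<^esub> proj v"
  using I.a_rcos_sum[of u v] by (simp add: tensor_fields FactRing_def proj_def)

lemma proj_mult: "\<lbrakk>u \<in> carrier F; v \<in> carrier F\<rbrakk> \<Longrightarrow> proj (u \<otimes>\<^bsub>S\<^esub> v) = proj u \<otimes>\<^bsub>T\<^esub> proj v"
  using I.rcoset_mult_add[of u v] by (simp add: tensor_fields FactRing_def proj_def)

lemma proj_one: "proj (e (\<one>\<^bsub>A\<^esub>, \<one>\<^bsub>B\<^esub>)) = \<one>\<^bsub>T\<^esub>"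
  by (simp add: tensor_fields FactRing_def proj_def)

lemma proj_eqI:
  assumes "u \<in> carrier F" "v \<in> carrier F" "u \<ominus>\<^bsub>F\<^esub> v \<in> I"
  shows "proj u = proj v"
  using assms S.A.quotient_eq_iff_same_a_r_cos[OF I.is_ideal, of u v] by (simp add: proj_def S_minus)

lemma proj_zero: "proj \<zero>\<^bsub>F\<^esub> = \<zero>\<^bsub>T\<^esub>"
  using S.A.a_rcos_zero[OF I.is_ideal, of "\<zero>\<^bsub>S\<^esub>"] I.zero_closed
  by (simp add: tensor_fields FactRing_def proj_def)

text \<open>A scalar acts as multiplication by its multiple of the unit of \<open>S\<close>, and an
  ideal absorbs such products.\<close>

lemma smult_mem: "\<lbrakk>x \<in> carrier k; u \<in> I\<rbrakk> \<Longrightarrow> x \<odot>\<^bsub>F\<^esub> u \<in> I"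
proof -
  assume x: "x \<in> carrier k" and u: "u \<in> I"
  then have uF: "u \<in> carrier F" using I.Icarr by simp
  have "(x \<odot>\<^bsub>F\<^esub> e (\<one>\<^bsub>A\<^esub>, \<one>\<^bsub>B\<^esub>)) \<otimes>\<^bsub>S\<^esub> u \<in> I"
    using I.I_l_closed[OF u, of "x \<odot>\<^bsub>F\<^esub> e (\<one>\<^bsub>A\<^esub>, \<one>\<^bsub>B\<^esub>)"] F.lsmult_closed[OF x, of "e (\<one>\<^bsub>A\<^esub>, \<one>\<^bsub>B\<^esub>)"] by simp
  then show ?thesis
    using mult_smult_l[OF x, of "e (\<one>\<^bsub>A\<^esub>, \<one>\<^bsub>B\<^esub>)" u] mult_one(1)[OF uF] uF by simp
qed

text \<open>The action on a coset is a union over its representatives. It collapses to a single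
  coset because \<open>I\<close> is closed under scalars.\<close>

lemma proj_smult:
  assumes x: "x \<in> carrier k" and u: "u \<in> carrier F"
  shows "x \<odot>\<^bsub>T\<^esub> proj u = proj (x \<odot>\<^bsub>F\<^esub> u)"
proof -
  have "proj (x \<odot>\<^bsub>F\<^esub> v) = proj (x \<odot>\<^bsub>F\<^esub> u)" if "v \<in> proj u" for v
  proof -
    from that obtain h where h: "h \<in> I" "v = h \<oplus>\<^bsub>F\<^esub> u" by (auto simp: proj_def a_r_coset_def r_coset_def)
    have hF: "h \<in> carrier F" using I.Icarr[OF h(1)] by simp
    have xh: "x \<odot>\<^bsub>F\<^esub> h \<in> carrier F" "x \<odot>\<^bsub>F\<^esub> u \<in> carrier F" using F.lsmult_closed x hF u by auto
    have "x \<odot>\<^bsub>F\<^esub> v = x \<odot>\<^bsub>F\<^esub> h \<oplus>\<^bsub>F\<^esub> x \<odot>\<^bsub>F\<^esub> u" using x hF u h(2) by (simp add: F.lsmult_r_distr)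
    moreover have "proj (x \<odot>\<^bsub>F\<^esub> h) = \<zero>\<^bsub>T\<^esub>"
      using S.A.a_rcos_zero[OF I.is_ideal smult_mem[OF x h(1)]] xh
      by (simp add: tensor_fields FactRing_def proj_def)
    ultimately show ?thesis using xh by (simp add: proj_add)
  qed
  moreover have "u \<in> proj u" using I.a_rcos_self[of u] u by (simp add: proj_def)
  ultimately have "(\<Union>v\<in>proj u. proj (x \<odot>\<^bsub>F\<^esub> v)) = proj (x \<odot>\<^bsub>F\<^esub> u)" by blast
  then show ?thesis by (simp add: tensor_fields coset_smult_def proj_def)
qed

lemma t_closed [simp]: "\<lbrakk>b \<in> carrier A; c \<in> carrier B\<rbrakk> \<Longrightarrow> t b c \<in> carrier T"
  by (simp add: t_def)

lemma t_add_l: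
  assumes "b \<in> carrier A" "b' \<in> carrier A" "c \<in> carrier B"
  shows "t (b \<oplus>\<^bsub>A\<^esub> b') c = t b c \<oplus>\<^bsub>T\<^esub> t b' c"
proof -
  have "e (b \<oplus>\<^bsub>A\<^esub> b', c) \<ominus>\<^bsub>S\<^esub> (e (b, c) \<oplus>\<^bsub>S\<^esub> e (b', c)) \<in> bilinear_relations k A B"
    unfolding bilinear_relations_def Let_def using assms by blast
  then have "e (b \<oplus>\<^bsub>A\<^esub> b', c) \<ominus>\<^bsub>F\<^esub> (e (b, c) \<oplus>\<^bsub>F\<^esub> e (b', c)) \<in> I"
    using relations_mem by (simp add: S_minus)
  then have "proj (e (b \<oplus>\<^bsub>A\<^esub> b', c)) = proj (e (b, c) \<oplus>\<^bsub>F\<^esub> e (b', c))"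
    using assms by (intro proj_eqI) (auto intro!: F.M.a_closed)
  then show ?thesis using assms by (simp add: t_def proj_add)
qed

lemma t_add_r:
  assumes "b \<in> carrier A" "c \<in> carrier B" "c' \<in> carrier B"
  shows "t b (c \<oplus>\<^bsub>B\<^esub> c') = t b c \<oplus>\<^bsub>T\<^esub> t b c'"
proof -
  have "e (b, c \<oplus>\<^bsub>B\<^esub> c') \<ominus>\<^bsub>S\<^esub> (e (b, c) \<oplus>\<^bsub>S\<^esub> e (b, c')) \<in> bilinear_relations k A B"
    unfolding bilinear_relations_def Let_def using assms by blast
  then have "e (b, c \<oplus>\<^bsub>B\<^esub> c') \<ominus>\<^bsub>F\<^esub> (e (b, c) \<oplus>\<^bsub>F\<^esub> e (b, c')) \<in> I"
    using relations_mem by (simp add: S_minus)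
  then have "proj (e (b, c \<oplus>\<^bsub>B\<^esub> c')) = proj (e (b, c) \<oplus>\<^bsub>F\<^esub> e (b, c'))"
    using assms by (intro proj_eqI) (auto intro!: F.M.a_closed)
  then show ?thesis using assms by (simp add: t_def proj_add)
qed

lemma t_smult_l:
  assumes "x \<in> carrier k" "b \<in> carrier A" "c \<in> carrier B"
  shows "t (x \<odot>\<^bsub>A\<^esub> b) c = proj (x \<odot>\<^bsub>F\<^esub> e (b, c))"
proof -
  have "e (x \<odot>\<^bsub>A\<^esub> b, c) \<ominus>\<^bsub>S\<^esub> x \<odot>\<^bsub>S\<^esub> e (b, c) \<in> bilinear_relations k A B"
    unfolding bilinear_relations_def Let_def using assms by blast
  then have "e (x \<odot>\<^bsub>A\<^esub> b, c) \<ominus>\<^bsub>F\<^esub> x \<odot>\<^bsub>F\<^esub> e (b, c) \<in> I"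
    using relations_mem by (simp add: S_minus)
  then show ?thesis
    unfolding t_def using assms by (intro proj_eqI) (auto intro!: F.lsmult_closed)
qed

lemma t_smult_r:
  assumes "x \<in> carrier k" "b \<in> carrier A" "c \<in> carrier B"
  shows "t b (x \<odot>\<^bsub>B\<^esub> c) = proj (x \<odot>\<^bsub>F\<^esub> e (b, c))"
proof -
  have "e (b, x \<odot>\<^bsub>B\<^esub> c) \<ominus>\<^bsub>S\<^esub> x \<odot>\<^bsub>S\<^esub> e (b, c) \<in> bilinear_relations k A B"
    unfolding bilinear_relations_def Let_def using assms by blast
  then have "e (b, x \<odot>\<^bsub>B\<^esub> c) \<ominus>\<^bsub>F\<^esub> x \<odot>\<^bsub>F\<^esub> e (b, c) \<in> I"
    using relations_mem by (simp add: S_minus)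
  then show ?thesis
    unfolding t_def using assms by (intro proj_eqI) (auto intro!: F.lsmult_closed)
qed

lemma t_mult:
  assumes "b \<in> carrier A" "b' \<in> carrier A" "c \<in> carrier B" "c' \<in> carrier B"
  shows "t b c \<otimes>\<^bsub>T\<^esub> t b' c' = t (b \<otimes>\<^bsub>A\<^esub> b') (c \<otimes>\<^bsub>B\<^esub> c')"
  using assms proj_mult[of "e (b, c)" "e (b', c')"] by (simp add: t_def)

text \<open>Coefficients are absorbed into the left factor, so plain sums of pure tensors already
  exhaust the algebra.\<close>

lemma t_generate:
  assumes r: "r \<in> carrier T" and "P \<zero>\<^bsub>T\<^esub>"
    and step: "\<And>b c r. \<lbrakk>b \<in> carrier A; c \<in> carrier B; r \<in> carrier T; P r\<rbrakk> \<Longrightarrow> P (t b c \<oplus>\<^bsub>T\<^esub> r)"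
  shows "P r"
proof -
  obtain u where u: "u \<in> carrier F" "r = proj u" using r by (auto simp: carrier_T)
  from u(1) have "P (proj u)"
  proof (induction rule: A.A.R.free_module_induct)
    case zero
    show ?case using assms(2) proj_zero by (simp add: free_module_simps)
  next
    case (add x y u)
    then obtain b c where y: "y = (b, c)" "b \<in> carrier A" "c \<in> carrier B"
      by (auto simp: carrier_DirProd)
    have "x \<odot>\<^bsub>F\<^esub> e y \<in> carrier F" using add by (intro F.lsmult_closed) auto
    then have "proj (x \<odot>\<^bsub>F\<^esub> e y \<oplus>\<^bsub>F\<^esub> u) = t (x \<odot>\<^bsub>A\<^esub> b) c \<oplus>\<^bsub>T\<^esub> proj u"
      using add y by (simp add: proj_add t_smult_l)
    then show ?case using step[of "x \<odot>\<^bsub>A\<^esub> b" c "proj u"] add y by (simp)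
  qed
  then show ?thesis using u by simp
qed

section \<open>The universal property of the tensor product\<close>

context
  fixes C :: "('k, 'c) module"
  assumes C: "left_module k C"
begin

interpretation C: left_module k C by (rule C)

abbreviation "ext f \<equiv> lin_ext k (carrier A \<times> carrier B) C (\<lambda>(b, c). f b c)"

lemma bilinear_funcset:
  "f \<in> bilinear_maps k A B C \<Longrightarrow> (\<lambda>(b, c). f b c) \<in> carrier A \<times> carrier B \<rightarrow> carrier C"
  by (auto simp: bilinear_maps_def left_hom_def additive_maps_def)

lemma ext_left_hom: "f \<in> bilinear_maps k A B C \<Longrightarrow> ext f \<in> left_hom k F C"
  using C.lin_ext_left_hom[OF bilinear_funcset] by (simp add: carrier_DirProd)

lemma ext_basis:
  "\<lbrakk>f \<in> bilinear_maps k A B C; b \<in> carrier A; c \<in> carrier B\<rbrakk> \<Longrightarrow> ext f (e (b, c)) = f b c"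
  using C.lin_ext_basis_vec[OF _ bilinear_funcset, of "(b, c)" f] by simp

lemma ext_left_hom_S: "f \<in> bilinear_maps k A B C \<Longrightarrow> ext f \<in> left_hom k S C"
  using ext_left_hom left_hom_cong[of S F C C k] by simp

lemma bilinear_translate_l:
  assumes f: "f \<in> bilinear_maps k A B C" and a: "a \<in> carrier A" "a' \<in> carrier B"
  shows "(\<lambda>b c. f (a \<otimes>\<^bsub>A\<^esub> b) (a' \<otimes>\<^bsub>B\<^esub> c)) \<in> bilinear_maps k A B C"
proof -
  have 1: "f b \<in> left_hom k B C" if "b \<in> carrier A" for b using f that by (simp add: bilinear_maps_def)
  have 2: "(\<lambda>a. f a b) \<in> left_hom k A C" if "b \<in> carrier B" for b using f that by (simp add: bilinear_maps_def)
  show ?thesis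
    using a by (auto simp: bilinear_maps_def left_hom_closed[OF 1] left_hom_add[OF 1] left_hom_add[OF 2]
        left_hom_smult[OF 1] left_hom_smult[OF 2] A.A.r_distr B.A.r_distr A.smult_mult_r B.smult_mult_r
        intro!: left_homI)
qed

lemma bilinear_translate_r:
  assumes f: "f \<in> bilinear_maps k A B C" and a: "a \<in> carrier A" "a' \<in> carrier B"
  shows "(\<lambda>b c. f (b \<otimes>\<^bsub>A\<^esub> a) (c \<otimes>\<^bsub>B\<^esub> a')) \<in> bilinear_maps k A B C"
proof -
  have 1: "f b \<in> left_hom k B C" if "b \<in> carrier A" for b using f that by (simp add: bilinear_maps_def)
  have 2: "(\<lambda>a. f a b) \<in> left_hom k A C" if "b \<in> carrier B" for b using f that by (simp add: bilinear_maps_def)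
  show ?thesis
    using a by (auto simp: bilinear_maps_def left_hom_closed[OF 1] left_hom_add[OF 1] left_hom_add[OF 2]
        left_hom_smult[OF 1] left_hom_smult[OF 2] A.A.l_distr B.A.l_distr A.smult_mult_l B.smult_mult_l
        intro!: left_homI)
qed

text \<open>The relations are divided out as an ideal, whereas the kernel of a single
  \<open>ext f\<close> is only known to be a submodule. Intersecting over all bilinear
  \<open>f\<close> repairs this, since translates of bilinear maps are bilinear.\<close>

definition "annihilator = {u \<in> carrier F. \<forall>f\<in>bilinear_maps k A B C. ext f u = \<zero>\<^bsub>C\<^esub>}"

lemma zero_left_hom: "(\<lambda>u. \<zero>\<^bsub>C\<^esub>) \<in> left_hom k F C"
  by (intro left_homI) simp_all

text \<open>For a basis vector \<open>e x\<close>, applying \<open>ext f\<close> to a product with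
  \<open>e x\<close> amounts to applying \<open>ext\<close> of a translate of \<open>f\<close> to
  the other factor, which gives zero on the annihilator; the general factor follows by
  linearity.\<close>

lemma annihilator_ideal: "ideal annihilator S"
proof (rule idealI[OF S.A.ring_axioms])
  show "subgroup annihilator (add_monoid S)"
  proof (rule S.M.add.subgroupI)
    show "annihilator \<noteq> {}"
      using additive_zero[OF left_hom_additive[OF ext_left_hom] F.M.abelian_group_axioms
          C.M.abelian_group_axioms] F.M.zero_closed
      by (auto simp: annihilator_def intro!: exI[of _ "\<zero>\<^bsub>F\<^esub>"])
    fix u assume u: "u \<in> annihilator"
    then have uF: "u \<in> carrier F" by (simp add: annihilator_def)
    have "\<ominus>\<^bsub>S\<^esub> u \<in> carrier F" using S.M.a_inv_closed[of u] uF by simp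
    moreover have "ext f (\<ominus>\<^bsub>S\<^esub> u) = \<zero>\<^bsub>C\<^esub>" if f: "f \<in> bilinear_maps k A B C" for f
      using additive_neg[OF left_hom_additive[OF ext_left_hom_S[OF f]] S.M.abelian_group_axioms
          C.M.abelian_group_axioms, of u] uF u f C.M.minus_equality[of "\<zero>\<^bsub>C\<^esub>" "\<zero>\<^bsub>C\<^esub>"]
      by (simp add: annihilator_def)
    ultimately show "\<ominus>\<^bsub>S\<^esub> u \<in> annihilator" by (simp add: annihilator_def)
  next
    fix u v assume "u \<in> annihilator" "v \<in> annihilator"
    then show "u \<oplus>\<^bsub>S\<^esub> v \<in> annihilator"
      by (simp add: annihilator_def left_hom_add[OF ext_left_hom])
  qed (auto simp: annihilator_def)
next
  fix u s assume u: "u \<in> annihilator" and s: "s \<in> carrier S"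
  then have uF: "u \<in> carrier F" and sF: "s \<in> carrier F" by (simp_all add: annihilator_def)
  have "ext f (s \<otimes>\<^bsub>S\<^esub> u) = \<zero>\<^bsub>C\<^esub>" if f: "f \<in> bilinear_maps k A B C" for f
  proof (rule A.A.R.free_module_hom_eqI[OF sF C.left_module_axioms
        left_hom_compose[OF mult_left_hom_l[OF uF] ext_left_hom[OF f]] zero_left_hom])
    fix x assume "x \<in> carrier (A \<times>\<times> B)"
    then obtain a a' where x: "x = (a, a')" "a \<in> carrier A" "a' \<in> carrier B" by (auto simp: carrier_DirProd)
    let ?f = "\<lambda>b c. f (a \<otimes>\<^bsub>A\<^esub> b) (a' \<otimes>\<^bsub>B\<^esub> c)"
    note f' = bilinear_translate_l[OF f x(2,3)]
    have "ext f (e x \<otimes>\<^bsub>S\<^esub> u) = ext ?f u"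
    proof (rule A.A.R.free_module_hom_eqI[OF uF C.left_module_axioms
          left_hom_compose[OF mult_left_hom_r ext_left_hom[OF f]] ext_left_hom[OF f']])
      fix y assume "y \<in> carrier (A \<times>\<times> B)"
      then show "ext f (e x \<otimes>\<^bsub>S\<^esub> e y) = ext ?f (e y)"
        using x by (auto simp: carrier_DirProd[of A B] ext_basis[OF f] ext_basis[OF f'])
    qed (use x in simp)
    then show "ext f (e x \<otimes>\<^bsub>S\<^esub> u) = \<zero>\<^bsub>C\<^esub>" using u f' by (simp add: annihilator_def)
  qed
  with uF sF show "s \<otimes>\<^bsub>S\<^esub> u \<in> annihilator" by (simp add: annihilator_def)
  have "ext f (u \<otimes>\<^bsub>S\<^esub> s) = \<zero>\<^bsub>C\<^esub>" if f: "f \<in> bilinear_maps k A B C" for f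
  proof (rule A.A.R.free_module_hom_eqI[OF sF C.left_module_axioms
        left_hom_compose[OF mult_left_hom_r[OF uF] ext_left_hom[OF f]] zero_left_hom])
    fix x assume "x \<in> carrier (A \<times>\<times> B)"
    then obtain a a' where x: "x = (a, a')" "a \<in> carrier A" "a' \<in> carrier B" by (auto simp: carrier_DirProd)
    let ?f = "\<lambda>b c. f (b \<otimes>\<^bsub>A\<^esub> a) (c \<otimes>\<^bsub>B\<^esub> a')"
    note f' = bilinear_translate_r[OF f x(2,3)]
    have "ext f (u \<otimes>\<^bsub>S\<^esub> e x) = ext ?f u"
    proof (rule A.A.R.free_module_hom_eqI[OF uF C.left_module_axioms
          left_hom_compose[OF mult_left_hom_l ext_left_hom[OF f]] ext_left_hom[OF f']])
      fix y assume "y \<in> carrier (A \<times>\<times> B)"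
      then show "ext f (e y \<otimes>\<^bsub>S\<^esub> e x) = ext ?f (e y)"
        using x by (auto simp: carrier_DirProd[of A B] ext_basis[OF f] ext_basis[OF f'])
    qed (use x in simp)
    then show "ext f (u \<otimes>\<^bsub>S\<^esub> e x) = \<zero>\<^bsub>C\<^esub>" using u f' by (simp add: annihilator_def)
  qed
  with uF sF show "u \<otimes>\<^bsub>S\<^esub> s \<in> annihilator" by (simp add: annihilator_def)
qed

lemma relations_annihilated: "bilinear_relations k A B \<subseteq> annihilator"
proof
  fix u assume u: "u \<in> bilinear_relations k A B"
  have "ext f u = \<zero>\<^bsub>C\<^esub>" if f: "f \<in> bilinear_maps k A B C" for f
  proof -
    have 1: "f b \<in> left_hom k B C" if "b \<in> carrier A" for b using f that by (simp add: bilinear_maps_def)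
    have 2: "(\<lambda>a. f a b) \<in> left_hom k A C" if "b \<in> carrier B" for b using f that by (simp add: bilinear_maps_def)
    have diff: "ext f (v \<ominus>\<^bsub>S\<^esub> w) = \<zero>\<^bsub>C\<^esub>"
      if "v \<in> carrier F" "w \<in> carrier F" "ext f v = ext f w" for v w
      using additive_minus[OF left_hom_additive[OF ext_left_hom[OF f]] F.M.abelian_group_axioms
          C.M.abelian_group_axioms, of v w] that left_hom_closed[OF ext_left_hom[OF f], of w]
      by (simp add: S_minus)
    show ?thesis
      using u unfolding bilinear_relations_def Let_def
      by (auto intro!: diff F.M.a_closed F.lsmult_closed
          simp: ext_basis[OF f] left_hom_add[OF ext_left_hom[OF f]] left_hom_smult[OF ext_left_hom[OF f]]
            left_hom_add[OF 1] left_hom_add[OF 2] left_hom_smult[OF 1] left_hom_smult[OF 2])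
  qed
  then show "u \<in> annihilator"
    using u relations_closed by (auto simp: annihilator_def)
qed

text \<open>The shape of the scalar action of \<open>regular_bimodule\<close>, so that
  \<open>act_eq\<close> identifies that action with the descent of a bilinear map.\<close>

definition "descend f X = the_elem (ext f ` X)"

lemma descend_proj:
  assumes f: "f \<in> bilinear_maps k A B C" and u: "u \<in> carrier F"
  shows "descend f (proj u) = ext f u"
proof -
  have "ext f v = ext f u" if "v \<in> proj u" for v
  proof -
    from that obtain h where h: "h \<in> I" "v = h \<oplus>\<^bsub>F\<^esub> u" by (auto simp: proj_def a_r_coset_def r_coset_def)
    have "I \<subseteq> annihilator"
      unfolding I_def by (rule S.A.genideal_minimal[OF annihilator_ideal relations_annihilated])
    then have "h \<in> annihilator" using h by blast
    then show ?thesis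
      using u f h left_hom_closed[OF ext_left_hom[OF f] u]
      by (simp add: annihilator_def left_hom_add[OF ext_left_hom[OF f]])
  qed
  moreover have "u \<in> proj u" using I.a_rcos_self[of u] u by (simp add: proj_def)
  ultimately have "ext f ` proj u = {ext f u}" by blast
  then show ?thesis by (simp add: descend_def)
qed

lemma descend_additive: "f \<in> bilinear_maps k A B C \<Longrightarrow> descend f \<in> additive_maps T C"
  by (rule additive_mapsI)
    (auto simp: carrier_T descend_proj left_hom_closed[OF ext_left_hom] left_hom_add[OF ext_left_hom]
      proj_add[symmetric])

lemma descend_t:
  "\<lbrakk>f \<in> bilinear_maps k A B C; b \<in> carrier A; c \<in> carrier B\<rbrakk> \<Longrightarrow> descend f (t b c) = f b c"
  by (simp add: t_def descend_proj ext_basis)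

end

end

section \<open>The first Hochschild cohomology of an algebra\<close>

lemma (in bimodule_env) act_add: "\<lbrakk>r \<in> carrier R; x \<in> carrier A; y \<in> carrier A\<rbrakk> \<Longrightarrow>
    r \<odot>\<^bsub>N\<^esub> (x \<oplus> y) = r \<odot>\<^bsub>N\<^esub> x \<oplus> r \<odot>\<^bsub>N\<^esub> y"
  using M.lsmult_r_distr[of r x y] by simp

text \<open>The two actions commute, which keeps scalar multiples of a cocycle R-linear.\<close>

lemma (in bimodule_env) act_smult:
  assumes r: "r \<in> carrier R" and "z \<in> carrier k" "x \<in> carrier A"
  shows "r \<odot>\<^bsub>N\<^esub> (z \<odot> x) = z \<odot> (r \<odot>\<^bsub>N\<^esub> x)"
  using r
proof (rule t_generate)
  show "\<zero>\<^bsub>R\<^esub> \<odot>\<^bsub>N\<^esub> (z \<odot> x) = z \<odot> (\<zero>\<^bsub>R\<^esub> \<odot>\<^bsub>N\<^esub> x)" using assms by simp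
qed (use assms in \<open>simp add: M.lsmult_l_distr t_act A.smult_mult_l A.smult_mult_r A.A.smult_r_distr\<close>)

lemma (in bimodule_env) scalar_act:
  "\<lbrakk>z \<in> carrier k; x \<in> carrier A\<rbrakk> \<Longrightarrow> (z \<odot>\<^bsub>R\<^esub> \<one>\<^bsub>R\<^esub>) \<odot>\<^bsub>N\<^esub> x = z \<odot> x"
  by (simp add: smult_one_R t_act A.smult_mult_l)

section \<open>The module of cocycles and the dimension of Ext in degree one\<close>

context bimodule_env
begin

abbreviation "Z1 \<equiv> (cochains R N N (Suc 0))\<lparr>carrier := cocycles R N N (Suc 0)\<rparr>"

lemma Z1_fields [simp]:
  "carrier Z1 = cocycles R N N (Suc 0)"
  "zero Z1 = (\<lambda>x\<in>carrier P1. \<zero>)"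
  "add Z1 = (\<lambda>\<phi> \<psi>. \<lambda>x\<in>carrier P1. \<phi> x \<oplus> \<psi> x)"
  "smult Z1 = (\<lambda>z \<phi>. \<lambda>x\<in>carrier P1. (z \<odot>\<^bsub>R\<^esub> \<one>\<^bsub>R\<^esub>) \<odot>\<^bsub>N\<^esub> \<phi> x)"
  by (simp_all add: cochains_def hom_module_def std_resolution_def)

sublocale P1: left_module R P1 by (rule M.R.free_left_module)

lemma K1_P1: "z \<in> K1 \<Longrightarrow> z \<in> carrier P1"
  by (simp add: K1_mem)

lemma
  assumes "\<phi> \<in> cocycles R N N (Suc 0)"
  shows cocycle_closed: "u \<in> carrier P1 \<Longrightarrow> \<phi> u \<in> carrier A"
    and cocycle_add: "\<lbrakk>u \<in> carrier P1; v \<in> carrier P1\<rbrakk> \<Longrightarrow> \<phi> (u \<oplus>\<^bsub>P1\<^esub> v) = \<phi> u \<oplus> \<phi> v"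
    and cocycle_smult: "\<lbrakk>r \<in> carrier R; u \<in> carrier P1\<rbrakk> \<Longrightarrow> \<phi> (r \<odot>\<^bsub>P1\<^esub> u) = r \<odot>\<^bsub>N\<^esub> \<phi> u"
    and cocycle_K1: "z \<in> K1 \<Longrightarrow> \<phi> z = \<zero>"
    and cocycle_ext: "\<phi> \<in> extensional (carrier P1)"
proof -
  have \<phi>: "\<phi> \<in> left_hom R P1 N" and "\<phi> \<in> extensional (carrier P1)" "\<forall>z\<in>K1. \<phi> z = \<zero>"
    using assms by (auto simp: cocycle_iff)
  then show "z \<in> K1 \<Longrightarrow> \<phi> z = \<zero>" "\<phi> \<in> extensional (carrier P1)" by auto
  show "u \<in> carrier P1 \<Longrightarrow> \<phi> u \<in> carrier A" using left_hom_closed[OF \<phi>, of u] by simp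
  show "\<lbrakk>u \<in> carrier P1; v \<in> carrier P1\<rbrakk> \<Longrightarrow> \<phi> (u \<oplus>\<^bsub>P1\<^esub> v) = \<phi> u \<oplus> \<phi> v"
    using left_hom_add[OF \<phi>, of u v] by simp
  show "\<lbrakk>r \<in> carrier R; u \<in> carrier P1\<rbrakk> \<Longrightarrow> \<phi> (r \<odot>\<^bsub>P1\<^esub> u) = r \<odot>\<^bsub>N\<^esub> \<phi> u"
    using left_hom_smult[OF \<phi>, of r u] by simp
qed

lemma cocycle_restrictI:
  assumes "\<And>u. u \<in> carrier P1 \<Longrightarrow> \<phi> u \<in> carrier A"
    and "\<And>u v. \<lbrakk>u \<in> carrier P1; v \<in> carrier P1\<rbrakk> \<Longrightarrow> \<phi> (u \<oplus>\<^bsub>P1\<^esub> v) = \<phi> u \<oplus> \<phi> v"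
    and "\<And>r u. \<lbrakk>r \<in> carrier R; u \<in> carrier P1\<rbrakk> \<Longrightarrow> \<phi> (r \<odot>\<^bsub>P1\<^esub> u) = r \<odot>\<^bsub>N\<^esub> \<phi> u"
    and "\<And>z. z \<in> K1 \<Longrightarrow> \<phi> z = \<zero>"
  shows "restrict \<phi> (carrier P1) \<in> cocycles R N N (Suc 0)"
proof -
  have "\<phi> \<in> left_hom R P1 N" using assms(1-3) by (intro left_homI) simp_all
  then show ?thesis
    unfolding cocycle_iff using restrict_left_hom[OF P1.M.abelian_group_axioms P1.lsmult_closed]
    by (auto simp: assms(4) K1_P1)
qed

lemma cocycle_eqI:
  assumes "\<phi> \<in> cocycles R N N (Suc 0)" "\<And>u. u \<in> carrier P1 \<Longrightarrow> \<phi> u = \<psi> u" "\<psi> \<in> extensional (carrier P1)"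
  shows "\<phi> = \<psi>"
  using cocycle_ext[OF assms(1)] assms(3,2) by (rule extensionalityI)

lemma Z1_abelian_group: "abelian_group Z1"
proof (rule abelian_groupI)
  fix \<phi> \<psi> assume a: "\<phi> \<in> carrier Z1" "\<psi> \<in> carrier Z1"
  then have "\<phi> \<in> cocycles R N N (Suc 0)" "\<psi> \<in> cocycles R N N (Suc 0)" by simp_all
  note f = cocycle_closed[OF this(1)] cocycle_add[OF this(1)] cocycle_smult[OF this(1)] cocycle_K1[OF this(1)]
    cocycle_closed[OF this(2)] cocycle_add[OF this(2)] cocycle_smult[OF this(2)] cocycle_K1[OF this(2)]
  show "\<phi> \<oplus>\<^bsub>Z1\<^esub> \<psi> \<in> carrier Z1"
    unfolding Z1_fields by (rule cocycle_restrictI) (simp_all add: f act_add A.A.a_ac)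
  show "\<phi> \<oplus>\<^bsub>Z1\<^esub> \<psi> = \<psi> \<oplus>\<^bsub>Z1\<^esub> \<phi>"
    unfolding Z1_fields by (rule restrict_ext) (simp add: f A.A.a_comm)
next
  fix \<phi> \<psi> \<chi> assume a: "\<phi> \<in> carrier Z1" "\<psi> \<in> carrier Z1" "\<chi> \<in> carrier Z1"
  then have "\<phi> \<in> cocycles R N N (Suc 0)" "\<psi> \<in> cocycles R N N (Suc 0)" "\<chi> \<in> cocycles R N N (Suc 0)"
    by simp_all
  note f = cocycle_closed[OF this(1)] cocycle_closed[OF this(2)] cocycle_closed[OF this(3)]
  show "\<phi> \<oplus>\<^bsub>Z1\<^esub> \<psi> \<oplus>\<^bsub>Z1\<^esub> \<chi> = \<phi> \<oplus>\<^bsub>Z1\<^esub> (\<psi> \<oplus>\<^bsub>Z1\<^esub> \<chi>)"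
    unfolding Z1_fields by (rule restrict_ext) (simp add: f A.A.a_assoc)
next
  show "\<zero>\<^bsub>Z1\<^esub> \<in> carrier Z1"
    unfolding Z1_fields using M.lsmult_r_null by (intro cocycle_restrictI) simp_all
next
  fix \<phi> assume a: "\<phi> \<in> carrier Z1"
  then have \<phi>: "\<phi> \<in> cocycles R N N (Suc 0)" by simp
  note f = cocycle_closed[OF \<phi>] cocycle_add[OF \<phi>] cocycle_smult[OF \<phi>] cocycle_K1[OF \<phi>]
  show "\<zero>\<^bsub>Z1\<^esub> \<oplus>\<^bsub>Z1\<^esub> \<phi> = \<phi>"
    unfolding Z1_fields by (rule cocycle_eqI[OF \<phi>, symmetric]) (simp_all add: f)
  have zero: "\<ominus> \<zero> = \<zero>" by simp
  have "restrict (\<lambda>u. \<ominus> \<phi> u) (carrier P1) \<in> cocycles R N N (Suc 0)"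
    using M.lsmult_r_minus by (intro cocycle_restrictI) (simp_all add: f A.A.minus_add zero)
  moreover have "restrict (\<lambda>u. \<ominus> \<phi> u) (carrier P1) \<oplus>\<^bsub>Z1\<^esub> \<phi> = \<zero>\<^bsub>Z1\<^esub>"
    unfolding Z1_fields by (rule restrict_ext) (simp add: f A.A.l_neg)
  ultimately show "\<exists>\<psi>\<in>carrier Z1. \<psi> \<oplus>\<^bsub>Z1\<^esub> \<phi> = \<zero>\<^bsub>Z1\<^esub>"
    by (intro bexI[of _ "restrict (\<lambda>u. \<ominus> \<phi> u) (carrier P1)"]) simp_all
qed

lemma Z1_smult_closed:
  assumes z: "z \<in> carrier k" and \<phi>: "\<phi> \<in> cocycles R N N (Suc 0)"
  shows "z \<odot>\<^bsub>Z1\<^esub> \<phi> \<in> cocycles R N N (Suc 0)"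
proof -
  note f = cocycle_closed[OF \<phi>] cocycle_add[OF \<phi>] cocycle_smult[OF \<phi>] cocycle_K1[OF \<phi>]
  have "restrict (\<lambda>x. z \<odot> \<phi> x) (carrier P1) \<in> cocycles R N N (Suc 0)"
    using z by (intro cocycle_restrictI) (simp_all add: f A.A.smult_r_distr act_smult)
  moreover have "z \<odot>\<^bsub>Z1\<^esub> \<phi> = restrict (\<lambda>x. z \<odot> \<phi> x) (carrier P1)"
    unfolding Z1_fields using z by (intro restrict_ext) (simp add: f scalar_act)
  ultimately show ?thesis by simp
qed

text \<open>The functionals sending \<open>D\<close> to \<open>lf i (D (a i))\<close> serve as
  coordinates on derivations modulo inner ones: \<open>kernel\<close> says that the inner
  derivations are their common zeros, \<open>surj\<close> that all value vectors occur. Evaluated on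
  the derivation of a cocycle, they give the linear map needed by
  \<open>quotient_module_dim\<close>.\<close>

theorem Ext1_dim:
  assumes k: "field k" and X: "finite X"
    and a: "\<And>i. i \<in> X \<Longrightarrow> a i \<in> carrier A"
    and lf_closed: "\<And>i x. \<lbrakk>i \<in> X; x \<in> carrier A\<rbrakk> \<Longrightarrow> lf i x \<in> carrier k"
    and lf_add: "\<And>i x y. \<lbrakk>i \<in> X; x \<in> carrier A; y \<in> carrier A\<rbrakk> \<Longrightarrow> lf i (x \<oplus> y) = lf i x \<oplus>\<^bsub>k\<^esub> lf i y"
    and lf_smult: "\<And>i z x. \<lbrakk>i \<in> X; z \<in> carrier k; x \<in> carrier A\<rbrakk> \<Longrightarrow> lf i (z \<odot> x) = z \<otimes>\<^bsub>k\<^esub> lf i x"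
    and kernel: "\<And>D. D \<in> derivations k A \<Longrightarrow> (\<forall>i\<in>X. lf i (D (a i)) = \<zero>\<^bsub>k\<^esub>) \<longleftrightarrow>
      (\<exists>m\<in>carrier A. \<forall>x\<in>carrier A. D x = x \<otimes> m \<ominus> m \<otimes> x)"
    and surj: "\<And>w. w \<in> carrier (free_module k X) \<Longrightarrow>
      \<exists>D\<in>derivations k A. \<forall>i\<in>X. lf i (D (a i)) = w i"
  shows "vectorspace k (Ext R 1 N N) \<and> vectorspace.fin_dim k (Ext R 1 N N) \<and>
    vectorspace.dim k (Ext R 1 N N) = card X"
proof -
  interpret k: field k by (rule k)
  define T where "T \<phi> = (\<lambda>i. if i \<in> X then lf i (cocycle_derivation \<phi> (a i)) else \<zero>\<^bsub>k\<^esub>)" for \<phi>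
  have dv: "K0.gen_vec (dvec x) \<in> carrier P1" if "x \<in> carrier A" for x
    using dvec_mem[OF that] by (intro M.R.basis_vec_closed imageI)
  have Tc: "T \<phi> \<in> carrier (free_module k X)" if \<phi>: "\<phi> \<in> cocycles R N N (Suc 0)" for \<phi>
    using X derivation_closed[OF cocycle_derivation[OF \<phi>]] a lf_closed
    by (auto simp: free_module_carrier T_def intro: finite_subset[of _ X] split: if_splits)
  have "T \<in> left_hom k Z1 (free_module k X)"
  proof (rule left_homI)
    fix \<phi> \<psi> assume "\<phi> \<in> carrier Z1" "\<psi> \<in> carrier Z1"
    then have h: "\<phi> \<in> cocycles R N N (Suc 0)" "\<psi> \<in> cocycles R N N (Suc 0)" by simp_all
    have "cocycle_derivation (\<phi> \<oplus>\<^bsub>Z1\<^esub> \<psi>) x = cocycle_derivation \<phi> x \<oplus> cocycle_derivation \<psi> x"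
      if "x \<in> carrier A" for x using dv[OF that] by (simp add: cocycle_derivation_def)
    then show "T (\<phi> \<oplus>\<^bsub>Z1\<^esub> \<psi>) = T \<phi> \<oplus>\<^bsub>free_module k X\<^esub> T \<psi>"
      using derivation_closed[OF cocycle_derivation[OF h(1)]] derivation_closed[OF cocycle_derivation[OF h(2)]] a
      by (auto simp: T_def free_module_simps fun_eq_iff lf_add)
  next
    fix z \<phi> assume z: "z \<in> carrier k" and "\<phi> \<in> carrier Z1"
    then have h: "\<phi> \<in> cocycles R N N (Suc 0)" by simp
    have "cocycle_derivation (z \<odot>\<^bsub>Z1\<^esub> \<phi>) x = z \<odot> cocycle_derivation \<phi> x"
      if "x \<in> carrier A" for x
      using dv[OF that] z cocycle_closed[OF h dv[OF that]] by (simp add: cocycle_derivation_def scalar_act)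
    then show "T (z \<odot>\<^bsub>Z1\<^esub> \<phi>) = z \<odot>\<^bsub>free_module k X\<^esub> T \<phi>"
      using derivation_closed[OF cocycle_derivation[OF h]] a z
      by (auto simp: T_def free_module_simps fun_eq_iff lf_smult)
  qed (use Tc in simp)
  moreover have "T ` carrier Z1 = carrier (free_module k X)"
  proof
    show "carrier (free_module k X) \<subseteq> T ` carrier Z1"
    proof
      fix w assume w: "w \<in> carrier (free_module k X)"
      from surj[OF w] obtain D where D: "D \<in> derivations k A" "\<forall>i\<in>X. lf i (D (a i)) = w i" by (elim bexE)
      from cocycle_of_derivation[OF D(1)] obtain \<phi> where \<phi>: "\<phi> \<in> cocycles R N N (Suc 0)"
        "\<forall>x\<in>carrier A. cocycle_derivation \<phi> x = D x" by (elim bexE)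
      have "T \<phi> = w"
        using \<phi>(2) D(2) a w by (simp add: T_def free_module_carrier fun_eq_iff)
      with \<phi>(1) show "w \<in> T ` carrier Z1" by (intro image_eqI[of _ _ \<phi>]) simp_all
    qed
  qed (use Tc in \<open>simp add: image_subset_iff\<close>)
  moreover have "coboundaries R N N (Suc 0) = {\<phi> \<in> carrier Z1. T \<phi> = \<zero>\<^bsub>free_module k X\<^esub>}"
  proof -
    have 1: "T \<phi> = \<zero>\<^bsub>free_module k X\<^esub> \<longleftrightarrow> \<phi> \<in> coboundaries R N N (Suc 0)"
      if \<phi>: "\<phi> \<in> cocycles R N N (Suc 0)" for \<phi>
      unfolding coboundary_iff_inner[OF \<phi>] kernel[OF cocycle_derivation[OF \<phi>], symmetric]
      by (auto simp: T_def free_module_simps fun_eq_iff)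
    \<comment> \<open>A coboundary is pulled back from the restriction to \<open>K0\<close> of a
      linear map on \<open>P0\<close>, so \<open>cocycleI\<close> applies to it.\<close>
    have 2: "\<phi> \<in> cocycles R N N (Suc 0)" if "\<phi> \<in> coboundaries R N N (Suc 0)" for \<phi>
    proof -
      from that obtain \<chi> where \<chi>: "\<chi> \<in> left_hom R P0 N"
        "\<phi> = restrict (\<lambda>u. \<chi> (syz_map R K0 u)) (carrier P1)" unfolding coboundary_iff by (elim bexE)
      have "\<chi> \<in> left_hom R K0.KM N"
        using left_hom_closed[OF \<chi>(1)] left_hom_add[OF \<chi>(1)] left_hom_smult[OF \<chi>(1)]
        by (intro left_homI) (simp_all add: K0_mem)
      then show ?thesis unfolding \<chi>(2) by (rule cocycleI)
    qed
    show ?thesis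
    proof (intro equalityI subsetI)
      fix \<phi> assume "\<phi> \<in> coboundaries R N N (Suc 0)"
      with 1[OF 2] 2 show "\<phi> \<in> {\<phi> \<in> carrier Z1. T \<phi> = \<zero>\<^bsub>free_module k X\<^esub>}" by simp
    next
      fix \<phi> assume "\<phi> \<in> {\<phi> \<in> carrier Z1. T \<phi> = \<zero>\<^bsub>free_module k X\<^esub>}"
      then have "\<phi> \<in> cocycles R N N (Suc 0)" "T \<phi> = \<zero>\<^bsub>free_module k X\<^esub>" by simp_all
      with 1 show "\<phi> \<in> coboundaries R N N (Suc 0)" by simp
    qed
  qed
  ultimately have "vectorspace k (quotient_module Z1 (coboundaries R N N (Suc 0))) \<and>
    vectorspace.fin_dim k (quotient_module Z1 (coboundaries R N N (Suc 0))) \<and>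
    vectorspace.dim k (quotient_module Z1 (coboundaries R N N (Suc 0))) = card X"
    using Z1_smult_closed by (intro quotient_module_dim[OF k Z1_abelian_group X]) simp_all
  then show ?thesis by (simp only: Ext_def One_nat_def)
qed

end

section \<open>The enveloping algebra acting on the algebra\<close>

locale k_algebra_module = k_algebra k A
  for k :: "('k, 'e) ring_scheme" and A :: "('k, 'a) module" (structure)
begin

interpretation opp: k_algebra k "opposite A"
  by (rule opposite_k_algebra) unfold_locales

interpretation E: tensor_product k A "opposite A" ..

abbreviation "N \<equiv> regular_bimodule k A"

lemma N_fields [simp]:
  "carrier N = carrier A" "zero N = zero A" "add N = add A"
  "smult N = (\<lambda>X a. the_elem
    ((\<lambda>u. lin_ext k (carrier A \<times> carrier A) A (\<lambda>(b, c). b \<otimes> a \<otimes> c) u) ` X))"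
  by (simp_all add: regular_bimodule_def ring.defs module.defs)

text \<open>The opposite algebra differs only in its product, which bilinearity does not
  see.\<close>

lemma bilinear_opposite: "bilinear_maps k A (opposite A) C = bilinear_maps k A A C"
  using left_hom_cong[of "opposite A" A C C k] by (simp add: bilinear_maps_def)

lemma sandwich_bilinear: "x \<in> carrier A \<Longrightarrow> (\<lambda>b c. b \<otimes> x \<otimes> c) \<in> bilinear_maps k A A A"
  by (auto simp: bilinear_maps_def A.l_distr A.r_distr smult_mult_l smult_mult_r intro!: left_homI)

lemma act_eq: "X \<odot>\<^bsub>N\<^esub> x = E.descend A (\<lambda>b c. b \<otimes> x \<otimes> c) X"
  unfolding E.descend_def[OF left_module] by simp

lemma act_additive: "x \<in> carrier A \<Longrightarrow> (\<lambda>X. X \<odot>\<^bsub>N\<^esub> x) \<in> additive_maps E.T A"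
  using E.descend_additive[OF left_module] sandwich_bilinear[of x]
  by (simp add: act_eq bilinear_opposite del: N_fields(4))

lemma act_t: "\<lbrakk>b \<in> carrier A; c \<in> carrier A; x \<in> carrier A\<rbrakk> \<Longrightarrow> E.t b c \<odot>\<^bsub>N\<^esub> x = b \<otimes> x \<otimes> c"
  using E.descend_t[OF left_module, of "\<lambda>b c. b \<otimes> x \<otimes> c" b c] sandwich_bilinear[of x]
  by (simp add: act_eq bilinear_opposite del: N_fields(4))

declare N_fields(4) [simp del]

lemmas act_closed [simp] = additive_closed[OF act_additive]
  and act_add_l = additive_add[OF act_additive]

lemma act_zero [simp]: "x \<in> carrier A \<Longrightarrow> \<zero>\<^bsub>E.T\<^esub> \<odot>\<^bsub>N\<^esub> x = \<zero>"
  using additive_zero[OF act_additive E.T.abelian_group_axioms A.abelian_group_axioms] by simp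

text \<open>The action is additive in the ring element, so the laws reduce to pure tensors, where
  they are distributivity and associativity in \<open>A\<close>.\<close>

lemma N_left_module: "left_module E.T N"
proof (rule left_moduleI)
  show "ring E.T" by unfold_locales
  show "abelian_group N"
    by (rule abelian_group_cong[OF A.abelian_group_axioms]) simp_all
  have add_r: "r \<odot>\<^bsub>N\<^esub> (x \<oplus> y) = r \<odot>\<^bsub>N\<^esub> x \<oplus> r \<odot>\<^bsub>N\<^esub> y"
    if "r \<in> carrier E.T" "x \<in> carrier A" "y \<in> carrier A" for r x y
    using that(1)
  proof (rule E.t_generate)
    show "\<zero>\<^bsub>E.T\<^esub> \<odot>\<^bsub>N\<^esub> (x \<oplus> y) = \<zero>\<^bsub>E.T\<^esub> \<odot>\<^bsub>N\<^esub> x \<oplus> \<zero>\<^bsub>E.T\<^esub> \<odot>\<^bsub>N\<^esub> y"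
      using that by simp
  qed (use that in \<open>simp add: act_add_l act_t A.l_distr A.r_distr A.a_ac\<close>)
  then show "a \<odot>\<^bsub>N\<^esub> (x \<oplus>\<^bsub>N\<^esub> y) = a \<odot>\<^bsub>N\<^esub> x \<oplus>\<^bsub>N\<^esub> a \<odot>\<^bsub>N\<^esub> y"
    if "a \<in> carrier E.T" "x \<in> carrier N" "y \<in> carrier N" for a x y using that by simp
  have zero_r: "r \<odot>\<^bsub>N\<^esub> \<zero> = \<zero>" if "r \<in> carrier E.T" for r
    using add_r[OF that, of \<zero> \<zero>] that A.add.r_cancel_one[of "r \<odot>\<^bsub>N\<^esub> \<zero>" "r \<odot>\<^bsub>N\<^esub> \<zero>"] by simp
  have t_assoc: "(E.t b c \<otimes>\<^bsub>E.T\<^esub> s) \<odot>\<^bsub>N\<^esub> x = b \<otimes> (s \<odot>\<^bsub>N\<^esub> x) \<otimes> c"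
    if b: "b \<in> carrier A" "c \<in> carrier A" "x \<in> carrier A" and s: "s \<in> carrier E.T" for b c s x
    using s
  proof (rule E.t_generate)
    show "(E.t b c \<otimes>\<^bsub>E.T\<^esub> \<zero>\<^bsub>E.T\<^esub>) \<odot>\<^bsub>N\<^esub> x = b \<otimes> (\<zero>\<^bsub>E.T\<^esub> \<odot>\<^bsub>N\<^esub> x) \<otimes> c"
      using b by simp
  qed (use b in \<open>simp add: E.T.r_distr act_add_l E.t_mult act_t A.l_distr A.r_distr A.m_assoc\<close>)
  show "(r \<otimes>\<^bsub>E.T\<^esub> s) \<odot>\<^bsub>N\<^esub> x = r \<odot>\<^bsub>N\<^esub> (s \<odot>\<^bsub>N\<^esub> x)"
    if r: "r \<in> carrier E.T" and s: "s \<in> carrier E.T" "x \<in> carrier N" for r s x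
    using r
  proof (rule E.t_generate)
    show "(\<zero>\<^bsub>E.T\<^esub> \<otimes>\<^bsub>E.T\<^esub> s) \<odot>\<^bsub>N\<^esub> x = \<zero>\<^bsub>E.T\<^esub> \<odot>\<^bsub>N\<^esub> (s \<odot>\<^bsub>N\<^esub> x)" using s by simp
  qed (use s in \<open>simp add: E.T.l_distr act_add_l t_assoc act_t\<close>)
  show "\<one>\<^bsub>E.T\<^esub> \<odot>\<^bsub>N\<^esub> x = x" if "x \<in> carrier N" for x
    using act_t[of \<one> \<one> x] that E.proj_one by (simp add: E.t_def)
qed (simp_all add: act_add_l)

lemma bimodule_env: "bimodule_env k A (enveloping_algebra k A) N E.t"
  unfolding enveloping_algebra_def
proof (intro bimodule_env.intro k_algebra_axioms two_modules.intro N_left_module bimodule_env_axioms.intro)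
  show "\<exists>L\<in>additive_maps E.T A. \<forall>b\<in>carrier A. \<forall>c\<in>carrier A. L (E.t b c) = f b c"
    if "f \<in> bilinear_maps k A A A" for f
    using E.descend_additive[OF left_module, of f] E.descend_t[OF left_module, of f] that
    by (intro bexI[of _ "E.descend A f"]) (simp_all add: bilinear_opposite)
  show "P r" if "r \<in> carrier E.T" "P \<zero>\<^bsub>E.T\<^esub>"
    "\<And>b c r. b \<in> carrier A \<Longrightarrow> c \<in> carrier A \<Longrightarrow> r \<in> carrier E.T \<Longrightarrow> P r \<Longrightarrow> P (E.t b c \<oplus>\<^bsub>E.T\<^esub> r)"
    for r P using E.t_generate[of r P] that by simp
  show "x \<odot>\<^bsub>E.T\<^esub> \<one>\<^bsub>E.T\<^esub> = E.t (x \<odot> \<one>) \<one>" if "x \<in> carrier k" for x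
    using E.t_smult_l[OF that, of \<one> \<one>] E.proj_smult[OF that, of "E.e (\<one>, \<one>)"] E.proj_one by simp
qed (simp_all add: E.t_add_l E.t_add_r[simplified] E.t_mult act_t E.t_smult_l E.t_smult_r[simplified]
    E.proj_one[simplified] E.t_def[of \<one> \<one>])

theorem HH1_dim:
  assumes "field k" and "finite X"
    and "\<And>i. i \<in> X \<Longrightarrow> a i \<in> carrier A"
    and "\<And>i x. \<lbrakk>i \<in> X; x \<in> carrier A\<rbrakk> \<Longrightarrow> lf i x \<in> carrier k"
    and "\<And>i x y. \<lbrakk>i \<in> X; x \<in> carrier A; y \<in> carrier A\<rbrakk> \<Longrightarrow> lf i (x \<oplus> y) = lf i x \<oplus>\<^bsub>k\<^esub> lf i y"
    and "\<And>i z x. \<lbrakk>i \<in> X; z \<in> carrier k; x \<in> carrier A\<rbrakk> \<Longrightarrow> lf i (z \<odot> x) = z \<otimes>\<^bsub>k\<^esub> lf i x"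
    and "\<And>D. D \<in> derivations k A \<Longrightarrow> (\<forall>i\<in>X. lf i (D (a i)) = \<zero>\<^bsub>k\<^esub>) \<longleftrightarrow>
      (\<exists>m\<in>carrier A. \<forall>x\<in>carrier A. D x = x \<otimes> m \<ominus> m \<otimes> x)"
    and "\<And>w. w \<in> carrier (free_module k X) \<Longrightarrow>
      \<exists>D\<in>derivations k A. \<forall>i\<in>X. lf i (D (a i)) = w i"
  shows "vectorspace k (HH k 1 A) \<and> vectorspace.fin_dim k (HH k 1 A) \<and>
    vectorspace.dim k (HH k 1 A) = card X"
  unfolding HH_def by (rule bimodule_env.Ext1_dim[OF bimodule_env]) (rule assms; assumption)+

end

section \<open>Derivations of group algebras\<close>

definition centralizer :: "('g, 'f) monoid_scheme \<Rightarrow> 'g \<Rightarrow> 'g set" where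
  "centralizer G x = {c \<in> carrier G. c \<otimes>\<^bsub>G\<^esub> x = x \<otimes>\<^bsub>G\<^esub> c}"

definition additive_chars :: "('g, 'f) monoid_scheme \<Rightarrow> 'g set \<Rightarrow> ('k, 'e) ring_scheme \<Rightarrow> ('g \<Rightarrow> 'k) set" where
  "additive_chars G H k = {f \<in> H \<rightarrow> carrier k. \<forall>c\<in>H. \<forall>c'\<in>H. f (c \<otimes>\<^bsub>G\<^esub> c') = f c \<oplus>\<^bsub>k\<^esub> f c'}"

lemma (in abelian_group) left_hom_sum:
  assumes "left_module R N" "f \<in> left_hom R M N" "g \<in> left_hom R M N"
  shows "(\<lambda>x. f x \<oplus>\<^bsub>N\<^esub> g x) \<in> left_hom R M N"
proof -
  interpret N: left_module R N by fact
  show ?thesis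
    using left_hom_closed[OF assms(2)] left_hom_closed[OF assms(3)]
    by (intro left_homI) (simp_all add: left_hom_add[OF assms(2)] left_hom_add[OF assms(3)]
        left_hom_smult[OF assms(2)] left_hom_smult[OF assms(3)] N.lsmult_r_distr N.M.a_ac)
qed

section \<open>Derivations of a group algebra as cocycles of the group\<close>

locale group_algebra = cring_monoid k G + G: group G
  for k :: "('k, 'e) ring_scheme" and G :: "('g, 'f) monoid_scheme" (structure) +
  assumes finite_G: "finite (carrier G)"
begin

lemma cancel [simp]:
  "\<lbrakk>g \<in> carrier G; h \<in> carrier G\<rbrakk> \<Longrightarrow> g \<otimes> (inv g \<otimes> h) = h"
  "\<lbrakk>g \<in> carrier G; h \<in> carrier G\<rbrakk> \<Longrightarrow> inv g \<otimes> (g \<otimes> h) = h"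
  by (simp_all add: G.m_assoc[symmetric])

lemmas group_simps = G.m_assoc G.inv_mult_group

lemma carrier_F_finite: "u \<in> carrier F \<longleftrightarrow> (\<forall>x\<in>carrier G. u x \<in> carrier k) \<and> (\<forall>x. x \<notin> carrier G \<longrightarrow> u x = \<zero>\<^bsub>k\<^esub>)"
proof -
  have "finite {x. u x \<noteq> \<zero>\<^bsub>k\<^esub>}" if "\<forall>x. x \<notin> carrier G \<longrightarrow> u x = \<zero>\<^bsub>k\<^esub>"
    by (rule finite_subset[OF _ finite_G]) (use that in auto)
  then show ?thesis by (auto simp: free_module_carrier)
qed

lemma F_apply_closed: "u \<in> carrier F \<Longrightarrow> u x \<in> carrier k"
  by (rule k.free_module_apply_closed)

lemma F_eqI:
  assumes "u \<in> carrier F" "v \<in> carrier F" "\<And>z. z \<in> carrier G \<Longrightarrow> u z = v z"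
  shows "u = v"
proof
  fix z show "u z = v z" using assms by (cases "z \<in> carrier G") (auto simp: carrier_F_finite)
qed

text \<open>A group element permutes the coefficients by translation. Both sides are linear in
  \<open>u\<close>, so the comparison is made on group elements.\<close>

lemma mult_basis_apply:
  assumes u: "u \<in> carrier F" and g: "g \<in> carrier G" and z: "z \<in> carrier G"
  shows "(u \<otimes>\<^bsub>S\<^esub> e g) z = u (z \<otimes> inv g)" "(e g \<otimes>\<^bsub>S\<^esub> u) z = u (inv g \<otimes> z)"
proof -
  note uc = F_apply_closed
  have r: "(\<lambda>u z. if z \<in> carrier G then u (z \<otimes> inv g) else \<zero>\<^bsub>k\<^esub>) \<in> left_hom k F F"
    by (rule left_homI) (auto simp: carrier_F_finite free_module_simps fun_eq_iff g)
  have "u \<otimes>\<^bsub>S\<^esub> e g = (\<lambda>z. if z \<in> carrier G then u (z \<otimes> inv g) else \<zero>\<^bsub>k\<^esub>)"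
  proof (rule k.free_module_hom_eqI[OF u F.left_module_axioms mult_left_hom_l r])
    fix x assume x: "x \<in> carrier G"
    have "z \<otimes> inv g = x \<longleftrightarrow> z = x \<otimes> g" if "z \<in> carrier G" for z
      using x g that by (metis G.inv_solve_right)
    then have "e (x \<otimes> g) = (\<lambda>z. if z \<in> carrier G then e x (z \<otimes> inv g) else \<zero>\<^bsub>k\<^esub>)"
      using x g by (auto simp: fun_eq_iff basis_vec_def)
    then show "e x \<otimes>\<^bsub>S\<^esub> e g = (\<lambda>z. if z \<in> carrier G then e x (z \<otimes> inv g) else \<zero>\<^bsub>k\<^esub>)"
      using x g by simp
  qed (use g in simp)
  then show "(u \<otimes>\<^bsub>S\<^esub> e g) z = u (z \<otimes> inv g)" using z by simp
  have l: "(\<lambda>u z. if z \<in> carrier G then u (inv g \<otimes> z) else \<zero>\<^bsub>k\<^esub>) \<in> left_hom k F F"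
    by (rule left_homI) (auto simp: carrier_F_finite free_module_simps fun_eq_iff g)
  have "e g \<otimes>\<^bsub>S\<^esub> u = (\<lambda>z. if z \<in> carrier G then u (inv g \<otimes> z) else \<zero>\<^bsub>k\<^esub>)"
  proof (rule k.free_module_hom_eqI[OF u F.left_module_axioms mult_left_hom_r l])
    fix x assume x: "x \<in> carrier G"
    have "inv g \<otimes> z = x \<longleftrightarrow> z = g \<otimes> x" if "z \<in> carrier G" for z
      using x g that by (metis G.inv_solve_left)
    then have "e (g \<otimes> x) = (\<lambda>z. if z \<in> carrier G then e x (inv g \<otimes> z) else \<zero>\<^bsub>k\<^esub>)"
      using x g by (auto simp: fun_eq_iff basis_vec_def)
    then show "e g \<otimes>\<^bsub>S\<^esub> e x = (\<lambda>z. if z \<in> carrier G then e x (inv g \<otimes> z) else \<zero>\<^bsub>k\<^esub>)"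
      using x g by simp
  qed (use g in simp)
  then show "(e g \<otimes>\<^bsub>S\<^esub> u) z = u (inv g \<otimes> z)" using z by simp
qed

lemma S_minus: "u \<ominus>\<^bsub>S\<^esub> v = u \<ominus>\<^bsub>F\<^esub> v"
  by (simp add: a_minus_def a_inv_def m_inv_def)

lemma inner_apply:
  assumes m: "m \<in> carrier F" and g: "g \<in> carrier G" and y: "y \<in> carrier G"
  shows "(e g \<otimes>\<^bsub>S\<^esub> m \<ominus>\<^bsub>S\<^esub> m \<otimes>\<^bsub>S\<^esub> e g) (y \<otimes> g) = m (inv g \<otimes> y \<otimes> g) \<ominus>\<^bsub>k\<^esub> m y"
  using assms by (simp add: S_minus k.free_module_diff mult_basis_apply group_simps)

text \<open>The coefficient of \<open>y\<close> in the product of \<open>D (e g)\<close> with the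
  inverse of \<open>g\<close>. Translating back by \<open>g\<close> turns the Leibniz rule into the
  cocycle identity \<open>twist_mult\<close> for conjugation, and inner derivations into
  coboundaries.\<close>

definition twist :: "(('g \<Rightarrow> 'k) \<Rightarrow> 'g \<Rightarrow> 'k) \<Rightarrow> 'g \<Rightarrow> 'g \<Rightarrow> 'k" where
  "twist D g y = D (e g) (y \<otimes> g)"

context
  fixes D assumes D: "D \<in> derivations k S"
begin

lemma D_closed: "u \<in> carrier F \<Longrightarrow> D u \<in> carrier F"
  using derivation_closed[OF D] by simp

lemma twist_closed: "\<lbrakk>g \<in> carrier G; y \<in> carrier G\<rbrakk> \<Longrightarrow> twist D g y \<in> carrier k"
  unfolding twist_def by (rule F_apply_closed[OF D_closed]) simp

lemma twist_mult:
  assumes g: "g \<in> carrier G" and h: "h \<in> carrier G" and y: "y \<in> carrier G"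
  shows "twist D (g \<otimes> h) y = twist D g y \<oplus>\<^bsub>k\<^esub> twist D h (inv g \<otimes> y \<otimes> g)"
proof -
  have "D (e (g \<otimes> h)) = D (e g) \<otimes>\<^bsub>S\<^esub> e h \<oplus>\<^bsub>F\<^esub> e g \<otimes>\<^bsub>S\<^esub> D (e h)"
    using derivation_mult[OF D, of "e g" "e h"] g h by simp
  then show ?thesis
    using assms D_closed[of "e g"] D_closed[of "e h"]
    by (simp add: twist_def free_module_simps mult_basis_apply group_simps)
qed

lemma D_inner:
  assumes m: "m \<in> carrier F"
    and eq: "\<And>g y. \<lbrakk>g \<in> carrier G; y \<in> carrier G\<rbrakk> \<Longrightarrow>
      twist D g y = m (inv g \<otimes> y \<otimes> g) \<ominus>\<^bsub>k\<^esub> m y"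
    and u: "u \<in> carrier F"
  shows "D u = u \<otimes>\<^bsub>S\<^esub> m \<ominus>\<^bsub>S\<^esub> m \<otimes>\<^bsub>S\<^esub> u"
proof (rule k.free_module_hom_eqI[OF u F.left_module_axioms])
  show "D \<in> left_hom k F F"
    using derivation_left_hom[OF D] left_hom_cong[of S F S F k] by simp
  show "(\<lambda>u. u \<otimes>\<^bsub>S\<^esub> m \<ominus>\<^bsub>S\<^esub> m \<otimes>\<^bsub>S\<^esub> u) \<in> left_hom k F F"
    unfolding S_minus using m F.M.minus_closed
    by (intro left_homI) (simp_all add: a_minus_def mult_add_l mult_add_r mult_smult_l mult_smult_r
        F.M.minus_add F.M.a_ac F.lsmult_r_distr F.lsmult_r_minus)
  fix g assume g: "g \<in> carrier G"
  show "D (e g) = e g \<otimes>\<^bsub>S\<^esub> m \<ominus>\<^bsub>S\<^esub> m \<otimes>\<^bsub>S\<^esub> e g"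
  proof (rule F_eqI)
    show "e g \<otimes>\<^bsub>S\<^esub> m \<ominus>\<^bsub>S\<^esub> m \<otimes>\<^bsub>S\<^esub> e g \<in> carrier F"
      using g m F.M.minus_closed by (simp add: S_minus)
    fix z assume z: "z \<in> carrier G"
    show "D (e g) z = (e g \<otimes>\<^bsub>S\<^esub> m \<ominus>\<^bsub>S\<^esub> m \<otimes>\<^bsub>S\<^esub> e g) z"
      using inner_apply[OF m g, of "z \<otimes> inv g"] eq[OF g, of "z \<otimes> inv g"] g z
      by (simp add: twist_def group_simps)
  qed (use D_closed g in simp)
qed

end

text \<open>A cocycle prescribes the values on group elements; its identity is the Leibniz rule
  there, and bilinearity extends the rule to the whole algebra.\<close>

lemma derivation_of_twist:
  assumes Fc: "\<And>g y. \<lbrakk>g \<in> carrier G; y \<in> carrier G\<rbrakk> \<Longrightarrow> f g y \<in> carrier k"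
    and Fm: "\<And>g h y. \<lbrakk>g \<in> carrier G; h \<in> carrier G; y \<in> carrier G\<rbrakk> \<Longrightarrow>
      f (g \<otimes> h) y = f g y \<oplus>\<^bsub>k\<^esub> f h (inv g \<otimes> y \<otimes> g)"
  shows "\<exists>D\<in>derivations k S. \<forall>g\<in>carrier G. \<forall>y\<in>carrier G. twist D g y = f g y"
proof -
  define \<phi> where "\<phi> g = (\<lambda>z. if z \<in> carrier G then f g (z \<otimes> inv g) else \<zero>\<^bsub>k\<^esub>)" for g
  have \<phi>c: "\<phi> \<in> carrier G \<rightarrow> carrier F"
    by (intro funcsetI) (simp add: carrier_F_finite \<phi>_def Fc)
  have \<phi>c': "\<phi> g \<in> carrier F" if "g \<in> carrier G" for g using \<phi>c that by auto
  define D where "D = lin_ext k (carrier G) F \<phi>"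
  have D: "D \<in> left_hom k F F" unfolding D_def by (rule F.lin_ext_left_hom[OF \<phi>c])
  have De: "D (e g) = \<phi> g" if "g \<in> carrier G" for g
    unfolding D_def by (rule F.lin_ext_basis_vec[OF that \<phi>c])
  note Dc = left_hom_closed[OF D]
  have basis: "D (e g \<otimes>\<^bsub>S\<^esub> e h) = D (e g) \<otimes>\<^bsub>S\<^esub> e h \<oplus>\<^bsub>F\<^esub> e g \<otimes>\<^bsub>S\<^esub> D (e h)"
    if g: "g \<in> carrier G" and h: "h \<in> carrier G" for g h
  proof (rule F_eqI)
    show "D (e g \<otimes>\<^bsub>S\<^esub> e h) \<in> carrier F"
      "D (e g) \<otimes>\<^bsub>S\<^esub> e h \<oplus>\<^bsub>F\<^esub> e g \<otimes>\<^bsub>S\<^esub> D (e h) \<in> carrier F"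
      using g h by (simp_all add: Dc)
    fix z assume z: "z \<in> carrier G"
    show "D (e g \<otimes>\<^bsub>S\<^esub> e h) z = (D (e g) \<otimes>\<^bsub>S\<^esub> e h \<oplus>\<^bsub>F\<^esub> e g \<otimes>\<^bsub>S\<^esub> D (e h)) z"
      using g h z \<phi>c'[OF g] \<phi>c'[OF h] Fm[OF g h, of "z \<otimes> inv h \<otimes> inv g"]
      by (simp add: De free_module_simps mult_basis_apply) (simp add: \<phi>_def group_simps)
  qed
  have mult: "D (u \<otimes>\<^bsub>S\<^esub> v) = D u \<otimes>\<^bsub>S\<^esub> v \<oplus>\<^bsub>F\<^esub> u \<otimes>\<^bsub>S\<^esub> D v"
    if u: "u \<in> carrier F" and v: "v \<in> carrier F" for u v
  proof (rule k.free_module_hom_eqI[OF u F.left_module_axioms])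
    show "(\<lambda>u. D (u \<otimes>\<^bsub>S\<^esub> v)) \<in> left_hom k F F"
      by (rule left_hom_compose[OF mult_left_hom_l[OF v] D])
    show "(\<lambda>u. D u \<otimes>\<^bsub>S\<^esub> v \<oplus>\<^bsub>F\<^esub> u \<otimes>\<^bsub>S\<^esub> D v) \<in> left_hom k F F"
      by (intro F.M.left_hom_sum F.left_module_axioms left_hom_compose[OF D mult_left_hom_l[OF v]]
          mult_left_hom_l Dc v)
    fix g assume g: "g \<in> carrier G"
    then have eg: "e g \<in> carrier F" by simp
    show "D (e g \<otimes>\<^bsub>S\<^esub> v) = D (e g) \<otimes>\<^bsub>S\<^esub> v \<oplus>\<^bsub>F\<^esub> e g \<otimes>\<^bsub>S\<^esub> D v"
    proof (rule k.free_module_hom_eqI[OF v F.left_module_axioms])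
      show "(\<lambda>v. D (e g \<otimes>\<^bsub>S\<^esub> v)) \<in> left_hom k F F"
        by (rule left_hom_compose[OF mult_left_hom_r[OF eg] D])
      show "(\<lambda>v. D (e g) \<otimes>\<^bsub>S\<^esub> v \<oplus>\<^bsub>F\<^esub> e g \<otimes>\<^bsub>S\<^esub> D v) \<in> left_hom k F F"
        by (intro F.M.left_hom_sum F.left_module_axioms left_hom_compose[OF D mult_left_hom_r[OF eg]]
            mult_left_hom_r Dc eg)
    qed (rule basis[OF g])
  qed
  have "D \<in> left_hom k S S" using D left_hom_cong[of S F S F k] by simp
  then have "D \<in> derivations k S" using mult by (simp add: derivations_def)
  moreover have "twist D g y = f g y" if "g \<in> carrier G" "y \<in> carrier G" for g y
    using that by (simp add: twist_def De \<phi>_def group_simps)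
  ultimately show ?thesis by (intro bexI[of _ D]) simp_all
qed

text \<open>
  As in Shapiro's lemma, the class of the cocycle \<open>twist D\<close> is determined by its restrictions to the
  centralizers of the representatives.
\<close>

theorem HH1_group_algebra_dim:
  assumes k: "field k" and X: "finite X"
    and \<rho>: "\<And>i. i \<in> X \<Longrightarrow> \<rho> i \<in> Rep" and \<gamma>: "\<And>i. i \<in> X \<Longrightarrow> \<gamma> i \<in> centralizer G (\<rho> i)"
    and Rep: "Rep \<subseteq> carrier G"
    and cover: "\<And>y. y \<in> carrier G \<Longrightarrow> \<exists>x\<in>Rep. \<exists>g\<in>carrier G. y = inv g \<otimes> x \<otimes> g"
    and unique: "\<And>x x' g. \<lbrakk>x \<in> Rep; x' \<in> Rep; g \<in> carrier G; x' = inv g \<otimes> x \<otimes> g\<rbrakk> \<Longrightarrow> x' = x"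
    and detect: "\<And>x f c. \<lbrakk>x \<in> Rep; f \<in> additive_chars G (centralizer G x) k;
      \<And>i. \<lbrakk>i \<in> X; \<rho> i = x\<rbrakk> \<Longrightarrow> f (\<gamma> i) = \<zero>\<^bsub>k\<^esub>; c \<in> centralizer G x\<rbrakk> \<Longrightarrow> f c = \<zero>\<^bsub>k\<^esub>"
    and exist: "\<And>x w. \<lbrakk>x \<in> Rep; \<And>i. i \<in> X \<Longrightarrow> w i \<in> carrier k\<rbrakk> \<Longrightarrow>
      \<exists>f\<in>additive_chars G (centralizer G x) k. \<forall>i\<in>X. \<rho> i = x \<longrightarrow> f (\<gamma> i) = w i"
  shows "vectorspace k (HH k 1 S) \<and> vectorspace.fin_dim k (HH k 1 S) \<and>
    vectorspace.dim k (HH k 1 S) = card X"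
proof -
  interpret kA: k_algebra_module k S by (intro k_algebra_module.intro) unfold_locales
  have Rc: "x \<in> carrier G" if "x \<in> Rep" for x using Rep that by auto
  have C: "c \<in> carrier G" "inv c \<otimes> x \<otimes> c = x" if "c \<in> centralizer G x" "x \<in> carrier G" for c x
    using that by (auto simp: centralizer_def G.m_assoc) (metis cancel(2))
  have CI: "c \<in> centralizer G x" if "c \<in> carrier G" "x \<in> carrier G" "inv c \<otimes> x \<otimes> c = x" for c x
  proof -
    have "c \<otimes> x = c \<otimes> (inv c \<otimes> x \<otimes> c)" by (simp only: that(3))
    also have "\<dots> = x \<otimes> c" using that(1,2) by (simp add: G.m_assoc)
    finally show ?thesis using that by (simp add: centralizer_def)
  qed
  from cover have "\<forall>y\<in>carrier G. \<exists>xg. fst xg \<in> Rep \<and> snd xg \<in> carrier G \<and> y = inv (snd xg) \<otimes> fst xg \<otimes> snd xg"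
    by (metis fst_conv snd_conv)
  then obtain xg where xg: "\<forall>y\<in>carrier G. fst (xg y) \<in> Rep \<and> snd (xg y) \<in> carrier G \<and>
      y = inv (snd (xg y)) \<otimes> fst (xg y) \<otimes> snd (xg y)" by (rule bchoice[THEN exE])
  \<comment> \<open>\<open>r y\<close> is the representative of the class of \<open>y\<close>, and
    \<open>s y\<close> a conjugator with
    \<open>y = inv (s y) \<otimes> r y \<otimes> s y\<close>.\<close>
  define r where "r y = fst (xg y)" for y
  define s where "s y = snd (xg y)" for y
  have r: "r y \<in> Rep" and s [simp]: "s y \<in> carrier G" and y: "y = inv (s y) \<otimes> r y \<otimes> s y"
    if "y \<in> carrier G" for y using xg that by (auto simp: r_def s_def)
  have rc [simp]: "r y \<in> carrier G" if "y \<in> carrier G" for y using r[OF that] by (rule Rc)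
  have sy: "s y \<otimes> y \<otimes> inv (s y) = r y" if "y \<in> carrier G" for y
  proof -
    have "s y \<otimes> (inv (s y) \<otimes> r y \<otimes> s y) \<otimes> inv (s y) = r y" using that by (simp add: group_simps)
    then show ?thesis using y[OF that] by simp
  qed
  have r_conj: "r (inv g \<otimes> x \<otimes> g) = x" if x: "x \<in> Rep" and g: "g \<in> carrier G" for x g
  proof -
    let ?y = "inv g \<otimes> x \<otimes> g"
    have yc: "?y \<in> carrier G" using x g Rc by simp
    have "r ?y = inv (g \<otimes> inv (s ?y)) \<otimes> x \<otimes> (g \<otimes> inv (s ?y))"
      using sy[OF yc] x g Rc s[OF yc] by (simp add: group_simps)
    then show ?thesis using unique[OF x r[OF yc]] g s[OF yc] by simp
  qed
  show ?thesis
  \<comment> \<open>The coordinate at \<open>i\<close> is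
    \<open>twist D (\<gamma> i) (\<rho> i)\<close>, the value at \<open>\<gamma> i\<close> of the
    character that \<open>D\<close> induces on the centralizer of \<open>\<rho> i\<close>.\<close>
  proof (rule kA.HH1_dim[OF k X, where a = "\<lambda>i. e (\<gamma> i)" and lf = "\<lambda>i u. u (\<rho> i \<otimes> \<gamma> i)"])
    fix D assume "D \<in> derivations k (monoid_algebra k G)"
    then have D: "D \<in> derivations k S" .
    show "(\<forall>i\<in>X. D (e (\<gamma> i)) (\<rho> i \<otimes> \<gamma> i) = \<zero>\<^bsub>k\<^esub>) \<longleftrightarrow>
      (\<exists>m\<in>carrier S. \<forall>x\<in>carrier S. D x = x \<otimes>\<^bsub>S\<^esub> m \<ominus>\<^bsub>S\<^esub> m \<otimes>\<^bsub>S\<^esub> x)"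
    proof
      assume "\<exists>m\<in>carrier S. \<forall>x\<in>carrier S. D x = x \<otimes>\<^bsub>S\<^esub> m \<ominus>\<^bsub>S\<^esub> m \<otimes>\<^bsub>S\<^esub> x"
      then obtain m where m: "m \<in> carrier F" "\<And>x. x \<in> carrier F \<Longrightarrow> D x = x \<otimes>\<^bsub>S\<^esub> m \<ominus>\<^bsub>S\<^esub> m \<otimes>\<^bsub>S\<^esub> x"
        by auto
      show "\<forall>i\<in>X. D (e (\<gamma> i)) (\<rho> i \<otimes> \<gamma> i) = \<zero>\<^bsub>k\<^esub>"
      proof
        fix i assume i: "i \<in> X"
        have \<rho>c: "\<rho> i \<in> carrier G" using \<rho>[OF i] by (rule Rc)
        note c = C[OF \<gamma>[OF i] \<rho>c]
        show "D (e (\<gamma> i)) (\<rho> i \<otimes> \<gamma> i) = \<zero>\<^bsub>k\<^esub>"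
          using inner_apply[OF m(1) c(1) \<rho>c] m(2)[of "e (\<gamma> i)"] c F_apply_closed[OF m(1)]
          by (simp add: a_minus_def k.r_neg)
      qed
    next
      assume zero: "\<forall>i\<in>X. D (e (\<gamma> i)) (\<rho> i \<otimes> \<gamma> i) = \<zero>\<^bsub>k\<^esub>"
      note tc = twist_closed[OF D] and tm = twist_mult[OF D]
      \<comment> \<open>Elements of the centralizer fix \<open>x\<close> under conjugation, so the
        cocycle identity at \<open>x\<close> becomes additivity and \<open>detect\<close>
        applies.\<close>
      have stab: "twist D c x = \<zero>\<^bsub>k\<^esub>" if x: "x \<in> Rep" and c: "c \<in> centralizer G x" for x c
      proof (rule detect[OF x _ _ c])
        show "(\<lambda>c. twist D c x) \<in> additive_chars G (centralizer G x) k"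
          using C Rc[OF x] tc tm by (auto simp: additive_chars_def)
        show "twist D (\<gamma> i) x = \<zero>\<^bsub>k\<^esub>" if "i \<in> X" "\<rho> i = x" for i
          using zero that by (auto simp: twist_def)
      qed
      \<comment> \<open>A potential for the cocycle: its value along the chosen path from the
        representative to \<open>y\<close>. By \<open>stab\<close> any other conjugator gives the
        same value, which is \<open>m_conj\<close>.\<close>
      define m where "m y = (if y \<in> carrier G then twist D (s y) (r y) else \<zero>\<^bsub>k\<^esub>)" for y
      have mF: "m \<in> carrier F" by (simp add: carrier_F_finite m_def tc)
      have m_conj: "m (inv g \<otimes> x \<otimes> g) = twist D g x" if x: "x \<in> Rep" and g: "g \<in> carrier G" for x g
      proof -
        let ?y = "inv g \<otimes> x \<otimes> g"
        have yc: "?y \<in> carrier G" using x g Rc by simp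
        note [simp] = s[OF yc] Rc[OF x] g
        define c where "c = g \<otimes> inv (s ?y)"
        have cG: "c \<in> carrier G" by (simp add: c_def)
        have "inv c \<otimes> x \<otimes> c = s ?y \<otimes> ?y \<otimes> inv (s ?y)" by (simp add: c_def group_simps)
        also have "\<dots> = x" using sy[OF yc] r_conj[OF x g] by simp
        finally have cx: "inv c \<otimes> x \<otimes> c = x" .
        have "g = c \<otimes> s ?y" by (simp add: c_def group_simps)
        then have "twist D g x = twist D c x \<oplus>\<^bsub>k\<^esub> twist D (s ?y) x"
          using tm[OF cG s[OF yc] Rc[OF x]] cx by simp
        then have "twist D g x = twist D (s ?y) x"
          using stab[OF x CI[OF cG Rc[OF x] cx]] tc[OF s[OF yc] Rc[OF x]] by simp
        then show ?thesis using r_conj[OF x g] yc by (simp add: m_def)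
      qed
      have "twist D g y = m (inv g \<otimes> y \<otimes> g) \<ominus>\<^bsub>k\<^esub> m y" if g: "g \<in> carrier G" and yc: "y \<in> carrier G" for g y
      proof -
        have sg: "s y \<otimes> g \<in> carrier G" using yc g by simp
        have "inv (s y \<otimes> g) \<otimes> r y \<otimes> (s y \<otimes> g) = inv g \<otimes> (inv (s y) \<otimes> r y \<otimes> s y) \<otimes> g"
          using yc g by (simp add: group_simps)
        then have "m (inv g \<otimes> y \<otimes> g) = twist D (s y \<otimes> g) (r y)"
          using m_conj[OF r[OF yc] sg] y[OF yc] by simp
        also have "\<dots> = m y \<oplus>\<^bsub>k\<^esub> twist D g y"
          using tm[OF s[OF yc] g rc[OF yc]] y[OF yc] yc by (simp add: m_def)
        finally show ?thesis
          using F_apply_closed[OF mF] tc[OF g yc]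
          by (simp add: a_minus_def k.a_assoc k.a_comm[of "m y"] k.r_neg)
      qed
      then show "\<exists>m\<in>carrier S. \<forall>x\<in>carrier S. D x = x \<otimes>\<^bsub>S\<^esub> m \<ominus>\<^bsub>S\<^esub> m \<otimes>\<^bsub>S\<^esub> x"
        using mF D_inner[OF D mF] by (intro bexI[of _ m]) simp_all
    qed
  next
    fix w assume w: "w \<in> carrier (free_module k X)"
    have "\<forall>x\<in>Rep. \<exists>f. f \<in> additive_chars G (centralizer G x) k \<and> (\<forall>i\<in>X. \<rho> i = x \<longrightarrow> f (\<gamma> i) = w i)"
      using exist[of _ w] k.free_module_apply_closed[OF w] by (simp add: Bex_def)
    then obtain f where f: "\<forall>x\<in>Rep. f x \<in> additive_chars G (centralizer G x) k \<and>
        (\<forall>i\<in>X. \<rho> i = x \<longrightarrow> f x (\<gamma> i) = w i)" by (rule bchoice[THEN exE])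
    have fc: "f x c \<in> carrier k" if "x \<in> Rep" "c \<in> centralizer G x" for x c
      using f that by (auto simp: additive_chars_def)
    have fm: "f x (c \<otimes> c') = f x c \<oplus>\<^bsub>k\<^esub> f x c'" if "x \<in> Rep" "c \<in> centralizer G x" "c' \<in> centralizer G x" for x c c'
      using f that by (auto simp: additive_chars_def)
    \<comment> \<open>The element of the centralizer of \<open>r y\<close> by which
      \<open>s y \<otimes> g\<close> differs from the chosen conjugator at the conjugate of
      \<open>y\<close>. These elements telescope along products, so characters of the centralizers,
      applied to them, form a cocycle.\<close>
    define q where "q g y = s y \<otimes> g \<otimes> inv (s (inv g \<otimes> y \<otimes> g))" for g y
    have r_inv: "r (inv g \<otimes> y \<otimes> g) = r y" if "g \<in> carrier G" "y \<in> carrier G" for g y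
    proof -
      have "inv g \<otimes> y \<otimes> g = inv g \<otimes> (inv (s y) \<otimes> r y \<otimes> s y) \<otimes> g" using y[OF that(2)] by simp
      also have "\<dots> = inv (s y \<otimes> g) \<otimes> r y \<otimes> (s y \<otimes> g)" using that by (simp add: group_simps)
      finally show ?thesis using r_conj[OF r[OF that(2)], of "s y \<otimes> g"] that by simp
    qed
    have q: "q g y \<in> centralizer G (r y)" if g: "g \<in> carrier G" and yc: "y \<in> carrier G" for g y
    proof (rule CI)
      let ?y = "inv g \<otimes> y \<otimes> g"
      have y'c: "?y \<in> carrier G" using g yc by simp
      show "q g y \<in> carrier G" "r y \<in> carrier G" using g yc y'c by (simp_all add: q_def)
      have "inv (q g y) \<otimes> r y \<otimes> q g y =
          s ?y \<otimes> (inv g \<otimes> (inv (s y) \<otimes> r y \<otimes> s y) \<otimes> g) \<otimes> inv (s ?y)"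
        using g yc s[OF y'c] by (simp add: q_def group_simps)
      also have "\<dots> = s ?y \<otimes> ?y \<otimes> inv (s ?y)" using y[OF yc] by simp
      also have "\<dots> = r y" using sy[OF y'c] r_inv[OF g yc] by simp
      finally show "inv (q g y) \<otimes> r y \<otimes> q g y = r y" .
    qed
    have "\<exists>D\<in>derivations k S. \<forall>g\<in>carrier G. \<forall>y\<in>carrier G. twist D g y = f (r y) (q g y)"
    proof (rule derivation_of_twist)
      show "f (r y) (q g y) \<in> carrier k" if "g \<in> carrier G" "y \<in> carrier G" for g y
        using fc[OF r q] that by simp
      fix g h y assume g: "g \<in> carrier G" and h: "h \<in> carrier G" and yc: "y \<in> carrier G"
      let ?y = "inv g \<otimes> y \<otimes> g"
      have y'c: "?y \<in> carrier G" using g yc by simp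
      have y''c: "inv h \<otimes> ?y \<otimes> h \<in> carrier G" using h y'c by simp
      have "inv (g \<otimes> h) \<otimes> y \<otimes> (g \<otimes> h) = inv h \<otimes> ?y \<otimes> h" using g h yc by (simp add: group_simps)
      then have "q (g \<otimes> h) y = q g y \<otimes> q h ?y"
        using g h yc s[OF y'c] s[OF y''c] by (simp add: q_def group_simps)
      then show "f (r y) (q (g \<otimes> h) y) = f (r y) (q g y) \<oplus>\<^bsub>k\<^esub> f (r ?y) (q h ?y)"
        using fm[OF r[OF yc] q[OF g yc]] q[OF h y'c] r_inv[OF g yc] by simp
    qed
    then obtain D where D: "D \<in> derivations k S" "\<forall>g\<in>carrier G. \<forall>y\<in>carrier G. twist D g y = f (r y) (q g y)"
      by (elim bexE)
    have "D (e (\<gamma> i)) (\<rho> i \<otimes> \<gamma> i) = w i" if i: "i \<in> X" for i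
    proof -
      define x where "x = \<rho> i"
      define c where "c = \<gamma> i"
      have xR: "x \<in> Rep" and cC: "c \<in> centralizer G x" using \<rho>[OF i] \<gamma>[OF i] by (simp_all add: x_def c_def)
      have xc: "x \<in> carrier G" by (rule Rc[OF xR])
      note c = C[OF cC xc]
      have rx: "r x = x" using r_conj[OF xR, of \<one>] xc by simp
      \<comment> \<open>The conjugator chosen for a representative need not be the identity, but it
        centralizes \<open>x\<close>. Since characters take values in a commutative group, the
        contributions of \<open>s x\<close> and its inverse cancel.\<close>
      have sC: "s x \<in> centralizer G x"
        using y[OF xc] rx by (intro CI s xc) simp
      have siC: "inv (s x) \<in> centralizer G x"
        using sy[OF xc] rx s[OF xc] xc by (intro CI) simp_all
      have oC: "\<one> \<in> centralizer G x" using xc by (intro CI) simp_all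
      have f1: "f x \<one> = \<zero>\<^bsub>k\<^esub>"
        using fm[OF xR oC oC] fc[OF xR oC] k.add.r_cancel_one[of "f x \<one>" "f x \<one>"] by simp
      have ci: "f x (s x) \<oplus>\<^bsub>k\<^esub> f x (inv (s x)) = \<zero>\<^bsub>k\<^esub>"
        using fm[OF xR sC siC] f1 s[OF xc] by simp
      have scC: "s x \<otimes> c \<in> centralizer G x"
      proof (rule CI)
        have "inv (s x \<otimes> c) \<otimes> x \<otimes> (s x \<otimes> c) = inv c \<otimes> (inv (s x) \<otimes> x \<otimes> s x) \<otimes> c"
          using s[OF xc] c(1) xc by (simp add: group_simps)
        also have "\<dots> = x" using C(2)[OF sC xc] c(2) by simp
        finally show "inv (s x \<otimes> c) \<otimes> x \<otimes> (s x \<otimes> c) = x" .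
      qed (use s[OF xc] c xc in simp_all)
      have "D (e c) (x \<otimes> c) = f x (q c x)" using D(2) c(1) xc rx by (simp add: twist_def)
      also have "q c x = s x \<otimes> c \<otimes> inv (s x)" using c by (simp add: q_def)
      also have "f x \<dots> = f x (s x) \<oplus>\<^bsub>k\<^esub> f x c \<oplus>\<^bsub>k\<^esub> f x (inv (s x))"
        using fm[OF xR scC siC] fm[OF xR sC cC] by simp
      also have "\<dots> = f x c"
        using fc[OF xR sC] fc[OF xR siC] fc[OF xR cC] ci
        by (simp add: k.a_assoc k.a_comm[of "f x c"]) (simp add: k.a_assoc[symmetric])
      also have "\<dots> = w i" using f xR i by (simp add: x_def c_def)
      finally show ?thesis by (simp add: x_def c_def)
    qed
    with D(1) show "\<exists>D\<in>derivations k S. \<forall>i\<in>X. D (e (\<gamma> i)) (\<rho> i \<otimes> \<gamma> i) = w i"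
      by (intro bexI[of _ D]) simp_all
  next
    fix i assume i: "i \<in> X"
    show "e (\<gamma> i) \<in> carrier S" using C(1)[OF \<gamma>[OF i] Rc[OF \<rho>[OF i]]] by simp
  qed (simp_all add: F_apply_closed free_module_simps)
qed

end

section \<open>Centralizers of permutations\<close>

locale fin_perm =
  fixes S :: "'a set" and x :: "'a \<Rightarrow> 'a"
  assumes finite_S: "finite S" and x: "x permutes S"
begin

abbreviation "L \<equiv> least_power x"

definition "orb a = range (\<lambda>i. (x ^^ i) a)"

text \<open>A discrete logarithm along the cycle of \<open>a\<close>, determined only modulo
  \<open>L a\<close>; \<open>idx_pow\<close> is the form in which it is used.\<close>

definition "idx a z = (SOME i. z = (x ^^ i) a)"

definition "Cent = {\<sigma>. \<sigma> permutes S \<and> \<sigma> \<circ> x = x \<circ> \<sigma>}"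

lemma permutation_x: "permutation x"
  using finite_S x permutation_permutes by blast

lemma L_pos: "L a > 0" and pow_L [simp]: "(x ^^ L a) a = a"
  using least_power_of_permutation[OF permutation_x] by auto

lemma inj_pow: "inj (x ^^ i)"
  using permutes_inj[OF x] by (induction i) (auto simp: inj_compose intro: inj_compose)

lemma pow_eq_iff: "(x ^^ i) a = (x ^^ j) a \<longleftrightarrow> i mod L a = j mod L a"
proof -
  have *: "(x ^^ i) a = (x ^^ j) a \<longleftrightarrow> i mod L a = j mod L a" if "i \<le> j" for i j
  proof -
    have "(x ^^ j) a = (x ^^ i) ((x ^^ (j - i)) a)"
      using that by (metis comp_apply funpow_add le_add_diff_inverse)
    then have "(x ^^ i) a = (x ^^ j) a \<longleftrightarrow> (x ^^ (j - i)) a = a"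
      using inj_pow[of i] by (auto simp: inj_eq)
    also have "\<dots> \<longleftrightarrow> L a dvd (j - i)" by (simp add: least_power_dvd[OF permutation_x])
    also have "\<dots> \<longleftrightarrow> i mod L a = j mod L a" using mod_eq_dvd_iff_nat[OF that] by metis
    finally show ?thesis .
  qed
  show ?thesis using *[of i j] *[of j i] by (cases "i \<le> j") auto
qed

lemma pow_mem: "a \<in> S \<Longrightarrow> (x ^^ i) a \<in> S"
  by (induction i) (auto simp: permutes_in_image[OF x])

lemma mem_orb [simp, intro]: "(x ^^ i) a \<in> orb a" "a \<in> orb a"
  by (auto simp: orb_def intro: image_eqI[of _ _ 0])

lemma orbE: assumes "z \<in> orb a" obtains i where "z = (x ^^ i) a"
  using assms by (auto simp: orb_def)

lemma orb_pow [simp]: "orb ((x ^^ i) a) = orb a"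
proof
  show "orb ((x ^^ i) a) \<subseteq> orb a"
    by (auto simp: orb_def funpow_add[THEN fun_cong, simplified, symmetric])
  show "orb a \<subseteq> orb ((x ^^ i) a)"
  proof
    fix z assume "z \<in> orb a"
    then obtain j where z: "z = (x ^^ j) a" by (rule orbE)
    \<comment> \<open>With natural exponents, \<open>i\<close> steps back along the cycle are
      \<open>i * (L a - 1)\<close> steps forward.\<close>
    have "j mod L a = (j + i * (L a - 1) + i) mod L a"
    proof -
      have "j + i * (L a - 1) + i = j + i * L a" using L_pos[of a] by (cases "L a") auto
      then show ?thesis by (simp only: mod_mult_self1)
    qed
    then have "z = (x ^^ (j + i * (L a - 1))) ((x ^^ i) a)"
      using z pow_eq_iff by (metis comp_apply funpow_add)
    then show "z \<in> orb ((x ^^ i) a)" by auto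
  qed
qed

lemma orb_eq: "z \<in> orb a \<Longrightarrow> orb z = orb a"
  by (auto elim: orbE)

lemma orb_sym: "z \<in> orb a \<longleftrightarrow> a \<in> orb z"
  by (metis orb_eq mem_orb(2))

lemma orb_x [simp]: "orb (x a) = orb a"
  using orb_pow[of 1 a] by simp

lemma x_mem_orb [simp]: "x z \<in> orb a \<longleftrightarrow> z \<in> orb a"
  by (metis orb_x orb_sym)

lemma orb_subset: "a \<in> S \<Longrightarrow> orb a \<subseteq> S"
  using pow_mem by (auto elim: orbE)

lemma idx: "z \<in> orb a \<Longrightarrow> (x ^^ idx a z) a = z"
  unfolding idx_def by (rule someI2_ex) (auto simp: orb_def)

lemma idx_pow: "idx a ((x ^^ i) a) mod L a = i mod L a"
  using idx[of "(x ^^ i) a" a] pow_eq_iff by blast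

lemma card_orb: "card (orb a) = L a"
proof -
  have "orb a = (\<lambda>i. (x ^^ i) a) ` {..<L a}"
  proof
    show "orb a \<subseteq> (\<lambda>i. (x ^^ i) a) ` {..<L a}"
    proof
      fix z assume "z \<in> orb a"
      then obtain i where "z = (x ^^ i) a" by (rule orbE)
      also have "\<dots> = (x ^^ (i mod L a)) a" by (simp add: pow_eq_iff)
      finally show "z \<in> (\<lambda>i. (x ^^ i) a) ` {..<L a}" using L_pos[of a] by auto
    qed
  qed auto
  moreover have "inj_on (\<lambda>i. (x ^^ i) a) {..<L a}"
    by (rule inj_onI) (simp add: pow_eq_iff)
  ultimately show ?thesis by (simp add: card_image)
qed

lemma L_orb: "z \<in> orb a \<Longrightarrow> L z = L a"
  using card_orb orb_eq by metis

section \<open>Permutations commuting with x\<close>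

lemma Cent_permutes: "\<sigma> \<in> Cent \<Longrightarrow> \<sigma> permutes S"
  by (simp add: Cent_def)

lemma Cent_commute: "\<sigma> \<in> Cent \<Longrightarrow> \<sigma> (x z) = x (\<sigma> z)"
  by (auto simp: Cent_def fun_eq_iff)

lemma Cent_pow: "\<sigma> \<in> Cent \<Longrightarrow> \<sigma> ((x ^^ i) z) = (x ^^ i) (\<sigma> z)"
  by (induction i) (simp_all add: Cent_commute)

lemma CentI: "\<lbrakk>\<sigma> permutes S; \<And>z. z \<in> S \<Longrightarrow> \<sigma> (x z) = x (\<sigma> z)\<rbrakk> \<Longrightarrow> \<sigma> \<in> Cent"
  using permutes_not_in[of \<sigma> S] permutes_not_in[OF x] by (auto simp: Cent_def fun_eq_iff) metis

lemma Cent_comp: "\<lbrakk>\<sigma> \<in> Cent; \<tau> \<in> Cent\<rbrakk> \<Longrightarrow> \<sigma> \<circ> \<tau> \<in> Cent"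
  by (auto simp: Cent_def permutes_compose fun_eq_iff)

lemma Cent_id: "id \<in> Cent"
  by (simp add: Cent_def permutes_id)

lemma Cent_inj: "\<sigma> \<in> Cent \<Longrightarrow> \<sigma> y = \<sigma> z \<longleftrightarrow> y = z"
  using permutes_inj[OF Cent_permutes] by (auto simp: inj_eq)

lemma Cent_mem: "\<sigma> \<in> Cent \<Longrightarrow> \<sigma> z \<in> S \<longleftrightarrow> z \<in> S"
  using permutes_in_image[OF Cent_permutes] by blast

lemma Cent_orb: assumes \<sigma>: "\<sigma> \<in> Cent" shows "\<sigma> z \<in> orb (\<sigma> a) \<longleftrightarrow> z \<in> orb a"
proof
  assume "\<sigma> z \<in> orb (\<sigma> a)"
  then obtain i where "\<sigma> z = (x ^^ i) (\<sigma> a)" by (rule orbE)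
  then have "z = (x ^^ i) a" using Cent_pow[OF \<sigma>] Cent_inj[OF \<sigma>] by metis
  then show "z \<in> orb a" by simp
qed (use Cent_pow[OF \<sigma>] in \<open>auto elim!: orbE\<close>)

lemma Cent_L: assumes \<sigma>: "\<sigma> \<in> Cent" shows "L (\<sigma> a) = L a"
proof -
  have "orb (\<sigma> a) = \<sigma> ` orb a" by (simp add: orb_def Cent_pow[OF \<sigma>] image_image)
  then show ?thesis
    using card_orb[of a] card_orb[of "\<sigma> a"] card_image[of \<sigma> "orb a"] Cent_inj[OF \<sigma>]
    by (metis inj_onI)
qed

text \<open>
  For \<open>v\<close> in the orbit of \<open>u\<close> this is a power of the cycle through \<open>u\<close>, otherwise it swaps two cycles.
\<close>

definition mv :: "'a \<Rightarrow> 'a \<Rightarrow> 'a \<Rightarrow> 'a" where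
  "mv u v z = (if z \<in> orb u then (x ^^ idx u z) v else if z \<in> orb v then (x ^^ idx v z) u else z)"

text \<open>Equal cycle lengths are what makes the image independent of the exponent chosen by
  \<open>idx\<close>.\<close>

lemma mv_l: "L u = L v \<Longrightarrow> mv u v ((x ^^ i) u) = (x ^^ i) v"
  using idx_pow[of u i] by (simp add: mv_def pow_eq_iff)

lemma mv_r: "\<lbrakk>L u = L v; v \<notin> orb u\<rbrakk> \<Longrightarrow> mv u v ((x ^^ i) v) = (x ^^ i) u"
  using idx_pow[of v i] orb_sym[of "(x ^^ i) v" u] orb_sym[of v u] by (simp add: mv_def pow_eq_iff)

lemma mv_other: "\<lbrakk>z \<notin> orb u; z \<notin> orb v\<rbrakk> \<Longrightarrow> mv u v z = z"
  by (simp add: mv_def)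

lemma mv_u [simp]: "L u = L v \<Longrightarrow> mv u v u = v"
  using mv_l[of u v 0] by simp

lemma orb_cases: obtains (l) i where "z = (x ^^ i) u"
  | (r) i where "z = (x ^^ i) v" "v \<notin> orb u" | (other) "z \<notin> orb u" "z \<notin> orb v"
  using orb_eq[of v u] by (metis orbE)

lemma mv_Cent:
  assumes L: "L u = L v" and u: "u \<in> S" and v: "v \<in> S"
  shows "mv u v \<in> Cent"
proof (rule CentI)
  show "mv u v permutes S"
  proof (rule bij_imp_permutes)
    \<comment> \<open>The cases are taken with \<open>u\<close> and \<open>v\<close> exchanged,
      because a point on the cycle of \<open>v\<close> has its preimage on the cycle of
      \<open>u\<close>.\<close>
    have "z \<in> mv u v ` S" if "z \<in> S" for z
    proof (cases rule: orb_cases[where z = z and u = v and v = u])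
      case (l i)
      then have "z = mv u v ((x ^^ i) u)" using L by (simp add: mv_l)
      then show ?thesis using pow_mem[OF u] by blast
    next
      case (r i)
      then have "z = mv u v ((x ^^ i) v)" using L orb_sym by (simp add: mv_r)
      then show ?thesis using pow_mem[OF v] by blast
    next
      case other
      then have "z = mv u v z" by (simp add: mv_other)
      then show ?thesis using that by blast
    qed
    then have sub: "S \<subseteq> mv u v ` S" by blast
    moreover have "mv u v ` S \<subseteq> S" using pow_mem u v by (auto simp: mv_def)
    ultimately have eq: "mv u v ` S = S" by blast
    then have "inj_on (mv u v) S" using finite_S by (simp add: eq_card_imp_inj_on)
    then show "bij_betw (mv u v) S S" using eq by (simp add: bij_betw_def)
    show "mv u v z = z" if "z \<notin> S" for z
      using that orb_subset[OF u] orb_subset[OF v] by (intro mv_other) auto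
  qed
  fix z assume "z \<in> S"
  show "mv u v (x z) = x (mv u v z)"
  proof (cases rule: orb_cases[where z = z and u = u and v = v])
    case (l i)
    then show ?thesis using mv_l[OF L, of "Suc i"] mv_l[OF L, of i] by simp
  next
    case (r i)
    then show ?thesis using mv_r[OF L r(2), of "Suc i"] mv_r[OF L r(2), of i] by simp
  next
    case other
    then show ?thesis by (simp add: mv_other)
  qed
qed

lemma mv_conj:
  assumes \<sigma>: "\<sigma> \<in> Cent" and L: "L u = L v"
  shows "\<sigma> \<circ> mv u v = mv (\<sigma> u) (\<sigma> v) \<circ> \<sigma>"
proof
  fix z
  have L': "L (\<sigma> u) = L (\<sigma> v)" using L Cent_L[OF \<sigma>] by simp
  show "(\<sigma> \<circ> mv u v) z = (mv (\<sigma> u) (\<sigma> v) \<circ> \<sigma>) z"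
  proof (cases rule: orb_cases[where z = z and u = u and v = v])
    case (l i)
    then show ?thesis by (simp add: mv_l[OF L] Cent_pow[OF \<sigma>] mv_l[OF L'])
  next
    case (r i)
    then show ?thesis by (simp add: mv_r[OF L] Cent_pow[OF \<sigma>] mv_r[OF L'] Cent_orb[OF \<sigma>])
  next
    case other
    then show ?thesis by (simp add: mv_other Cent_orb[OF \<sigma>])
  qed
qed

text \<open>\<open>mv u (x u)\<close> rotates the cycle of \<open>u\<close> by one step. Its powers
  are thus all the \<open>mv u v\<close> with \<open>v\<close> on that cycle, and a character on
  them is known from this single rotation.\<close>

lemma mv_pow: "mv u (x u) ^^ i = mv u ((x ^^ i) u)"
proof (induction i)
  have L: "L u = L ((x ^^ i) u)" for i using L_orb[of "(x ^^ i) u" u] by simp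
  have [simp]: "mv u ((x ^^ i) u) z = z" if "z \<notin> orb u" for i z using that by (simp add: mv_other)
  {
    case 0
    show ?case
    proof
      fix z show "(mv u (x u) ^^ 0) z = mv u ((x ^^ 0) u) z"
        using mv_l[of u u] by (cases "z \<in> orb u") (auto elim!: orbE simp: mv_other)
    qed
  next
    case (Suc i)
    show ?case
    proof
      fix z
      show "(mv u (x u) ^^ Suc i) z = mv u ((x ^^ Suc i) u) z"
      proof (cases "z \<in> orb u")
        case True
        then obtain j where z: "z = (x ^^ j) u" by (rule orbE)
        have "mv u (x u) ((x ^^ m) u) = x ((x ^^ m) u)" for m
          using mv_l[of u "x u" m] L[of 1] by (simp add: funpow_swap1)
        moreover have "mv u ((x ^^ m) u) z = (x ^^ (j + m)) u" for m
          using mv_l[OF L, of m j] z by (simp add: funpow_add)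
        ultimately show ?thesis using Suc by (simp del: funpow.simps add: funpow.simps(2)[of i "mv u (x u)"]) simp
      next
        case False
        then have "mv u w z = z" if "orb w = orb u" for w using that by (simp add: mv_other)
        then have "mv u (x u) z = z" "mv u ((x ^^ i) u) z = z" "mv u ((x ^^ Suc i) u) z = z"
          by (simp_all del: funpow.simps)
        then show ?thesis using Suc by (simp del: funpow.simps add: funpow_Suc_right[of i "mv u (x u)"])
      qed
    qed
  }
qed

text \<open>Integer representatives modulo p: sums over cycles and integer multiples can be formed
  first and reduced at the end.\<close>

definition Cent_chars :: "nat \<Rightarrow> (('a \<Rightarrow> 'a) \<Rightarrow> int) set" where
  "Cent_chars p = {f. \<forall>\<sigma>\<in>Cent. \<forall>\<tau>\<in>Cent. [f (\<sigma> \<circ> \<tau>) = f \<sigma> + f \<tau>] (mod int p)}"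

context
  fixes p :: nat and f :: "('a \<Rightarrow> 'a) \<Rightarrow> int"
  assumes p: "prime p" and f: "f \<in> Cent_chars p"
begin

lemma char_comp: "\<lbrakk>\<sigma> \<in> Cent; \<tau> \<in> Cent\<rbrakk> \<Longrightarrow> [f (\<sigma> \<circ> \<tau>) = f \<sigma> + f \<tau>] (mod int p)"
  using f by (simp add: Cent_chars_def)

lemma char_id: "[f id = 0] (mod int p)"
  using char_comp[OF Cent_id Cent_id] by (simp add: cong_iff_dvd_diff)

lemma Cent_pow_mem: "\<sigma> \<in> Cent \<Longrightarrow> \<sigma> ^^ i \<in> Cent"
  by (induction i) (auto simp: Cent_id Cent_comp)

lemma char_pow:
  assumes \<sigma>: "\<sigma> \<in> Cent" shows "[f (\<sigma> ^^ i) = int i * f \<sigma>] (mod int p)"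
proof (induction i)
  case (Suc i)
  have "[f (\<sigma> ^^ Suc i) = f \<sigma> + f (\<sigma> ^^ i)] (mod int p)"
    using char_comp[OF \<sigma> Cent_pow_mem[OF \<sigma>]] by (simp only: funpow.simps)
  also have "[f \<sigma> + f (\<sigma> ^^ i) = f \<sigma> + int i * f \<sigma>] (mod int p)"
    using Suc by (intro cong_add cong_refl)
  finally show ?case by (simp only: of_nat_Suc distrib_right mult_1_left)
qed (use char_id in \<open>simp add: id_def\<close>)

text \<open>Conjugate elements have equal images in a commutative group.\<close>

lemma char_conj:
  assumes \<sigma>: "\<sigma> \<in> Cent" and L: "L u = L v" and uv: "u \<in> S" "v \<in> S"
  shows "[f (mv u v) = f (mv (\<sigma> u) (\<sigma> v))] (mod int p)"
proof -
  have m: "mv u v \<in> Cent" "mv (\<sigma> u) (\<sigma> v) \<in> Cent"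
    using mv_Cent L uv Cent_L[OF \<sigma>] Cent_mem[OF \<sigma>] by auto
  have "[f \<sigma> + f (mv u v) = f (mv (\<sigma> u) (\<sigma> v)) + f \<sigma>] (mod int p)"
    using char_comp[OF \<sigma> m(1)] char_comp[OF m(2) \<sigma>] mv_conj[OF \<sigma> L] by (metis cong_sym cong_trans)
  then show ?thesis by (metis add.commute cong_add_lcancel)
qed

text \<open>The maps \<open>mv u v\<close> generate the centralizer, and up to conjugation a
  rotation or a swap depends only on the length of its cycles. A rotation of length prime to p has
  order prime to p, and a swap is an involution; hence only the rotations with
  \<open>p dvd L u\<close> and, for \<open>p = 2\<close>, the swaps have to be tested, one of each
  length.\<close>

lemma char_detect:
  assumes cyc: "\<And>u. \<lbrakk>u \<in> S; p dvd L u\<rbrakk> \<Longrightarrow> \<exists>b\<in>S. L b = L u \<and> [f (mv b (x b)) = 0] (mod int p)"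
    and swap: "\<And>u v. \<lbrakk>p = 2; u \<in> S; v \<in> S; L u = L v; v \<notin> orb u\<rbrakk> \<Longrightarrow>
      \<exists>b\<in>S. \<exists>b'\<in>S. L b = L u \<and> L b' = L u \<and> b' \<notin> orb b \<and> [f (mv b b') = 0] (mod int p)"
    and \<sigma>: "\<sigma> \<in> Cent"
  shows "[f \<sigma> = 0] (mod int p)"
proof -
  have prime: "prime (int p)" using p by simp
  have cyc0: "[f (mv u (x u)) = 0] (mod int p)" if u: "u \<in> S" for u
  proof (cases "p dvd L u")
    case True
    then obtain b where b: "b \<in> S" "L b = L u" "[f (mv b (x b)) = 0] (mod int p)" using cyc[OF u] by blast
    have m: "mv u b \<in> Cent" using mv_Cent b u by simp
    have Lx: "L u = L (x u)" using L_orb[of "x u" u] by simp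
    have "mv u b (x u) = x b" using Cent_commute[OF m] b by simp
    then have "[f (mv u (x u)) = f (mv b (x b))] (mod int p)"
      using char_conj[OF m Lx u] pow_mem[OF u, of 1] b by simp
    then show ?thesis using b(3) cong_trans by blast
  next
    case False
    have Lx: "L u = L (x u)" using L_orb[of "x u" u] by simp
    have m: "mv u (x u) \<in> Cent" using mv_Cent[OF Lx u] pow_mem[OF u, of 1] by simp
    \<comment> \<open>The power with exponent \<open>L u\<close> of the rotation is trivial, and
      \<open>L u\<close> is invertible modulo p.\<close>
    have "mv u u = id" using mv_pow[where u = u and i = 0] by (simp add: id_def)
    then have "[int (L u) * f (mv u (x u)) = 0] (mod int p)"
      using char_pow[OF m, of "L u"] char_id mv_pow[where u = u and i = "L u"] by (metis cong_sym cong_trans pow_L)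
    then show ?thesis using prime False by (simp add: cong_0_iff prime_dvd_mult_iff)
  qed
  have swap0: "[f (mv u v) = 0] (mod int p)"
    if u: "u \<in> S" and v: "v \<in> S" and L: "L u = L v" and o: "v \<notin> orb u" for u v
  proof (cases "p = 2")
    case True
    obtain b b' where b: "b \<in> S" "b' \<in> S" "L b = L u" "L b' = L u" "b' \<notin> orb b"
      "[f (mv b b') = 0] (mod int p)" using swap[OF True u v L o] by blast
    have m1: "mv u b \<in> Cent" using mv_Cent u b by simp
    define v1 where "v1 = mv u b v"
    have v1: "v1 \<in> S" "L v1 = L u" using Cent_mem[OF m1] Cent_L[OF m1] v L by (simp_all add: v1_def)
    have v1b: "v1 \<notin> orb b" using Cent_orb[OF m1, of v u] o b by (simp add: v1_def)
    \<comment> \<open>The first move takes \<open>u\<close> to \<open>b\<close> and \<open>v\<close>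
      to \<open>v1\<close>; this one takes \<open>v1\<close> to \<open>b'\<close> and leaves
      \<open>b\<close> in place, since \<open>b\<close> lies on the cycle of neither.\<close>
    have m2: "mv v1 b' \<in> Cent" using mv_Cent v1 b by simp
    have "mv v1 b' b = b" using v1b b(5) orb_sym by (intro mv_other) auto
    moreover have "mv v1 b' v1 = b'" using v1 b by simp
    moreover have "L b = L v1" using b v1 by simp
    ultimately have "[f (mv b v1) = f (mv b b')] (mod int p)" using char_conj[OF m2 _ b(1) v1(1)] by simp
    moreover have "[f (mv u v) = f (mv b v1)] (mod int p)"
      using char_conj[OF m1 L u v] b by (simp add: v1_def)
    ultimately show ?thesis using b(6) cong_trans by blast
  next
    case False
    have m: "mv u v \<in> Cent" using mv_Cent L u v by simp
    have "mv u v \<circ> mv u v = id"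
    proof
      fix z show "(mv u v \<circ> mv u v) z = id z"
        by (cases rule: orb_cases[where z = z and u = u and v = v]) (simp_all add: mv_l[OF L] mv_r[OF L] mv_other o)
    qed
    then have "[f (mv u v) + f (mv u v) = 0] (mod int p)"
      using char_comp[OF m m] char_id by (metis cong_sym cong_trans)
    then have "int p dvd 2 * f (mv u v)" by (simp add: cong_0_iff)
    moreover have "\<not> int p dvd 2"
      using False p primes_dvd_imp_eq two_is_prime_nat by (metis int_dvd_int_iff of_nat_numeral)
    ultimately show ?thesis using prime by (simp add: cong_0_iff prime_dvd_mult_iff)
  qed
  have mv0: "[f (mv u v) = 0] (mod int p)" if u: "u \<in> S" and v: "v \<in> S" and L: "L u = L v" for u v
  proof (cases "v \<in> orb u")
    case True
    then obtain i where i: "v = (x ^^ i) u" by (rule orbE)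
    have Lx: "L u = L (x u)" using L_orb[of "x u" u] by simp
    have m: "mv u (x u) \<in> Cent" using mv_Cent[OF Lx u] pow_mem[OF u, of 1] by simp
    have "[f (mv u v) = int i * f (mv u (x u))] (mod int p)"
      using char_pow[OF m, of i] by (simp add: mv_pow i)
    moreover have "[int i * f (mv u (x u)) = 0] (mod int p)" using cyc0[OF u] by (simp add: cong_0_iff)
    ultimately show ?thesis by (rule cong_trans)
  qed (use swap0 that in blast)
  have "finite {z \<in> S. \<sigma> z \<noteq> z}" using finite_S by simp
  then show ?thesis using \<sigma>
  proof (induction "card {z \<in> S. \<sigma> z \<noteq> z}" arbitrary: \<sigma> rule: less_induct)
    case less
    note \<sigma> = less.prems(2)
    show ?case
    proof (cases "\<exists>u\<in>S. \<sigma> u \<noteq> u")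
      case False
      then have "\<sigma> = id" using permutes_not_in[OF Cent_permutes[OF \<sigma>]] by (auto simp: fun_eq_iff)
      then show ?thesis using char_id by simp
    next
      case True
      then obtain u where u: "u \<in> S" "\<sigma> u \<noteq> u" by blast
      define v where "v = \<sigma> u"
      have v: "v \<in> S" "L v = L u" using Cent_mem[OF \<sigma>] Cent_L[OF \<sigma>] u by (simp_all add: v_def)
      have m: "mv v u \<in> Cent" using mv_Cent v u by simp
      define \<rho> where "\<rho> = mv v u \<circ> \<sigma>"
      have \<rho>: "\<rho> \<in> Cent" unfolding \<rho>_def by (rule Cent_comp[OF m \<sigma>])
      \<comment> \<open>A fixed point of \<open>\<sigma>\<close> lies neither on the cycle of
        \<open>u\<close> nor on that of \<open>\<sigma> u\<close>, for otherwise
        \<open>\<sigma>\<close> would fix \<open>u\<close>. Hence composing with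
        \<open>mv v u\<close> loses no fixed point and gains \<open>u\<close>.\<close>
      have fx: "\<rho> z = z" if z: "\<sigma> z = z" for z
      proof -
        have "z \<notin> orb u"
        proof
          assume "z \<in> orb u"
          then obtain i where i: "z = (x ^^ i) u" by (rule orbE)
          then have "(x ^^ i) v = (x ^^ i) u" using z Cent_pow[OF \<sigma>] by (simp add: v_def)
          then show False using inj_pow u(2) by (simp add: inj_eq v_def)
        qed
        moreover have "z \<notin> orb v"
        proof
          assume "z \<in> orb v"
          then obtain i where i: "z = (x ^^ i) v" by (rule orbE)
          then have "(x ^^ i) (\<sigma> v) = (x ^^ i) v" using z Cent_pow[OF \<sigma>] by simp
          then have "\<sigma> v = \<sigma> u" using inj_pow by (simp add: inj_eq v_def)
          then show False using Cent_inj[OF \<sigma>] u(2) by (simp add: v_def)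
        qed
        ultimately show ?thesis using z by (simp add: \<rho>_def mv_other)
      qed
      moreover have "\<rho> u = u" using v by (simp add: \<rho>_def v_def[symmetric])
      ultimately have "{z \<in> S. \<rho> z \<noteq> z} \<subset> {z \<in> S. \<sigma> z \<noteq> z}" using u by blast
      then have "[f \<rho> = 0] (mod int p)"
        using less.hyps[OF _ _ \<rho>] less.prems(1) by (simp add: psubset_card_mono finite_S)
      moreover have "[f \<rho> = f (mv v u) + f \<sigma>] (mod int p)"
        unfolding \<rho>_def by (rule char_comp[OF m \<sigma>])
      moreover have "[f (mv v u) = 0] (mod int p)" using mv0 v u by simp
      ultimately have "int p dvd f \<rho>" "int p dvd f \<rho> - (f (mv v u) + f \<sigma>)" "int p dvd f (mv v u)"
        by (simp_all only: cong_iff_dvd_diff diff_zero)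
      then have "int p dvd f \<rho> - (f \<rho> - (f (mv v u) + f \<sigma>)) - f (mv v u)" by (metis dvd_diff)
      then show ?thesis by (simp add: cong_0_iff)
    qed
  qed
qed

end

subsection \<open>Construction of characters\<close>

text \<open>The choice is made from the set \<open>orb z\<close>, so it depends on the cycle
  alone.\<close>

definition "rp z = (SOME w. w \<in> orb z)"

definition "reps k = {b \<in> rp ` S. L b = k}"

text \<open>The total rotation in the wreath product of Z/k by a symmetric group: representatives
  fix an origin on each cycle, and \<open>idx\<close> measures how far from the origin of its image
  cycle each origin lands. Only its class modulo \<open>k\<close> is meaningful.\<close>

definition "cyc_char k \<sigma> = (\<Sum>b\<in>reps k. int (idx (rp (\<sigma> b)) (\<sigma> b)))"

definition "rep_perm k \<sigma> b = (if b \<in> reps k then rp (\<sigma> b) else b)"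

text \<open>The sign of the permutation of the cycles of length \<open>k\<close>, written additively
  in Z/2.\<close>

definition "swap_char k \<sigma> = (if evenperm (rep_perm k \<sigma>) then 0 else 1 :: int)"

lemma rp_mem: "rp z \<in> orb z"
  unfolding rp_def by (rule someI[of _ z]) simp

lemma orb_rp [simp]: "orb (rp z) = orb z"
  by (rule orb_eq[OF rp_mem])

lemma rp_orb: "z \<in> orb a \<Longrightarrow> rp z = rp a"
  by (simp add: rp_def orb_eq)

lemma rp_idem [simp]: "rp (rp z) = rp z"
  by (rule rp_orb[OF rp_mem])

lemma rp_pow [simp]: "rp ((x ^^ i) z) = rp z"
  by (rule rp_orb) simp

lemma rp_S: "z \<in> S \<Longrightarrow> rp z \<in> S"
  by (rule subsetD[OF orb_subset rp_mem])

lemma L_rp [simp]: "L (rp z) = L z"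
  by (rule L_orb[OF rp_mem])

lemma repsD: "b \<in> reps k \<Longrightarrow> b \<in> S \<and> rp b = b \<and> L b = k"
  by (auto simp: reps_def rp_S)

lemma repsI: "z \<in> S \<Longrightarrow> rp z \<in> reps (L z)"
  by (auto simp: reps_def)

lemma reps_iff: "b \<in> reps k \<longleftrightarrow> b \<in> S \<and> rp b = b \<and> L b = k"
proof
  assume b: "b \<in> S \<and> rp b = b \<and> L b = k"
  then have "rp b \<in> reps (L b)" by (intro repsI) simp
  with b show "b \<in> reps k" by simp
qed (rule repsD)

lemma finite_reps: "finite (reps k)"
  using finite_S by (simp add: reps_def)

lemma rep_orb_eq: "\<lbrakk>rp b = b; rp b' = b'; b' \<in> orb b\<rbrakk> \<Longrightarrow> b' = b"
  using rp_orb[of b' b] by simp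

lemma idx_rp: "(x ^^ idx (rp z) z) (rp z) = z"
  by (rule idx) simp

lemma rep_perm_comp:
  assumes \<sigma>: "\<sigma> \<in> Cent" and \<tau>: "\<tau> \<in> Cent"
  shows "rep_perm k (\<sigma> \<circ> \<tau>) = rep_perm k \<sigma> \<circ> rep_perm k \<tau>"
proof
  fix b
  show "rep_perm k (\<sigma> \<circ> \<tau>) b = (rep_perm k \<sigma> \<circ> rep_perm k \<tau>) b"
  proof (cases "b \<in> reps k")
    case True
    have "rp (\<tau> b) \<in> reps k"
      using repsI[of "\<tau> b"] repsD[OF True] Cent_mem[OF \<tau>] Cent_L[OF \<tau>] by simp
    moreover have "rp (\<sigma> (\<tau> b)) = rp (\<sigma> (rp (\<tau> b)))"
      using idx_rp[of "\<tau> b"] Cent_pow[OF \<sigma>] rp_pow by metis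
    ultimately show ?thesis using True by (simp add: rep_perm_def)
  qed (simp add: rep_perm_def)
qed

lemma rep_perm_permutes:
  assumes \<sigma>: "\<sigma> \<in> Cent" shows "rep_perm k \<sigma> permutes reps k"
proof (rule bij_imp_permutes)
  have "rep_perm k \<sigma> ` reps k \<subseteq> reps k"
    using repsI repsD Cent_mem[OF \<sigma>] Cent_L[OF \<sigma>] by (force simp: rep_perm_def)
  moreover have "inj_on (rep_perm k \<sigma>) (reps k)"
  proof (rule inj_onI)
    fix b b' assume b: "b \<in> reps k" "b' \<in> reps k" "rep_perm k \<sigma> b = rep_perm k \<sigma> b'"
    then have "orb (\<sigma> b) = orb (\<sigma> b')" using orb_rp by (metis rep_perm_def)
    then have "b' \<in> orb b" using Cent_orb[OF \<sigma>, of b' b] by simp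
    then show "b = b'" using rep_orb_eq repsD b by metis
  qed
  ultimately show "bij_betw (rep_perm k \<sigma>) (reps k) (reps k)"
    using finite_reps by (simp add: bij_betw_def endo_inj_surj)
qed (simp add: rep_perm_def)

lemma permutation_rep_perm: "\<sigma> \<in> Cent \<Longrightarrow> permutation (rep_perm k \<sigma>)"
  using rep_perm_permutes finite_reps permutation_permutes by blast

lemma swap_char: "swap_char k \<in> Cent_chars 2"
  unfolding Cent_chars_def
proof (intro CollectI ballI)
  fix \<sigma> \<tau> assume "\<sigma> \<in> Cent" "\<tau> \<in> Cent"
  then have "evenperm (rep_perm k (\<sigma> \<circ> \<tau>)) \<longleftrightarrow> evenperm (rep_perm k \<sigma>) = evenperm (rep_perm k \<tau>)"
    by (simp only: rep_perm_comp evenperm_comp permutation_rep_perm)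
  then show "[swap_char k (\<sigma> \<circ> \<tau>) = swap_char k \<sigma> + swap_char k \<tau>] (mod int 2)"
    by (simp add: swap_char_def cong_def)
qed

text \<open>Rotation numbers of a composite add modulo \<open>k\<close> when the outer one is read
  at the cycle reached by the inner map. Summing over all cycles absorbs this change of index, which
  is the permutation \<open>rep_perm k \<tau>\<close>.\<close>

lemma cyc_char:
  assumes "p dvd k" shows "cyc_char k \<in> Cent_chars p"
  unfolding Cent_chars_def
proof (intro CollectI ballI)
  fix \<sigma> \<tau> assume \<sigma>: "\<sigma> \<in> Cent" and \<tau>: "\<tau> \<in> Cent"
  let ?a = "\<lambda>\<sigma> b. int (idx (rp (\<sigma> b)) (\<sigma> b))"
  have "[?a (\<sigma> \<circ> \<tau>) b = ?a \<sigma> (rep_perm k \<tau> b) + ?a \<tau> b] (mod int p)" if b: "b \<in> reps k" for b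
  proof -
    let ?b = "rp (\<tau> b)" and ?i = "idx (rp (\<tau> b)) (\<tau> b)"
    let ?c = "rp (\<sigma> ?b)" and ?j = "idx (rp (\<sigma> ?b)) (\<sigma> ?b)"
    have "\<sigma> (\<tau> b) = (x ^^ ?i) (\<sigma> ?b)" using idx_rp[of "\<tau> b"] Cent_pow[OF \<sigma>] by metis
    also have "\<sigma> ?b = (x ^^ ?j) ?c" using idx_rp[of "\<sigma> ?b"] by simp
    finally have *: "\<sigma> (\<tau> b) = (x ^^ (?i + ?j)) ?c" by (simp add: funpow_add)
    then have c: "rp (\<sigma> (\<tau> b)) = ?c" by simp
    have Lc: "L ?c = k" using repsD[OF b] Cent_L[OF \<sigma>] Cent_L[OF \<tau>] by simp
    have "idx ?c (\<sigma> (\<tau> b)) mod k = (?i + ?j) mod k"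
      using idx_pow[of ?c "?i + ?j"] * Lc by simp
    then have "[idx ?c (\<sigma> (\<tau> b)) = ?i + ?j] (mod p)"
      using assms unfolding cong_def[symmetric] by (rule cong_dvd_modulus_nat)
    then have "[int (idx ?c (\<sigma> (\<tau> b))) = int (?i + ?j)] (mod int p)" by (simp only: cong_int_iff)
    then show ?thesis using b c by (simp add: rep_perm_def add.commute)
  qed
  then have "[cyc_char k (\<sigma> \<circ> \<tau>) = (\<Sum>b\<in>reps k. ?a \<sigma> (rep_perm k \<tau> b) + ?a \<tau> b)] (mod int p)"
    unfolding cyc_char_def by (rule cong_sum)
  also have "(\<Sum>b\<in>reps k. ?a \<sigma> (rep_perm k \<tau> b) + ?a \<tau> b) = cyc_char k \<sigma> + cyc_char k \<tau>"
    using sum.permute[OF rep_perm_permutes[OF \<tau>], of "?a \<sigma>" k]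
    by (simp add: sum.distrib cyc_char_def comp_def)
  finally show "[cyc_char k (\<sigma> \<circ> \<tau>) = cyc_char k \<sigma> + cyc_char k \<tau>] (mod int p)" .
qed

lemma mv_cycle_apply: "mv u (x u) z = (if z \<in> orb u then x z else z)"
proof (cases "z \<in> orb u")
  case True
  then obtain j where z: "z = (x ^^ j) u" by (rule orbE)
  then show ?thesis using mv_l[of u "x u" j] L_orb[of "x u" u] by (simp add: funpow_swap1)
qed (simp add: mv_other)

lemma rep_perm_mv_cycle: "rep_perm k (mv u (x u)) = id"
proof
  fix b show "rep_perm k (mv u (x u)) b = id b"
    using repsD[of b k] rp_pow[of 1 b] by (simp add: rep_perm_def mv_cycle_apply)
qed

lemma swap_char_cycle: "swap_char k (mv u (x u)) = 0"
  by (simp add: swap_char_def rep_perm_mv_cycle)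

text \<open>The exponent chosen by \<open>idx b b\<close> may be any multiple of \<open>L b\<close>,
  so only its vanishing modulo a divisor of \<open>L b\<close> can be claimed.\<close>

lemma idx_rp_self: "p dvd L b \<Longrightarrow> [int (idx b b) = 0] (mod int p)"
proof -
  assume p: "p dvd L b"
  have "L b dvd idx b b" using idx_pow[of b 0] by (simp add: dvd_eq_mod_eq_0)
  with p have "p dvd idx b b" by (rule dvd_trans)
  then show ?thesis by (simp add: cong_0_iff)
qed

text \<open>Of the origins only the one on the cycle of \<open>u\<close> moves, and it moves by one
  step.\<close>

lemma cyc_char_cycle:
  assumes p: "p dvd k" and u: "u \<in> S"
  shows "[cyc_char k (mv u (x u)) = (if L u = k then 1 else 0)] (mod int p)"
proof -
  have "[int (idx (rp (mv u (x u) b)) (mv u (x u) b)) = (if b = rp u then 1 else 0)] (mod int p)"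
    if b: "b \<in> reps k" for b
  proof (cases "b \<in> orb u")
    case True
    then have bu: "b = rp u" using rp_orb repsD[OF b] by metis
    have "rp (x b) = b" using rp_pow[of 1 b] repsD[OF b] by simp
    moreover have "[idx b (x b) = 1] (mod p)"
    proof (rule cong_dvd_modulus_nat[OF _ p])
      show "[idx b (x b) = 1] (mod k)" using idx_pow[of b 1] repsD[OF b] by (simp add: cong_def)
    qed
    then have "[int (idx b (x b)) = 1] (mod int p)" using cong_int_iff[of "idx b (x b)" 1 p] by simp
    ultimately show ?thesis using True bu by (simp add: mv_cycle_apply)
  next
    case False
    then have "b \<noteq> rp u" using rp_mem by metis
    then show ?thesis using False repsD[OF b] p idx_rp_self[of p b] by (simp add: mv_cycle_apply)
  qed
  then have "[cyc_char k (mv u (x u)) = (\<Sum>b\<in>reps k. if b = rp u then 1 else 0)] (mod int p)"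
    unfolding cyc_char_def by (rule cong_sum)
  moreover have "(\<Sum>b\<in>reps k. if b = rp u then 1 else 0) = (if L u = k then 1 else 0 :: int)"
    using finite_reps rp_S[OF u] by (simp add: reps_iff)
  ultimately show ?thesis by simp
qed

lemma mv_swap_rep:
  assumes "b \<in> reps l" "b' \<in> reps l" "b \<noteq> b'" "c \<in> reps k"
  shows "mv b b' c = transpose b b' c"
proof -
  note r = repsD[OF assms(1)] repsD[OF assms(2)] repsD[OF assms(4)]
  have L: "L b = L b'" using r by simp
  have o: "b' \<notin> orb b" using rep_orb_eq[of b b'] r assms(3) by auto
  have "c \<notin> orb b" if "c \<noteq> b" using rep_orb_eq[of b c] r that by auto
  moreover have "c \<notin> orb b'" if "c \<noteq> b'" using rep_orb_eq[of b' c] r that by auto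
  moreover have "mv b b' b' = b" using mv_r[OF L o, of 0] by simp
  ultimately show ?thesis using L by (auto simp: transpose_def mv_other)
qed

text \<open>Because the swap is taken at origins, it permutes the origins and no rotation is
  recorded.\<close>

lemma cyc_char_swap:
  assumes p: "p dvd k" and b: "b \<in> reps l" "b' \<in> reps l" "b \<noteq> b'"
  shows "[cyc_char k (mv b b') = 0] (mod int p)"
proof -
  have "[int (idx (rp (mv b b' c)) (mv b b' c)) = 0] (mod int p)" if c: "c \<in> reps k" for c
  proof -
    have m: "mv b b' \<in> Cent" using repsD[OF b(1)] repsD[OF b(2)] by (intro mv_Cent) simp_all
    have "rp (transpose b b' c) = transpose b b' c"
      using repsD[OF c] repsD[OF b(1)] repsD[OF b(2)] by (simp add: transpose_def)
    then have "rp (mv b b' c) = mv b b' c" by (simp only: mv_swap_rep[OF b c])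
    moreover have "p dvd L (mv b b' c)" using Cent_L[OF m] repsD[OF c] p by simp
    ultimately show ?thesis using idx_rp_self by simp
  qed
  then have "[cyc_char k (mv b b') = (\<Sum>c\<in>reps k. 0)] (mod int p)"
    unfolding cyc_char_def by (rule cong_sum)
  then show ?thesis by simp
qed

lemma swap_char_swap:
  assumes b: "b \<in> reps l" "b' \<in> reps l" "b \<noteq> b'"
  shows "swap_char k (mv b b') = (if k = l then 1 else 0)"
proof -
  have "rep_perm k (mv b b') c = (if k = l then transpose b b' c else c)" for c
  proof (cases "c \<in> reps k")
    case True
    have "rp (transpose b b' c) = transpose b b' c"
      using repsD[OF True] repsD[OF b(1)] repsD[OF b(2)] by (auto simp: transpose_def)
    moreover have "transpose b b' c = c" if "k \<noteq> l"
      using that repsD[OF True] repsD[OF b(1)] repsD[OF b(2)] by (intro transpose_apply_other) auto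
    ultimately show ?thesis using True mv_swap_rep[OF b True] by (simp add: rep_perm_def)
  next
    case False
    then show ?thesis using b by (auto simp: rep_perm_def transpose_def)
  qed
  then have "rep_perm k (mv b b') = (if k = l then transpose b b' else id)" by (simp add: fun_eq_iff)
  then show ?thesis using b(3) by (simp add: swap_char_def evenperm_swap)
qed

end

section \<open>Characters with prescribed values\<close>

context fin_perm
begin

lemma Cent_chars_add: "\<lbrakk>f \<in> Cent_chars p; g \<in> Cent_chars p\<rbrakk> \<Longrightarrow> (\<lambda>\<sigma>. f \<sigma> + g \<sigma>) \<in> Cent_chars p"
proof -
  assume f: "f \<in> Cent_chars p" and g: "g \<in> Cent_chars p"
  show ?thesis
    unfolding Cent_chars_def
  proof (intro CollectI ballI)
    fix \<sigma> \<tau> assume "\<sigma> \<in> Cent" "\<tau> \<in> Cent"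
    then have "[f (\<sigma> \<circ> \<tau>) + g (\<sigma> \<circ> \<tau>) = (f \<sigma> + f \<tau>) + (g \<sigma> + g \<tau>)] (mod int p)"
      using f g unfolding Cent_chars_def by (intro cong_add) blast+
    then show "[f (\<sigma> \<circ> \<tau>) + g (\<sigma> \<circ> \<tau>) = f \<sigma> + g \<sigma> + (f \<tau> + g \<tau>)] (mod int p)"
      by (simp add: algebra_simps)
  qed
qed

lemma Cent_chars_mult: "f \<in> Cent_chars p \<Longrightarrow> (\<lambda>\<sigma>. z * f \<sigma>) \<in> Cent_chars p"
  unfolding Cent_chars_def
proof (intro CollectI ballI)
  fix \<sigma> \<tau> assume f: "f \<in> {f. \<forall>\<sigma>\<in>Cent. \<forall>\<tau>\<in>Cent. [f (\<sigma> \<circ> \<tau>) = f \<sigma> + f \<tau>] (mod int p)}"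
    "\<sigma> \<in> Cent" "\<tau> \<in> Cent"
  then have "[z * f (\<sigma> \<circ> \<tau>) = z * (f \<sigma> + f \<tau>)] (mod int p)" by (intro cong_mult cong_refl) blast
  then show "[z * f (\<sigma> \<circ> \<tau>) = z * f \<sigma> + z * f \<tau>] (mod int p)" by (simp add: algebra_simps)
qed

lemma Cent_chars_zero: "(\<lambda>\<sigma>. 0) \<in> Cent_chars p"
  by (simp add: Cent_chars_def)

lemma Cent_chars_sum:
  "\<lbrakk>finite K; \<And>k. k \<in> K \<Longrightarrow> f k \<in> Cent_chars p\<rbrakk> \<Longrightarrow> (\<lambda>\<sigma>. \<Sum>k\<in>K. f k \<sigma>) \<in> Cent_chars p"
  by (induction K rule: finite_induct) (simp_all add: Cent_chars_zero Cent_chars_add)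

text \<open>The basic characters are dual to the test elements: \<open>cyc_char k\<close> sees only
  rotations of length \<open>k\<close>, \<open>swap_char k\<close> only swaps of cycles of length
  \<open>k\<close>. A combination with the prescribed values as coefficients therefore takes these
  values.\<close>

lemma char_exist:
  assumes K: "finite K"
  shows "\<exists>f\<in>Cent_chars p.
    (\<forall>u\<in>S. L u \<in> K \<longrightarrow> p dvd L u \<longrightarrow> [f (mv u (x u)) = wc (L u)] (mod int p)) \<and>
    (p = 2 \<longrightarrow> (\<forall>k\<in>K. \<forall>b\<in>reps k. \<forall>b'\<in>reps k. b \<noteq> b' \<longrightarrow> [f (mv b b') = ws k] (mod int p)))"
proof -
  \<comment> \<open>The rotation number is defined modulo \<open>k\<close>, so it gives a character
    modulo p through \<open>cyc_char\<close> only for the lengths kept here.\<close>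
  define K' where "K' = {k \<in> K. p dvd k}"
  have K': "finite K'" "\<And>k. k \<in> K' \<Longrightarrow> p dvd k" using K by (auto simp: K'_def)
  define c where "c \<sigma> = (\<Sum>k\<in>K'. wc k * cyc_char k \<sigma>)" for \<sigma>
  define s where "s \<sigma> = (if p = 2 then \<Sum>k\<in>K. ws k * swap_char k \<sigma> else 0)" for \<sigma>
  have "c \<in> Cent_chars p"
    unfolding c_def[abs_def] using K' by (intro Cent_chars_sum Cent_chars_mult cyc_char) auto
  moreover have "s \<in> Cent_chars p"
  proof (cases "p = 2")
    case True
    then have "s = (\<lambda>\<sigma>. \<Sum>k\<in>K. ws k * swap_char k \<sigma>)" by (simp add: s_def fun_eq_iff)
    then show ?thesis using True K by (simp add: Cent_chars_sum Cent_chars_mult swap_char)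
  next
    case False
    then have "s = (\<lambda>\<sigma>. 0)" by (simp add: s_def fun_eq_iff)
    then show ?thesis by (simp add: Cent_chars_zero)
  qed
  ultimately have "(\<lambda>\<sigma>. c \<sigma> + s \<sigma>) \<in> Cent_chars p" by (rule Cent_chars_add)
  moreover have "[c (mv u (x u)) + s (mv u (x u)) = wc (L u)] (mod int p)"
    if u: "u \<in> S" "L u \<in> K" "p dvd L u" for u
  proof -
    have "[c (mv u (x u)) = (\<Sum>k\<in>K'. wc k * (if L u = k then 1 else 0))] (mod int p)"
      unfolding c_def using u K' by (intro cong_sum cong_mult cong_refl cyc_char_cycle) auto
    also have "(\<Sum>k\<in>K'. wc k * (if L u = k then 1 else 0)) = (\<Sum>k\<in>K'. if L u = k then wc k else 0)"
      by (rule sum.cong) auto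
    also have "\<dots> = wc (L u)" using u K'(1) by (simp add: K'_def)
    finally have "[c (mv u (x u)) = wc (L u)] (mod int p)" .
    moreover have "s (mv u (x u)) = 0" by (simp add: s_def swap_char_cycle)
    ultimately show ?thesis by simp
  qed
  moreover have "[c (mv b b') + s (mv b b') = ws k] (mod int p)"
    if "p = 2" "k \<in> K" "b \<in> reps k" "b' \<in> reps k" "b \<noteq> b'" for k b b'
  proof -
    have "[c (mv b b') = (\<Sum>k\<in>K'. wc k * 0)] (mod int p)"
      unfolding c_def using K' that by (intro cong_sum cong_mult cong_refl cyc_char_swap) auto
    moreover have "s (mv b b') = (\<Sum>l\<in>K. ws l * (if l = k then 1 else 0))"
      using that by (simp add: s_def swap_char_swap)
    moreover have "\<dots> = (\<Sum>l\<in>K. if l = k then ws l else 0)" by (rule sum.cong) auto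
    moreover have "\<dots> = ws k" using K that by simp
    ultimately show ?thesis using cong_add[of "c (mv b b')" 0 "int p" "s (mv b b')" "ws k"] by simp
  qed
  ultimately show ?thesis by (intro bexI[of _ "\<lambda>\<sigma>. c \<sigma> + s \<sigma>"]) simp_all
qed

lemma card_points: "card {z \<in> S. L z = k} = k * card (reps k)"
proof -
  have "{z \<in> S. L z = k} = (\<Union>b\<in>reps k. orb b)"
  proof (intro equalityI subsetI)
    fix z assume "z \<in> {z \<in> S. L z = k}"
    then have "rp z \<in> reps k" "z \<in> orb (rp z)" using repsI by auto
    then show "z \<in> (\<Union>b\<in>reps k. orb b)" by blast
  next
    fix z assume "z \<in> (\<Union>b\<in>reps k. orb b)"
    then obtain b where b: "b \<in> reps k" "z \<in> orb b" by blast
    then show "z \<in> {z \<in> S. L z = k}" using repsD[OF b(1)] L_orb[OF b(2)] orb_subset[of b] by auto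
  qed
  also have "card \<dots> = (\<Sum>b\<in>reps k. card (orb b))"
  proof (rule card_UN_disjoint)
    show "\<forall>b\<in>reps k. finite (orb b)"
      using repsD orb_subset finite_S finite_subset by meson
    show "\<forall>b\<in>reps k. \<forall>b'\<in>reps k. b \<noteq> b' \<longrightarrow> orb b \<inter> orb b' = {}"
    proof (intro ballI impI)
      fix b b' assume b: "b \<in> reps k" "b' \<in> reps k" "b \<noteq> b'"
      show "orb b \<inter> orb b' = {}"
      proof (rule ccontr)
        assume "orb b \<inter> orb b' \<noteq> {}"
        then obtain z where "z \<in> orb b" "z \<in> orb b'" by blast
        then have "rp b = rp b'" using rp_orb by metis
        then show False using b repsD by metis
      qed
    qed
  qed (rule finite_reps)
  also have "\<dots> = (\<Sum>b\<in>reps k. k)" using card_orb repsD by (intro sum.cong) auto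
  finally show ?thesis by simp
qed

subsection \<open>Cycle types\<close>

text \<open>Counting points instead of cycles makes the invariance under conjugation immediate.\<close>

definition has_type :: "nat multiset \<Rightarrow> bool" where
  "has_type l \<longleftrightarrow> 0 \<notin># l \<and> (\<forall>k. card {z \<in> S. L z = k} = k * count l k)"

lemma has_type_count: "has_type l \<Longrightarrow> count l k = card (reps k)"
proof (cases "k = 0")
  case True
  have "reps 0 = {}" using repsD L_pos by (metis equals0I less_irrefl)
  then show "has_type l \<Longrightarrow> ?thesis" using True by (simp add: has_type_def not_in_iff)
next
  case False
  assume "has_type l"
  then have "k * card (reps k) = k * count l k" by (simp add: has_type_def flip: card_points)
  with False show ?thesis by simp
qed

lemma has_type_exists: "\<exists>l\<in>partitions (card S). has_type l"
proof -
  define l where "l = image_mset L (mset_set (rp ` S))"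
  have fin: "finite (rp ` S)" using finite_S by simp
  have count: "count l k = card (reps k)" for k
  proof -
    have "L -` {k} \<inter> rp ` S = reps k" by (auto simp: reps_def)
    then have "count l k = (\<Sum>b\<in>reps k. count (mset_set (rp ` S)) b)"
      using fin by (simp add: l_def count_image_mset)
    also have "\<dots> = (\<Sum>b\<in>reps k. 1)" using fin by (intro sum.cong) (auto simp: reps_def)
    finally show ?thesis by simp
  qed
  have mem: "\<exists>b\<in>S. L b = k" if "k \<in># l" for k
    using that fin rp_S by (auto simp: l_def)
  have pos: "1 \<le> k" if "k \<in># l" for k
    using mem[OF that] L_pos Suc_le_eq by auto
  have "sum_mset l = (\<Sum>b\<in>rp ` S. card (orb b))"
    by (simp add: l_def card_orb sum_unfold_sum_mset)
  also have "\<dots> = card (\<Union>b\<in>rp ` S. orb b)"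
  proof (rule card_UN_disjoint[symmetric, OF fin])
    show "\<forall>b\<in>rp ` S. finite (orb b)"
      using rp_S orb_subset finite_S finite_subset by (metis imageE)
    show "\<forall>b\<in>rp ` S. \<forall>b'\<in>rp ` S. b \<noteq> b' \<longrightarrow> orb b \<inter> orb b' = {}"
    proof (intro ballI impI)
      fix b b' assume b: "b \<in> rp ` S" "b' \<in> rp ` S" "b \<noteq> b'"
      show "orb b \<inter> orb b' = {}"
      proof (rule ccontr)
        assume "orb b \<inter> orb b' \<noteq> {}"
        then obtain z where "z \<in> orb b" "z \<in> orb b'" by blast
        then have "rp b = rp b'" using rp_orb by metis
        then show False using b by auto
      qed
    qed
  qed
  also have "(\<Union>b\<in>rp ` S. orb b) = S"
  proof (intro equalityI subsetI)
    fix z assume "z \<in> (\<Union>b\<in>rp ` S. orb b)"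
    then show "z \<in> S" using orb_subset by auto
  qed auto
  finally have "l \<in> partitions (card S)" using pos by (simp add: partitions_def)
  moreover have "has_type l"
    using pos[of 0] by (auto simp: has_type_def count card_points)
  ultimately show ?thesis by blast
qed

end

lemma has_type_unique:
  assumes "fin_perm S x" "fin_perm S y" "fin_perm.has_type S x l" "fin_perm.has_type S y l'"
    and \<theta>: "\<theta> permutes S" and conj: "\<And>z. \<theta> (y z) = x (\<theta> z)"
  shows "l = l'"
proof -
  interpret X: fin_perm S x by fact
  interpret Y: fin_perm S y by fact
  have pow: "\<theta> ((y ^^ i) z) = (x ^^ i) (\<theta> z)" for i z by (induction i) (simp_all add: conj)
  have L: "least_power x (\<theta> z) = least_power y z" for z
    unfolding least_power_def pow[symmetric] by (simp add: inj_eq[OF permutes_inj[OF \<theta>]])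
  have "card {z \<in> S. least_power x z = k} = card {z \<in> S. least_power y z = k}" for k
  proof (rule bij_betw_same_card[OF bij_betw_imageI, symmetric])
    show "inj_on \<theta> {z \<in> S. least_power y z = k}" using permutes_inj[OF \<theta>] by (rule inj_on_subset) simp
    show "\<theta> ` {z \<in> S. least_power y z = k} = {z \<in> S. least_power x z = k}"
    proof (intro equalityI subsetI)
      fix z assume z: "z \<in> {z \<in> S. least_power x z = k}"
      then obtain w where w: "w \<in> S" "z = \<theta> w" using permutes_image[OF \<theta>] by blast
      with z L show "z \<in> \<theta> ` {z \<in> S. least_power y z = k}" by auto
    qed (auto simp: L permutes_in_image[OF \<theta>])
  qed
  then have "k * count l k = k * count l' k" for k
    using assms(3,4) unfolding X.has_type_def Y.has_type_def by metis
  \<comment> \<open>The factor \<open>k\<close> hides the multiplicity of 0, which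
    \<open>has_type\<close> excludes separately.\<close>
  moreover have "count l 0 = count l' 0"
    using assms(3,4) unfolding X.has_type_def Y.has_type_def by (simp add: not_in_iff)
  ultimately have "count l k = count l' k" for k by (cases "k = 0") auto
  then show ?thesis by (simp add: multiset_eq_iff)
qed

text \<open>Both permutations have equally many cycles of each length. A bijection between the
  origins of the cycles extends equivariantly along them.\<close>

lemma has_type_conjugate:
  assumes "fin_perm S x" "fin_perm S y" "fin_perm.has_type S x l" "fin_perm.has_type S y l"
  shows "\<exists>\<theta>. \<theta> permutes S \<and> (\<forall>z. \<theta> (x z) = y (\<theta> z))"
proof -
  interpret X: fin_perm S x by fact
  interpret Y: fin_perm S y by fact
  have "\<exists>h. bij_betw h (X.reps k) (Y.reps k)" for k
    using X.has_type_count[OF assms(3), of k] Y.has_type_count[OF assms(4), of k]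
    by (intro finite_same_card_bij X.finite_reps Y.finite_reps) simp
  then obtain h where h: "\<And>k. bij_betw (h k) (X.reps k) (Y.reps k)" by metis
  define \<beta> where "\<beta> z = h (least_power x z) (X.rp z)" for z
  have \<beta>: "\<beta> z \<in> Y.reps (least_power x z)" if "z \<in> S" for z
    using bij_betwE[OF h] X.repsI[OF that] by (simp add: \<beta>_def)
  define \<theta> where "\<theta> z = (if z \<in> S then (y ^^ X.idx (X.rp z) z) (\<beta> z) else z)" for z
  have \<theta>S: "\<theta> z \<in> S" if "z \<in> S" for z
    using that Y.pow_mem Y.repsD[OF \<beta>[OF that]] by (simp add: \<theta>_def)
  \<comment> \<open>The exponent chosen by \<open>idx\<close> is correct modulo the length of the
    cycle in \<open>x\<close>, which is also the length of the cycle of \<open>\<beta> b\<close> in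
    \<open>y\<close>.\<close>
  have key: "\<theta> ((x ^^ i) b) = (y ^^ i) (\<beta> b)" if b: "b \<in> S" "X.rp b = b" for i b
  proof -
    have "least_power x ((x ^^ i) b) = least_power x b" by (rule X.L_orb) simp
    then have "\<beta> ((x ^^ i) b) = \<beta> b" by (simp add: \<beta>_def)
    moreover have "least_power y (\<beta> b) = least_power x b" using Y.repsD[OF \<beta>[OF b(1)]] by simp
    ultimately show ?thesis
      using X.pow_mem[OF b(1)] X.idx_pow[of b i] b by (simp add: \<theta>_def Y.pow_eq_iff)
  qed
  have rep: "z = (x ^^ X.idx (X.rp z) z) (X.rp z)" for z using X.idx_rp[of z] by simp
  have comm: "\<theta> (x z) = y (\<theta> z)" if z: "z \<in> S" for z
  proof -
    have b: "X.rp z \<in> S" "X.rp (X.rp z) = X.rp z" using X.rp_S[OF z] by simp_all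
    let ?i = "X.idx (X.rp z) z"
    have "\<theta> (x z) = \<theta> ((x ^^ Suc ?i) (X.rp z))" using rep[of z] by simp
    also have "\<dots> = y ((y ^^ ?i) (\<beta> (X.rp z)))" unfolding key[OF b] by simp
    also have "(y ^^ ?i) (\<beta> (X.rp z)) = \<theta> z" using key[OF b, of ?i] rep[of z] by simp
    finally show ?thesis .
  qed
  have "z \<in> \<theta> ` S" if z: "z \<in> S" for z
  proof -
    have "Y.rp z \<in> h (least_power y z) ` X.reps (least_power y z)"
      using h[of "least_power y z"] Y.repsI[OF z] by (simp add: bij_betw_def)
    then obtain b where b: "b \<in> X.reps (least_power y z)" "Y.rp z = h (least_power y z) b" by blast
    then have "\<beta> b = Y.rp z" using X.repsD[OF b(1)] by (simp add: \<beta>_def)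
    then have "\<theta> ((x ^^ Y.idx (Y.rp z) z) b) = z"
      using key[of b] X.repsD[OF b(1)] Y.idx_rp[of z] by simp
    then show ?thesis using X.pow_mem[of b] X.repsD[OF b(1)] by (intro image_eqI[of _ _ "(x ^^ Y.idx (Y.rp z) z) b"]) simp_all
  qed
  then have surj: "\<theta> ` S = S" using \<theta>S by auto
  then have "bij_betw \<theta> S S"
    using X.finite_S by (simp add: bij_betw_def eq_card_imp_inj_on)
  then have "\<theta> permutes S" by (rule bij_imp_permutes) (simp add: \<theta>_def)
  moreover have "\<theta> (x z) = y (\<theta> z)" for z
  proof (cases "z \<in> S")
    case False
    then show ?thesis
      using permutes_not_in[OF X.x] permutes_not_in[OF Y.x] by (simp add: \<theta>_def)
  qed (rule comm)
  ultimately show ?thesis by blast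
qed

section \<open>Permutations with a prescribed cycle type\<close>

lemma ex_cycle_on:
  assumes "finite T"
  shows "\<exists>c. c permutes T \<and> (\<forall>z\<in>T. least_power c z = card T)"
proof -
  define k where "k = card T"
  obtain h where h: "bij_betw h {0..<k} T" using ex_bij_betw_nat_finite[OF assms] k_def by blast
  have inj: "h i = h j \<longleftrightarrow> i = j" if "i < k" "j < k" for i j
    using h that by (auto simp: bij_betw_def inj_on_def)
  define g where "g = the_inv_into {0..<k} h"
  have g: "g (h j) = j" if "j < k" for j
    unfolding g_def using h that by (intro the_inv_into_f_f) (auto simp: bij_betw_def)
  have T: "\<exists>j<k. z = h j" if "z \<in> T" for z using h that by (auto simp: bij_betw_def)
  have hT: "h j \<in> T" if "j < k" for j using h that by (auto simp: bij_betw_def)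
  \<comment> \<open>Adding one modulo \<open>k\<close>, transported along an enumeration of
    \<open>T\<close>.\<close>
  define c where "c z = (if z \<in> T then h ((g z + 1) mod k) else z)" for z
  have ch: "c (h j) = h ((j + 1) mod k)" if "j < k" for j using that by (simp add: c_def hT g)
  have pow: "(c ^^ i) (h j) = h ((j + i) mod k)" if "j < k" for i j
  proof (induction i)
    case (Suc i)
    have "(j + i) mod k < k" using that by simp
    then show ?case using Suc by (simp add: ch mod_Suc_eq)
  qed (use that in simp)
  have "z \<in> c ` T" if z: "z \<in> T" for z
  proof -
    obtain j where j: "j < k" "z = h j" using T[OF z] by blast
    \<comment> \<open>The predecessor modulo \<open>k\<close> is reached by adding
      \<open>k - 1\<close>, which avoids truncated subtraction at 0.\<close>
    have "(j + (k - 1)) mod k < k" using j by simp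
    moreover have "((j + (k - 1)) mod k + 1) mod k = j"
    proof -
      have "((j + (k - 1)) mod k + 1) mod k = (j + (k - 1) + 1) mod k" by (rule mod_add_left_eq)
      also have "\<dots> = (j + k) mod k" using j by simp
      finally show ?thesis using j by simp
    qed
    ultimately have "z = c (h ((j + (k - 1)) mod k))" using ch j by metis
    then show ?thesis using hT \<open>(j + (k - 1)) mod k < k\<close> by blast
  qed
  moreover have "c z \<in> T" if "z \<in> T" for z using T[OF that] ch hT by auto
  ultimately have surj: "c ` T = T" by blast
  then have "bij_betw c T T" using assms by (simp add: bij_betw_def eq_card_imp_inj_on)
  then have "c permutes T" by (rule bij_imp_permutes) (simp add: c_def)
  moreover have "least_power c z = card T" if z: "z \<in> T" for z
  proof -
    obtain j where j: "j < k" "z = h j" using T[OF z] by blast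
    have iff: "(c ^^ i) z = z \<longleftrightarrow> k dvd i" for i
    proof -
      have "(c ^^ i) z = z \<longleftrightarrow> (j + i) mod k = j mod k" using j inj[of "(j + i) mod k" j] by (simp add: pow)
      also have "\<dots> \<longleftrightarrow> k dvd i" using mod_eq_dvd_iff_nat[of j "j + i" k] by simp
      finally show ?thesis .
    qed
    show ?thesis
      unfolding least_power_def iff k_def[symmetric] using j
      by (intro Least_equality) (auto intro: dvd_imp_le)
  qed
  ultimately show ?thesis by blast
qed

text \<open>Induction on the type: a cycle on a subset of size \<open>k\<close> is combined with a
  permutation of the remaining points. The supports are disjoint, so the least powers of the two
  pieces are preserved.\<close>

lemma ex_perm_of_type:
  assumes "finite S" "0 \<notin># l" "sum_mset l = card S"
  shows "\<exists>x. fin_perm S x \<and> fin_perm.has_type S x l"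
proof -
  have "\<exists>x. x permutes S \<and> (\<forall>k. card {z \<in> S. least_power x z = k} = k * count l k)"
    using assms
  proof (induction l arbitrary: S)
    case empty
    then show ?case by (auto simp: permutes_empty)
  next
    case (add k l)
    then have "k \<le> card S" by simp
    then obtain T where T: "T \<subseteq> S" "card T = k" "finite T" using obtain_subset_with_card_n by metis
    have "card (S - T) = sum_mset l" using add T by (simp add: card_Diff_subset)
    then obtain y where y: "y permutes (S - T)"
      "\<And>i. card {z \<in> S - T. least_power y z = i} = i * count l i"
      using add.IH[of "S - T"] add.prems by auto
    obtain c where c: "c permutes T" "\<forall>z\<in>T. least_power c z = k" using ex_cycle_on[OF T(3)] T(2) by blast
    have cT: "(c \<circ> y) z = c z" if "z \<in> T" for z using permutes_not_in[OF y(1)] that by simp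
    have yT: "(c \<circ> y) z = y z" if "z \<in> S - T" for z
      using permutes_not_in[OF c(1)] permutes_in_image[OF y(1), of z] that by auto
    have powT: "((c \<circ> y) ^^ i) z = (c ^^ i) z \<and> (c ^^ i) z \<in> T" if "z \<in> T" for i z
      using that by (induction i) (auto simp: cT[unfolded comp_apply] permutes_in_image[OF c(1)])
    have powS: "((c \<circ> y) ^^ i) z = (y ^^ i) z \<and> (y ^^ i) z \<in> S - T" if "z \<in> S - T" for i z
    proof (induction i)
      case (Suc i)
      then show ?case using yT[of "(y ^^ i) z"] permutes_in_image[OF y(1), of "(y ^^ i) z"] by simp
    qed (use that in simp)
    have perm: "c \<circ> y permutes S"
      using permutes_subset[OF c(1) T(1)] permutes_subset[OF y(1)] by (intro permutes_compose) auto
    have LT: "least_power (c \<circ> y) z = k" if "z \<in> T" for z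
      using c(2) that powT[OF that] by (simp add: least_power_def)
    have LS: "least_power (c \<circ> y) z = least_power y z" if "z \<in> S - T" for z
      using powS[OF that] by (simp add: least_power_def)
    have "card {z \<in> S. least_power (c \<circ> y) z = i} = i * count (add_mset k l) i" for i
    proof -
      have "{z \<in> S. least_power (c \<circ> y) z = i} =
          (if i = k then T else {}) \<union> {z \<in> S - T. least_power y z = i}"
      proof (rule Set.set_eqI)
        fix z show "z \<in> {z \<in> S. least_power (c \<circ> y) z = i} \<longleftrightarrow>
            z \<in> (if i = k then T else {}) \<union> {z \<in> S - T. least_power y z = i}"
          using LT[of z] LS[of z] T(1) by (cases "z \<in> T") auto
      qed
      also have "card \<dots> = (if i = k then k else 0) + i * count l i"
        using T add.prems(1) by (subst card_Un_disjoint) (auto simp: y(2)[simplified])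
      finally show ?thesis by simp
    qed
    with perm show ?case by blast
  qed
  then obtain x where xS: "x permutes S" "\<forall>k. card {z \<in> S. least_power x z = k} = k * count l k" by blast
  interpret fin_perm S x by unfold_locales (use assms xS in auto)
  show ?thesis using xS assms fin_perm_axioms by (auto simp: has_type_def)
qed

section \<open>Counting parts of partitions\<close>

lemma part_le: "\<lbrakk>l \<in> partitions n; k \<in># l\<rbrakk> \<Longrightarrow> 1 \<le> k \<and> k \<le> n"
  by (auto simp: partitions_def dest: multi_member_split)

lemma finite_partitions: "finite (partitions n)"
proof (rule finite_subset)
  show "partitions n \<subseteq> mset ` {xs. set xs \<subseteq> {..n} \<and> length xs \<le> n}"
  proof
    fix l assume l: "l \<in> partitions n"
    obtain xs where xs: "l = mset xs" using ex_mset by metis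
    \<comment> \<open>Every part is at least 1, which bounds the number of parts by their
      sum.\<close>
    have "size l \<le> sum_mset l"
    proof -
      have "\<forall>i\<in>#l. 1 \<le> i" using l by (simp add: partitions_def)
      then show ?thesis by (induction l) auto
    qed
    then have "length xs \<le> n" using l xs by (simp add: partitions_def sum_mset_sum_list)
    moreover have "set xs \<subseteq> {..n}" using part_le[OF l] xs by auto
    ultimately show "l \<in> mset ` {xs. set xs \<subseteq> {..n} \<and> length xs \<le> n}" using xs by blast
  qed
  show "finite (mset ` {xs. set xs \<subseteq> {..n} \<and> length xs \<le> n})"
    by (intro finite_imageI finite_lists_length_le) simp
qed

text \<open>The second component is the number of parts \<open>k\<close> that the bijections below
  trade away, and it is from this number that the trade is inverted.\<close>

lemma num_parts_eq_card: "num_parts k n = card (SIGMA l:partitions n. {1..count l k})"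
  by (simp add: num_parts_def finite_partitions)

text \<open>In this form the condition guarantees that removing the parts and adding them back
  restores the multiset.\<close>

lemma le_count_iff_replicate: "j \<le> count l k \<longleftrightarrow> replicate_mset j k \<subseteq># l"
  by (simp add: count_le_replicate_mset_subset_eq)

text \<open>A part \<open>p j\<close> is traded for \<open>j\<close> parts \<open>p\<close>.\<close>

lemma card_multiple_parts:
  assumes p: "p > 0"
  shows "card {(l, k). l \<in> partitions n \<and> k \<in># l \<and> p dvd k} = num_parts p n"
  unfolding num_parts_eq_card
proof (rule bij_betw_same_card, rule bij_betw_byWitness[where
      f = "\<lambda>(l, k). (l - {#k#} + replicate_mset (k div p) p, k div p)" and
      f' = "\<lambda>(l, j). (l - replicate_mset j p + {#p * j#}, p * j)"])
  let ?f = "\<lambda>(l, k). (l - {#k#} + replicate_mset (k div p) p, k div p)"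
  let ?g = "\<lambda>(l, j). (l - replicate_mset j p + {#p * j#}, p * j)"
  let ?A = "{(l, k). l \<in> partitions n \<and> k \<in># l \<and> p dvd k}"
  let ?B = "SIGMA l:partitions n. {1..count l p}"
  show "\<forall>a\<in>?A. ?g (?f a) = a" using p by auto
  show "\<forall>b\<in>?B. ?f (?g b) = b" using p by (auto simp: le_count_iff_replicate)
  show "?f ` ?A \<subseteq> ?B"
  proof safe
    fix l k assume l: "l \<in> partitions n" and k: "k \<in># l" and "p dvd k"
    then obtain j where j: "k = p * j" by auto
    obtain m where m: "l = add_mset k m" using k by (rule mset_add)
    have "1 \<le> k" using part_le[OF l k] by simp
    then have "1 \<le> j" using j by (cases j) auto
    then show "l - {#k#} + replicate_mset (k div p) p \<in> partitions n"
      using l p by (auto simp: partitions_def m j in_replicate_mset split: if_splits)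
    show "k div p \<in> {1..count (l - {#k#} + replicate_mset (k div p) p) p}"
      using \<open>1 \<le> j\<close> j p by simp
  qed
  show "?g ` ?B \<subseteq> ?A"
  proof safe
    fix l j assume l: "l \<in> partitions n" and j: "j \<in> {1..count l p}"
    obtain m where m: "l = replicate_mset j p + m"
      using j le_count_iff_replicate[of j l p] by (auto simp: mset_subset_eq_exists_conv)
    show "l - replicate_mset j p + {#p * j#} \<in> partitions n"
      using l j p by (auto simp: partitions_def m mult.commute)
  qed auto
qed

text \<open>Two equal parts \<open>k\<close> are traded for \<open>k\<close> parts \<open>2\<close>.\<close>

lemma card_repeated_parts:
  "card {(l, k). l \<in> partitions n \<and> 2 \<le> count l k} = num_parts 2 n"
  unfolding num_parts_eq_card
proof (rule bij_betw_same_card, rule bij_betw_byWitness[where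
      f = "\<lambda>(l, k). (l - replicate_mset 2 k + replicate_mset k 2, k)" and
      f' = "\<lambda>(l, k). (l - replicate_mset k 2 + replicate_mset 2 k, k)"])
  let ?f = "\<lambda>(l, k). (l - replicate_mset 2 k + replicate_mset k 2, k)"
  let ?g = "\<lambda>(l, k). (l - replicate_mset k 2 + replicate_mset 2 k, k)"
  let ?A = "{(l, k). l \<in> partitions n \<and> 2 \<le> count l k}"
  let ?B = "SIGMA l:partitions n. {1..count l 2}"
  show "\<forall>a\<in>?A. ?g (?f a) = a" by (auto simp: le_count_iff_replicate)
  show "\<forall>b\<in>?B. ?f (?g b) = b" by (auto simp: le_count_iff_replicate)
  show "?f ` ?A \<subseteq> ?B"
  proof safe
    fix l k assume l: "l \<in> partitions n" and k: "2 \<le> count l k"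
    obtain m where m: "l = replicate_mset 2 k + m"
      using k le_count_iff_replicate[of 2 l k] by (auto simp: mset_subset_eq_exists_conv)
    have "k \<in># l" using k by (simp add: count_greater_zero_iff[symmetric] del: count_greater_zero_iff)
    then have "1 \<le> k" using part_le[OF l] by simp
    then show "l - replicate_mset 2 k + replicate_mset k 2 \<in> partitions n"
      using l by (auto simp: partitions_def m in_replicate_mset split: if_splits)
    show "k \<in> {1..count (l - replicate_mset 2 k + replicate_mset k 2) 2}"
      using \<open>1 \<le> k\<close> by simp
  qed
  show "?g ` ?B \<subseteq> ?A"
  proof safe
    fix l k assume l: "l \<in> partitions n" and k: "k \<in> {1..count l 2}"
    obtain m where m: "l = replicate_mset k 2 + m"
      using k le_count_iff_replicate[of k l 2] by (auto simp: mset_subset_eq_exists_conv)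
    show "l - replicate_mset k 2 + replicate_mset 2 k \<in> partitions n"
      using l k by (auto simp: partitions_def m in_replicate_mset split: if_splits)
    show "2 \<le> count (l - replicate_mset k 2 + replicate_mset 2 k) k" by simp
  qed
qed

section \<open>The symmetric group\<close>

lemma fin_perm_sym: "x permutes {1..n::nat} \<Longrightarrow> fin_perm {1..n} x"
  by (simp add: fin_perm_def)

lemma centralizer_sym_group:
  assumes "x permutes {1..n}"
  shows "centralizer (sym_group n) x = fin_perm.Cent {1..n} x"
proof -
  interpret fin_perm "{1..n}" x by (rule fin_perm_sym[OF assms])
  show ?thesis unfolding centralizer_def Cent_def sym_group_def by simp
qed

text \<open>\<open>False\<close> marks the characters given by rotations, \<open>True\<close> those
  given by swaps.\<close>

definition index_set :: "nat \<Rightarrow> nat \<Rightarrow> ((nat multiset \<times> nat) \<times> bool) set" where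
  "index_set p n = {(l, k). l \<in> partitions n \<and> k \<in># l \<and> p dvd k} \<times> {False}
    \<union> (if p = 2 then {(l, k). l \<in> partitions n \<and> 2 \<le> count l k} \<times> {True} else {})"

lemma finite_index_set: "finite (index_set p n)"
proof -
  have "finite {(l, k). l \<in> partitions n \<and> k \<in># l}"
  proof (rule finite_subset)
    show "{(l, k). l \<in> partitions n \<and> k \<in># l} \<subseteq> partitions n \<times> {..n}"
      using part_le by auto
  qed (simp add: finite_partitions)
  then have "finite ({(l, k). l \<in> partitions n \<and> k \<in># l} \<times> (UNIV :: bool set))" by simp
  moreover have "index_set p n \<subseteq> {(l, k). l \<in> partitions n \<and> k \<in># l} \<times> UNIV"
    by (auto simp: index_set_def Suc_le_eq not_in_iff intro!: count_inI)
  ultimately show ?thesis by (rule rev_finite_subset)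
qed

lemma card_index_set:
  assumes "p > 0"
  shows "card (index_set p n) = (if p = 2 then 2 * num_parts 2 n else num_parts p n)"
proof (cases "p = 2")
  case True
  have "index_set p n = {(l, k). l \<in> partitions n \<and> k \<in># l \<and> p dvd k} \<times> {False}
    \<union> {(l, k). l \<in> partitions n \<and> 2 \<le> count l k} \<times> {True}" (is "_ = ?A \<union> ?B")
    using True by (simp add: index_set_def)
  moreover have "finite ?A" "finite ?B"
    using finite_index_set[of p n] True by (simp_all add: index_set_def)
  ultimately have "card (index_set p n) = card ?A + card ?B"
    by (simp only:) (rule card_Un_disjoint, auto)
  then show ?thesis
    using card_multiple_parts[of p n] card_repeated_parts[of n] True by (simp add: card_cartesian_product)
next
  case False
  then show ?thesis
    using card_multiple_parts[OF assms, of n] by (simp add: index_set_def card_cartesian_product)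
qed

theorem HH1_sym_group:
  assumes p: "prime p"
  shows "vectorspace (prime_field p) (HH (prime_field p) 1 (sym_group_algebra p n)) \<and>
    vectorspace.fin_dim (prime_field p) (HH (prime_field p) 1 (sym_group_algebra p n)) \<and>
    vectorspace.dim (prime_field p) (HH (prime_field p) 1 (sym_group_algebra p n)) = card (index_set p n)"
proof -
  let ?S = "{1..n}" and ?k = "prime_field p" and ?G = "sym_group n"
  interpret rp: residues_prime p ?k by unfold_locales (use p in auto)
  interpret G: group ?G by (rule sym_group_is_group)
  have finG: "finite (carrier ?G)" using finite_permutations[of ?S] by (simp add: sym_group_def)
  interpret GA: group_algebra ?k ?G
    by (intro group_algebra.intro cring_monoid.intro group_algebra_axioms.intro finG
        rp.cring G.monoid_axioms G.group_axioms)
  \<comment> \<open>One permutation of each cycle type represents the conjugacy classes.\<close>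
  have "\<forall>l\<in>partitions n. \<exists>x. fin_perm ?S x \<and> fin_perm.has_type ?S x l"
    using ex_perm_of_type[of ?S] by (fastforce simp: partitions_def)
  then obtain xp where xp: "\<And>l. l \<in> partitions n \<Longrightarrow> fin_perm ?S (xp l)"
    "\<And>l. l \<in> partitions n \<Longrightarrow> fin_perm.has_type ?S (xp l) l" by metis
  have xp_perm: "xp l permutes ?S" if "l \<in> partitions n" for l using xp(1)[OF that] by (simp add: fin_perm_def)
  \<comment> \<open>An index stores a partition, while the coordinates are grouped by
    representatives; injectivity recovers the first from the second.\<close>
  have xp_inj: "l = l'" if "l \<in> partitions n" "l' \<in> partitions n" "xp l = xp l'" for l l'
    using has_type_unique[OF xp(1)[OF that(1)] xp(1)[OF that(2)] xp(2)[OF that(1)] xp(2)[OF that(2)],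
        of id] that(3) by (simp add: permutes_id)
  define b where "b l k = (SOME b. b \<in> fin_perm.reps ?S (xp l) k)" for l k
  define b' where "b' l k = (SOME b'. b' \<in> fin_perm.reps ?S (xp l) k \<and> b' \<noteq> b l k)" for l k
  \<comment> \<open>\<open>False\<close> yields the rotation of one cycle of length
    \<open>k\<close>, \<open>True\<close> the swap of two distinct cycles of length \<open>k\<close>
    at their origins.\<close>
  define \<gamma> where "\<gamma> i = (case i of ((l, k), f) \<Rightarrow>
    fin_perm.mv (xp l) (b l k) (if f then b' l k else xp l (b l k)))" for i
  define \<rho> where "\<rho> i = xp (fst (fst i))" for i :: "(nat multiset \<times> nat) \<times> bool"
  have b: "b l k \<in> fin_perm.reps ?S (xp l) k" if "l \<in> partitions n" "k \<in># l" for l k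
  proof -
    interpret fin_perm ?S "xp l" by (rule xp(1)[OF that(1)])
    have "card (reps k) > 0" using has_type_count[OF xp(2)[OF that(1)], of k] that(2) by (metis count_greater_zero_iff)
    then obtain c where "c \<in> reps k" by (metis card.empty equals0I less_irrefl)
    then show ?thesis unfolding b_def by (rule someI)
  qed
  have b': "b' l k \<in> fin_perm.reps ?S (xp l) k \<and> b' l k \<noteq> b l k"
    if "l \<in> partitions n" "2 \<le> count l k" for l k
  proof -
    interpret fin_perm ?S "xp l" by (rule xp(1)[OF that(1)])
    have "card (reps k) \<ge> 2" using has_type_count[OF xp(2)[OF that(1)], of k] that(2) by simp
    then have "\<not> reps k \<subseteq> {b l k}" using card_mono[of "{b l k}" "reps k"] by auto
    then obtain c where "c \<in> reps k \<and> c \<noteq> b l k" by blast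
    then show ?thesis unfolding b'_def by (rule someI)
  qed
  have ix: "l \<in> partitions n \<and> k \<in># l \<and> (f \<longrightarrow> p = 2 \<and> 2 \<le> count l k) \<and> (\<not> f \<longrightarrow> p dvd k)"
    if "((l, k), f) \<in> index_set p n" for l k f
    using that by (auto simp: index_set_def split: if_splits intro!: count_inI)
  have kc: "carrier ?k = {0..int p - 1}" and kz: "zero ?k = 0" and ka: "add ?k = (\<lambda>a b. (a + b) mod int p)"
    by (simp_all add: residue_ring_def)
  have p0: "int p > 0" using p prime_gt_0_nat by simp
  \<comment> \<open>Field elements are canonical residues, so congruent ones coincide.\<close>
  have small: "u = v" if "[u = v] (mod int p)" "u \<in> {0..int p - 1}" "v \<in> {0..int p - 1}" for u v
    using that by (simp add: cong_def)
  show ?thesis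
  proof (rule GA.HH1_group_algebra_dim[OF rp.is_field finite_index_set, where Rep = "xp ` partitions n"
        and \<rho> = \<rho> and \<gamma> = \<gamma>])
    show "\<rho> i \<in> xp ` partitions n" if "i \<in> index_set p n" for i
      using ix[of "fst (fst i)" "snd (fst i)" "snd i"] that by (simp add: \<rho>_def)
    show "xp ` partitions n \<subseteq> carrier ?G" using xp_perm by (auto simp: sym_group_def)
    show "\<gamma> i \<in> centralizer ?G (\<rho> i)" if i: "i \<in> index_set p n" for i
    proof -
      obtain l k f where lkf: "i = ((l, k), f)" by (metis surj_pair)
      note h = ix[OF i[unfolded lkf]]
      interpret fin_perm ?S "xp l" by (rule xp(1)) (use h in simp)
      have "b l k \<in> reps k" using b h by simp
      moreover have "b' l k \<in> reps k" if f using b' h that by simp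
      ultimately have "\<gamma> i \<in> Cent"
        using repsD[of "b l k" k] repsD[of "b' l k" k] permutes_in_image[OF x, of "b l k"]
          L_orb[of "xp l (b l k)" "b l k"]
        by (cases f) (simp_all add: \<gamma>_def lkf mv_Cent del: One_nat_def atLeastAtMost_iff)
      then show ?thesis using centralizer_sym_group[OF xp_perm] h by (simp add: \<rho>_def lkf)
    qed
    show "\<exists>x\<in>xp ` partitions n. \<exists>g\<in>carrier ?G. y = inv\<^bsub>?G\<^esub> g \<otimes>\<^bsub>?G\<^esub> x \<otimes>\<^bsub>?G\<^esub> g" if y: "y \<in> carrier ?G" for y
    proof -
      have yp: "fin_perm ?S y" using y fin_perm_sym by (simp add: sym_group_def)
      obtain l where l: "l \<in> partitions n" "fin_perm.has_type ?S y l"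
        using fin_perm.has_type_exists[OF yp] by auto
      obtain \<theta> where \<theta>: "\<theta> permutes ?S" "\<forall>z. \<theta> (y z) = xp l (\<theta> z)"
        using has_type_conjugate[OF yp xp(1)[OF l(1)] l(2) xp(2)[OF l(1)]] by blast
      have \<theta>G: "\<theta> \<in> carrier ?G" using \<theta>(1) by (simp add: sym_group_def)
      have xG: "xp l \<in> carrier ?G" using xp_perm[OF l(1)] by (simp add: sym_group_def)
      have "\<theta> \<otimes>\<^bsub>?G\<^esub> y = xp l \<otimes>\<^bsub>?G\<^esub> \<theta>" using \<theta>(2) by (simp add: sym_group_def fun_eq_iff)
      then have "y = inv\<^bsub>?G\<^esub> \<theta> \<otimes>\<^bsub>?G\<^esub> (xp l \<otimes>\<^bsub>?G\<^esub> \<theta>)"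
        using G.inv_solve_left[OF y \<theta>G G.m_closed[OF xG \<theta>G]] by simp
      then have "y = inv\<^bsub>?G\<^esub> \<theta> \<otimes>\<^bsub>?G\<^esub> xp l \<otimes>\<^bsub>?G\<^esub> \<theta>"
        using G.m_assoc[OF G.inv_closed[OF \<theta>G] xG \<theta>G] by (simp only:)
      then show ?thesis using l(1) \<theta>G by blast
    qed
    show "x' = x" if x: "x \<in> xp ` partitions n" and x': "x' \<in> xp ` partitions n" and g: "g \<in> carrier ?G"
      and conj: "x' = inv\<^bsub>?G\<^esub> g \<otimes>\<^bsub>?G\<^esub> x \<otimes>\<^bsub>?G\<^esub> g" for x x' g
    proof -
      obtain l l' where l: "l \<in> partitions n" "x = xp l" "l' \<in> partitions n" "x' = xp l'" using x x' by blast
      have xG: "x \<in> carrier ?G" using xp_perm l by (simp add: sym_group_def)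
      have "g \<otimes>\<^bsub>?G\<^esub> x' = g \<otimes>\<^bsub>?G\<^esub> (inv\<^bsub>?G\<^esub> g \<otimes>\<^bsub>?G\<^esub> (x \<otimes>\<^bsub>?G\<^esub> g))"
        unfolding conj using G.m_assoc[OF G.inv_closed[OF g] xG g] by (simp only:)
      also have "\<dots> = x \<otimes>\<^bsub>?G\<^esub> g" using GA.cancel(1)[OF g G.m_closed[OF xG g]] .
      finally have "\<And>z. g (x' z) = x (g z)" by (simp add: sym_group_def fun_eq_iff)
      then have "l = l'"
        using has_type_unique[OF xp(1)[OF l(1)] xp(1)[OF l(3)] xp(2)[OF l(1)] xp(2)[OF l(3)]] g l
        by (simp add: sym_group_def)
      then show ?thesis using l by simp
    qed
  next
    fix x f c
    assume "x \<in> xp ` partitions n" and f: "f \<in> additive_chars ?G (centralizer ?G x) ?k"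
      and zero: "\<And>i. \<lbrakk>i \<in> index_set p n; \<rho> i = x\<rbrakk> \<Longrightarrow> f (\<gamma> i) = \<zero>\<^bsub>?k\<^esub>" and c: "c \<in> centralizer ?G x"
    then obtain l where l: "l \<in> partitions n" "x = xp l" by blast
    interpret fin_perm ?S "xp l" by (rule xp(1)[OF l(1)])
    have C: "centralizer ?G x = Cent" unfolding l(2) by (rule centralizer_sym_group[OF xp_perm[OF l(1)]])
    have fc: "f \<sigma> \<in> {0..int p - 1}" if "\<sigma> \<in> Cent" for \<sigma>
      using f that unfolding additive_chars_def C kc by blast
    have "f \<in> Cent_chars p"
      using f unfolding additive_chars_def C Cent_chars_def ka sym_group_mult by (simp add: cong_def)
    then have "[f c = 0] (mod int p)"
    proof (rule char_detect[OF p])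
      fix u assume u: "u \<in> ?S" "p dvd L u"
      have "count l (L u) > 0"
        using has_type_count[OF xp(2)[OF l(1)], of "L u"] repsI[OF u(1)] finite_reps by (simp add: card_gt_0_iff) blast
      then have k: "L u \<in># l" by simp
      then have "((l, L u), False) \<in> index_set p n" using l u by (simp add: index_set_def)
      then have "f (\<gamma> ((l, L u), False)) = 0" using zero l(2) kz by (simp add: \<rho>_def)
      then show "\<exists>b\<in>?S. L b = L u \<and> [f (mv b (xp l b)) = 0] (mod int p)"
        using repsD[OF b[OF l(1) k]] by (intro bexI[of _ "b l (L u)"]) (simp_all add: \<gamma>_def)
    next
      fix u v assume uv: "p = 2" "u \<in> ?S" "v \<in> ?S" "L u = L v" "v \<notin> orb u"
      \<comment> \<open>Two different cycles of the same length show that this length is a repeated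
        part, so the index with flag \<open>True\<close> exists.\<close>
      have "rp u \<noteq> rp v" using uv(5) orb_rp mem_orb(2) by metis
      moreover have "rp u \<in> reps (L u)" "rp v \<in> reps (L u)" using repsI[OF uv(2)] repsI[OF uv(3)] uv(4) by simp_all
      ultimately have "card {rp u, rp v} \<le> card (reps (L u))" by (intro card_mono finite_reps) simp
      then have k: "2 \<le> count l (L u)"
        using \<open>rp u \<noteq> rp v\<close> has_type_count[OF xp(2)[OF l(1)], of "L u"] by simp
      then have k': "L u \<in># l" by (intro count_inI) auto
      have "((l, L u), True) \<in> index_set p n" using l uv k by (simp add: index_set_def)
      then have "f (\<gamma> ((l, L u), True)) = 0" using zero l(2) kz by (simp add: \<rho>_def)
      moreover have "b' l (L u) \<notin> orb (b l (L u))"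
        using rep_orb_eq repsD[OF b[OF l(1) k']] repsD[OF b'[OF l(1) k, THEN conjunct1]] b'[OF l(1) k] by metis
      ultimately show "\<exists>b\<in>?S. \<exists>b'\<in>?S. L b = L u \<and> L b' = L u \<and> b' \<notin> orb b \<and> [f (mv b b') = 0] (mod int p)"
        using repsD[OF b[OF l(1) k']] repsD[OF b'[OF l(1) k, THEN conjunct1]]
        by (intro bexI[of _ "b l (L u)"] bexI[of _ "b' l (L u)"]) (simp_all add: \<gamma>_def)
    next
      show "c \<in> Cent" using c C by simp
    qed
    then show "f c = \<zero>\<^bsub>?k\<^esub>" using small[of "f c" 0] fc c C kz p0 by simp
  next
    fix x and w :: "(nat multiset \<times> nat) \<times> bool \<Rightarrow> int"
    assume "x \<in> xp ` partitions n" and w: "\<And>i. i \<in> index_set p n \<Longrightarrow> w i \<in> carrier ?k"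
    then obtain l where l: "l \<in> partitions n" "x = xp l" by blast
    interpret fin_perm ?S "xp l" by (rule xp(1)[OF l(1)])
    have C: "centralizer ?G x = Cent" unfolding l(2) by (rule centralizer_sym_group[OF xp_perm[OF l(1)]])
    obtain f where f: "f \<in> Cent_chars p"
      "\<And>u. \<lbrakk>u \<in> ?S; L u \<in> set_mset l; p dvd L u\<rbrakk> \<Longrightarrow> [f (mv u (xp l u)) = w ((l, L u), False)] (mod int p)"
      "\<And>k b b'. \<lbrakk>p = 2; k \<in># l; b \<in> reps k; b' \<in> reps k; b \<noteq> b'\<rbrakk> \<Longrightarrow> [f (mv b b') = w ((l, k), True)] (mod int p)"
      using char_exist[of "set_mset l" p "\<lambda>k. w ((l, k), False)" "\<lambda>k. w ((l, k), True)"] by auto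
    \<comment> \<open>Only now is the integer valued character reduced to canonical
      residues.\<close>
    have "(\<lambda>\<sigma>. f \<sigma> mod int p) \<in> additive_chars ?G (centralizer ?G x) ?k"
      using f(1) p0 unfolding additive_chars_def C Cent_chars_def ka kc sym_group_mult
      by (auto simp: cong_def mod_add_eq)
    moreover have "f (\<gamma> i) mod int p = w i" if i: "i \<in> index_set p n" "\<rho> i = x" for i
    proof -
      obtain l' k fl where lkf: "i = ((l', k), fl)" by (metis surj_pair)
      note h = ix[OF i(1)[unfolded lkf]]
      have l': "l' = l" using xp_inj[of l' l] h l i(2) by (simp add: \<rho>_def lkf)
      note h = h[unfolded l']
      have br: "b l k \<in> reps k" using b h by simp
      have "[f (\<gamma> i) = w i] (mod int p)"
      proof (cases fl)
        case True
        then show ?thesis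
          using f(3)[of k "b l k" "b' l k"] b'[of l k] h br by (simp add: \<gamma>_def lkf l')
      next
        case False
        then show ?thesis using f(2)[of "b l k"] repsD[OF br] h by (simp add: \<gamma>_def lkf l')
      qed
      then have "[f (\<gamma> i) mod int p = w i] (mod int p)" by (simp add: cong_def)
      then show ?thesis using small[of "f (\<gamma> i) mod int p" "w i"] w[OF i(1)] p0 kc by simp
    qed
    ultimately show "\<exists>f\<in>additive_chars ?G (centralizer ?G x) ?k. \<forall>i\<in>index_set p n. \<rho> i = x \<longrightarrow> f (\<gamma> i) = w i"
      by (intro bexI[of _ "\<lambda>\<sigma>. f \<sigma> mod int p"]) simp_all
  qed
qed

theorem corollary4p7:
  fixes p n :: nat
  assumes "prime p" and "n > 0"
  shows "vectorspace (prime_field p) (HH (prime_field p) 1 (sym_group_algebra p n)) \<and>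
         vectorspace.fin_dim (prime_field p) (HH (prime_field p) 1 (sym_group_algebra p n)) \<and>
         vectorspace.dim (prime_field p) (HH (prime_field p) 1 (sym_group_algebra p n)) =
           (if p = 2 then 2 * num_parts 2 n else num_parts p n)"
  using HH1_sym_group[OF assms(1), of n] card_index_set[OF prime_gt_0_nat[OF assms(1)], of n] by simp

end
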